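(* Let $\ell\geq 1$ and fix a seed graph $G(0)$ with $s\geq1$ vertices labelled $1,\dots,s$ and positive integer initial weights $d_1,\dots,d_s$. Let $m_k=\sum_{i=1}^k d_i$ for $1\leq k\leq s$. Assume that either (i) $(G(n))_{n\ge0}$ evolves according to Model N$_\ell$, in which case set $a_k=m_s+(\ell+1)(k-s)+\ell$ for $k\geq s$; or (ii) $(G(n))_{n\ge0}$ evolves according to Model L$_\ell$, in which case set $a_k=m_s+(\ell+1)(k-s)$ for $k\geq s$. Fix $r\geq s$ and let $B_1,\dots,B_{r-1}$ and $Z_r$ be independent random variables with $B_k\sim\mathrm{Beta}(m_k,d_{k+1})$ for $1\leq k<s$, $B_k\sim\mathrm{Beta}(a_k,1)$ for $s\leq k\leq r-1$, and $Z_r\sim\mathrm{GGa}(a_r,\ell+1)$. Define $Z_k=B_kB_{k+1}\cdots B_{r-1}Z_r$ for $1\leq k<r$, and $Y=(Z_1,Z_2-Z_1,\dots,Z_r-Z_{r-1})$. Let $d_k(n)$ denote the weight of vertex $k$ in $G(n)$ and $$D(n)=(D_1(n),\dots,D_r(n))=\frac{1}{(\ell+1)n^{\ell/(\ell+1)}}\big(d_1(n),\dots,d_r(n)\big).$$ Then there is a constant $C>0$ (depending on $r,\ell$ and the seed, but not on $n$) such that for all $n\geq1$, $$\sup_K\big|\mathbb{P}[D(n)\in K]-\mathbb{P}[Y\in K]\big|\leq \frac{C}{n^{\ell/(\ell+1)}},$$ where the supremum is over all convex subsets $K\subset\mathbb{R}^r$.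
   Context: Weights: each vertex is born with weight $1$ (except seed vertices, which have the given initial weights), and each time a vertex receives an edge its weight increases by one. Model N$_\ell$: given $G(n-1)$ with vertices $1,\dots,s+n-1$ and weights $d_i(n-1)$, form $G(n)$ by adding a vertex $s+n$ and sequentially attaching $\ell$ edges from it to vertices among $1,\dots,s+n-1$: each edge attaches to vertex $k$ with probability proportional to the current weight of $k$, where the weight of the vertex receiving an edge is increased by one immediately (before the next edge is attached). After all $\ell$ edges are attached, vertex $s+n$ is given weight $d_{s+n}(n)=1$. Multiple edges are allowed. Model L$_\ell$: given $G(n-1)$, add a vertex $s+n$ with weight $1$ and sequentially attach $\ell$ edges from it to vertices among $1,\dots,s+n$ (loops allowed): each edge attaches to vertex $k$ with probability proportional to the current weight of $k$ (including the new vertex), and the weight of the receiving vertex is increased by one immediately. $\mathrm{GGa}(a,b)$ ($a,b>0$) denotes the distribution on $(0,\infty)$ with density proportional to $x^{a-1}e^{-x^b}$. $\mathrm{Beta}(a,b)$ denotes the distribution on $(0,1)$ with density proportional to $x^{a-1}(1-x)^{b-1}$. *)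

theory Defs
  imports "HOL-Analysis.Analysis" "HOL-Probability.Probability"
begin

section \<open>The random graph processes (only vertex weights matter)\<close>

text \<open>A state is a weight vector w :: nat => nat; vertex k has weight w k
  (vertices that do not exist yet have weight 0).\<close>

definition attach1 :: "nat set \<Rightarrow> (nat \<Rightarrow> nat) \<Rightarrow> (nat \<Rightarrow> nat) pmf" where
  "attach1 V w = map_pmf (\<lambda>k. w(k := Suc (w k)))
      (pmf_of_multiset (\<Sum>k\<in>V. replicate_mset (w k) k))"

fun attach :: "nat \<Rightarrow> nat set \<Rightarrow> (nat \<Rightarrow> nat) \<Rightarrow> (nat \<Rightarrow> nat) pmf" where
  "attach 0 V w = return_pmf w"
| "attach (Suc j) V w = bind_pmf (attach1 V w) (attach j V)"

datatype model = Model_N | Model_L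

text \<open>Step producing G(n) from G(n-1) (n >= 1): new vertex s+n.\<close>
fun step :: "model \<Rightarrow> nat \<Rightarrow> nat \<Rightarrow> nat \<Rightarrow> (nat \<Rightarrow> nat) \<Rightarrow> (nat \<Rightarrow> nat) pmf" where
  "step Model_N l s n w = map_pmf (\<lambda>w'. w'(s + n := 1)) (attach l {1..s + n - 1} w)"
| "step Model_L l s n w = attach l {1..s + n} (w(s + n := 1))"

fun weights :: "model \<Rightarrow> nat \<Rightarrow> nat \<Rightarrow> (nat \<Rightarrow> nat) \<Rightarrow> nat \<Rightarrow> (nat \<Rightarrow> nat) pmf" where
  "weights M l s d 0 = return_pmf (\<lambda>k. if k \<in> {1..s} then d k else 0)"
| "weights M l s d (Suc n) = bind_pmf (weights M l s d n) (step M l s (Suc n))"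

definition prop_density :: "(real \<Rightarrow> real) \<Rightarrow> real measure" where
  "prop_density f = density lborel (\<lambda>x. ennreal (f x / integral\<^sup>L lborel f))"

definition beta_distr :: "real \<Rightarrow> real \<Rightarrow> real measure" where
  "beta_distr a b = prop_density
     (\<lambda>x. indicator {0<..<1} x * x powr (a - 1) * (1 - x) powr (b - 1))"

definition gga_distr :: "real \<Rightarrow> real \<Rightarrow> real measure" where
  "gga_distr a b = prop_density
     (\<lambda>x. indicator {0<..} x * x powr (a - 1) * exp (- (x powr b)))"

definition m_seq :: "(nat \<Rightarrow> nat) \<Rightarrow> nat \<Rightarrow> nat" where
  "m_seq d k = (\<Sum>i=1..k. d i)"

definition a_seq :: "model \<Rightarrow> nat \<Rightarrow> nat \<Rightarrow> (nat \<Rightarrow> nat) \<Rightarrow> nat \<Rightarrow> nat" where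
  "a_seq M l s d k = m_seq d s + (l + 1) * (k - s) + (if M = Model_N then l else 0)"

text \<open>Laws of the independent factors: omega k = B_k for 1 <= k < r, omega r = Z_r.\<close>
definition factor_distr :: "model \<Rightarrow> nat \<Rightarrow> nat \<Rightarrow> (nat \<Rightarrow> nat) \<Rightarrow> nat \<Rightarrow> nat \<Rightarrow> real measure" where
  "factor_distr M l s d r k =
     (if k < s then beta_distr (m_seq d k) (d (k + 1))
      else if k < r then beta_distr (a_seq M l s d k) 1
      else gga_distr (a_seq M l s d r) (l + 1))"

definition Zvar :: "nat \<Rightarrow> (nat \<Rightarrow> real) \<Rightarrow> nat \<Rightarrow> real" where
  "Zvar r \<omega> k = (if k = 0 then 0 else (\<Prod>j\<in>{k..<r}. \<omega> j) * \<omega> r)"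

text \<open>Vectors of R^r are represented as functions nat => real supported on {1..r}.\<close>
definition Yvar :: "nat \<Rightarrow> (nat \<Rightarrow> real) \<Rightarrow> nat \<Rightarrow> real" where
  "Yvar r \<omega> = (\<lambda>i. if i \<in> {1..r} then Zvar r \<omega> i - Zvar r \<omega> (i - 1) else 0)"

definition Y_law :: "model \<Rightarrow> nat \<Rightarrow> nat \<Rightarrow> (nat \<Rightarrow> nat) \<Rightarrow> nat \<Rightarrow> (nat \<Rightarrow> real) measure" where
  "Y_law M l s d r =
     completion (distr (PiM {1..r} (factor_distr M l s d r)) (PiM UNIV (\<lambda>_. borel)) (Yvar r))"

definition Rvec :: "nat \<Rightarrow> (nat \<Rightarrow> real) set" where
  "Rvec r = {x. \<forall>i. i \<notin> {1..r} \<longrightarrow> x i = 0}"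

definition convex_in :: "nat \<Rightarrow> (nat \<Rightarrow> real) set \<Rightarrow> bool" where
  "convex_in r K \<longleftrightarrow> K \<subseteq> Rvec r \<and>
     (\<forall>x\<in>K. \<forall>y\<in>K. \<forall>u::real. 0 \<le> u \<and> u \<le> 1 \<longrightarrow> (\<lambda>i. u * x i + (1 - u) * y i) \<in> K)"

definition Dvec :: "nat \<Rightarrow> nat \<Rightarrow> nat \<Rightarrow> (nat \<Rightarrow> nat) \<Rightarrow> nat \<Rightarrow> real" where
  "Dvec l r n w = (\<lambda>i. if i \<in> {1..r}
      then real (w i) / ((real l + 1) * real n powr (real l / (real l + 1))) else 0)"

end

theory Submission
  imports Defs
begin

text \<open>In terms of the partial sums \<open>S\<^sub>k = d\<^sub>1(n) + \<dots> + d\<^sub>k(n)\<close> the weights form a Markov chain running downwards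
  from \<open>S\<^sub>r\<close>: given \<open>S\<^sub>k\<^sub>+\<^sub>1\<close>, the sum \<open>S\<^sub>k\<close> is a Polya urn, and \<open>S\<^sub>r\<close> is an urn with immigration. The
  variables \<open>Z\<^sub>k\<close> form the analogous chain with beta factors. The two chains are exchanged one coordinate
  at a time. With the other coordinates fixed, a convex set restricts the exchanged one to an interval, so
  that only one-dimensional Kolmogorov distances are needed: \<open>O(1/S\<^sub>k\<^sub>+\<^sub>1)\<close> for a Polya urn, where
  \<open>1/(S - 1)\<close> has explicit expectation, and \<open>O(n powr (- l / (l + 1)))\<close> for the urn with immigration.

  For the latter, the probabilities are \<open>(a + j - 1 choose j) * g j\<close> with a decreasing \<open>g\<close> satisfying an
  exact identity between the increments of \<open>g\<close> after \<open>n + 1\<close> rounds and \<open>g\<close> after \<open>n\<close> rounds. Monotonicity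
  turns it into a two-sided inequality for a single \<open>n\<close>, a discrete version of
  \<open>g' = - (l + 1) x\<^sup>l g\<close>, which forces \<open>g\<close> to be close to a multiple of \<open>exp (- x ^ (l + 1))\<close>.\<close>

section \<open>Intervals\<close>

text \<open>Partial sums and \<open>increments\<close> are linear, so convexity survives the passage
  to sums. Two difficulties shape the rest. A convex set need not be Borel, so one works with the
  interior and closure of its preimage under \<open>increments\<close>. These live in the full
  product space, where a set that fixes coordinates outside \<open>{1..r}\<close> has empty
  interior; hence the cylinders \<open>depends_on\<close>. Both have the same probability because
  the factors have no atoms. Secondly, the error of a Polya kernel is of order \<open>1 / S\<close>
  with \<open>S\<close> random. The mean of \<open>1 / (S - 1)\<close> is multiplied by
  \<open>1 - 1 / T\<close> in each draw, so a bound \<open>C / (S - 1)\<close> keeps its form along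
  the chain and becomes the rate at the top.

  For \<open>k \<ge> s\<close>, \<open>a_k\<close> is the total weight when vertex
  \<open>k + 1\<close> first competes with its predecessors. In Model N the edges of its own round
  still all go to older vertices, whence the additional \<open>l\<close>. The graph follows the urn
  only after a fixed delay; the finitely many earlier \<open>n\<close> enlarge the constant.

  The urn is compared at its own scale \<open>urn_scale\<close>, where the inequality for
  \<open>g\<close> has no constants left; the power of \<open>n\<close> differs from it by a
  relative error \<open>O(1 / n)\<close>.\<close>

lemma down_closed_real_cases:
  fixes D :: "real set"
  assumes "\<And>x y. y \<in> D \<Longrightarrow> x \<le> y \<Longrightarrow> x \<in> D"
  shows "D = {} \<or> D = UNIV \<or> (\<exists>t. D = {..t}) \<or> (\<exists>t. D = {..<t})"
proof (cases "D = {} \<or> \<not> bdd_above D")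
  case True
  show ?thesis
  proof (cases "D = {}")
    case False
    with True have "\<not> bdd_above D" by blast
    hence "x \<in> D" for x
      using assms[of _ x] unfolding bdd_above_def by (meson linear)
    thus ?thesis by blast
  qed simp
next
  case False
  hence ne: "D \<noteq> {}" and bd: "bdd_above D" by auto
  have low: "x \<in> D" if "x < Sup D" for x
    using less_cSup_iff[OF ne bd, of x] that assms by force
  have up: "x \<le> Sup D" if "x \<in> D" for x
    using cSup_upper[OF that bd] .
  show ?thesis
  proof (cases "Sup D \<in> D")
    case True
    hence "D = {..Sup D}" using assms up by auto
    thus ?thesis by blast
  next
    case nin: False
    have "D = {..<Sup D}"
    proof (intro set_eqI iffI)
      fix x assume "x \<in> D"
      with up[OF this] nin show "x \<in> {..<Sup D}" by (cases "x = Sup D") auto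
    qed (use low in auto)
    thus ?thesis by blast
  qed
qed

text \<open>Reduces measurability and discrepancy of intervals to down-closed sets, that is, to half
  lines and trivial sets.\<close>

lemma real_interval_eq_Diff:
  fixes J :: "real set"
  assumes J: "is_interval J"
  obtains D L where "J = D - L" "L \<subseteq> D" "\<And>x y. y \<in> D \<Longrightarrow> x \<le> y \<Longrightarrow> x \<in> D" "\<And>x y. y \<in> L \<Longrightarrow> x \<le> y \<Longrightarrow> x \<in> L"
proof
  define D where "D = {x. \<exists>y\<in>J. x \<le> y}"
  \<comment> \<open>The second conjunct covers empty \<open>J\<close>, where the first holds
    vacuously and \<open>L\<close> would be everything while \<open>D\<close> is empty.\<close>
  define L where "L = {x. (\<forall>y\<in>J. x < y) \<and> J \<noteq> {}}"
  show "J = D - L"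
  proof (intro set_eqI iffI)
    fix x assume "x \<in> D - L"
    then obtain y z where "y \<in> J" "x \<le> y" "z \<in> J" "z \<le> x"
      unfolding D_def L_def by fastforce
    thus "x \<in> J" using J unfolding is_interval_1 by blast
  qed (auto simp: D_def L_def)
  show "L \<subseteq> D" by (auto simp: L_def D_def less_imp_le)
  show "y \<in> D \<Longrightarrow> x \<le> y \<Longrightarrow> x \<in> D" for x y by (auto simp: D_def intro: order_trans)
  show "y \<in> L \<Longrightarrow> x \<le> y \<Longrightarrow> x \<in> L" for x y by (auto simp: L_def)
qed

lemma real_interval_borel:
  fixes J :: "real set"
  assumes "is_interval J"
  shows "J \<in> sets borel"
proof -
  obtain D L where DL: "J = D - L" "\<And>x y. y \<in> D \<Longrightarrow> x \<le> y \<Longrightarrow> x \<in> D" "\<And>x y. y \<in> L \<Longrightarrow> x \<le> y \<Longrightarrow> x \<in> L"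
    by (rule real_interval_eq_Diff[OF assms]) (rule that; assumption)
  have D: "D = {} \<or> D = UNIV \<or> (\<exists>t. D = {..t}) \<or> (\<exists>t. D = {..<t})"
    by (rule down_closed_real_cases) (rule DL(2))
  have L: "L = {} \<or> L = UNIV \<or> (\<exists>t. L = {..t}) \<or> (\<exists>t. L = {..<t})"
    by (rule down_closed_real_cases) (rule DL(3))
  from D L have "D \<in> sets borel" "L \<in> sets borel" by auto
  thus ?thesis unfolding DL(1) by simp
qed

text \<open>By the classification only half lines matter. An open one is an increasing union of
  closed ones, so the bound on distribution functions passes to the limit.\<close>

lemma down_closed_discrepancy:
  fixes \<mu> \<nu> :: "real measure"
  assumes "prob_space \<mu>" "prob_space \<nu>" and [measurable_cong]: "sets \<mu> = sets borel" "sets \<nu> = sets borel"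
    and cdf: "\<And>t. \<bar>measure \<mu> {..t} - measure \<nu> {..t}\<bar> \<le> \<delta>"
    and dc: "\<And>x y. y \<in> D \<Longrightarrow> x \<le> y \<Longrightarrow> x \<in> D"
  shows "D \<in> sets borel \<and> \<bar>measure \<mu> D - measure \<nu> D\<bar> \<le> \<delta>"
proof -
  interpret m: prob_space \<mu> by fact
  interpret n: prob_space \<nu> by fact
  have sp: "space \<mu> = UNIV" "space \<nu> = UNIV"
    using assms(3,4) sets_eq_imp_space_eq by (metis space_borel)+
  have \<delta>0: "\<delta> \<ge> 0" using cdf[of 0] by linarith
  have lt: "\<bar>measure \<mu> {..<t} - measure \<nu> {..<t}\<bar> \<le> \<delta>" for t
  proof -
    let ?A = "\<lambda>n::nat. {..t - 1 / real (Suc n)}"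
    have inc: "incseq ?A"
      by (intro monoI) (auto simp: frac_le intro: order_trans)
    have U: "(\<Union>n. ?A n) = {..<t}"
    proof (intro set_eqI iffI)
      fix x assume "x \<in> {..<t}"
      hence "t - x > 0" by simp
      then obtain n where "inverse (real (Suc n)) < t - x" using reals_Archimedean by blast
      thus "x \<in> (\<Union>n. ?A n)" by (auto simp: inverse_eq_divide intro!: exI[of _ n])
    next
      fix x assume "x \<in> (\<Union>n. ?A n)"
      then obtain n where "x \<le> t - 1 / real (Suc n)" by auto
      moreover have "1 / real (Suc n) > 0" by simp
      ultimately show "x \<in> {..<t}" unfolding lessThan_iff by linarith
    qed
    have "(\<lambda>n. measure \<mu> (?A n)) \<longlonglongrightarrow> measure \<mu> {..<t}"
      using m.finite_Lim_measure_incseq[OF _ inc] U by (simp add: assms(3) image_subset_iff)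
    moreover have "(\<lambda>n. measure \<nu> (?A n)) \<longlonglongrightarrow> measure \<nu> {..<t}"
      using n.finite_Lim_measure_incseq[OF _ inc] U by (simp add: assms(4) image_subset_iff)
    ultimately have "(\<lambda>n. \<bar>measure \<mu> (?A n) - measure \<nu> (?A n)\<bar>) \<longlonglongrightarrow> \<bar>measure \<mu> {..<t} - measure \<nu> {..<t}\<bar>"
      by (intro tendsto_intros)
    thus ?thesis by (rule LIMSEQ_le_const2) (use cdf in blast)
  qed
  have "measure \<mu> UNIV = 1" "measure \<nu> UNIV = 1"
    using m.prob_space n.prob_space sp by simp_all
  thus ?thesis
    using down_closed_real_cases[of D] dc lt cdf \<delta>0 by force
qed

text \<open>One \<open>\<delta>\<close> for each end of the interval.\<close>

lemma interval_discrepancy: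
  fixes \<mu> \<nu> :: "real measure"
  assumes p: "prob_space \<mu>" "prob_space \<nu>" "sets \<mu> = sets borel" "sets \<nu> = sets borel"
    and cdf: "\<And>t. \<bar>measure \<mu> {..t} - measure \<nu> {..t}\<bar> \<le> \<delta>"
    and J: "is_interval J"
  shows "\<bar>measure \<mu> J - measure \<nu> J\<bar> \<le> 2 * \<delta>"
proof -
  interpret m: prob_space \<mu> by fact
  interpret n: prob_space \<nu> by fact
  obtain D L where J_eq: "J = D - L" and sub: "L \<subseteq> D"
    and dc: "\<And>x y. y \<in> D \<Longrightarrow> x \<le> y \<Longrightarrow> x \<in> D" "\<And>x y. y \<in> L \<Longrightarrow> x \<le> y \<Longrightarrow> x \<in> L"
    by (rule real_interval_eq_Diff[OF J]) (rule that; assumption)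
  have D: "D \<in> sets borel \<and> \<bar>measure \<mu> D - measure \<nu> D\<bar> \<le> \<delta>"
    by (rule down_closed_discrepancy[OF p cdf]) (rule dc(1))
  have L: "L \<in> sets borel \<and> \<bar>measure \<mu> L - measure \<nu> L\<bar> \<le> \<delta>"
    by (rule down_closed_discrepancy[OF p cdf]) (rule dc(2))
  have "measure \<mu> J = measure \<mu> D - measure \<mu> L" "measure \<nu> J = measure \<nu> D - measure \<nu> L"
    unfolding J_eq using D L sub p by (simp_all add: m.finite_measure_Diff n.finite_measure_Diff)
  thus ?thesis using D L by linarith
qed

section \<open>Kolmogorov distance from a local comparison\<close>

text \<open>Densities up to a factor, matching \<open>prop_density\<close>, which divides by the
  integral. No normalising constant of a beta or gamma law is ever evaluated.\<close>

locale finite_density =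
  fixes h :: "real \<Rightarrow> real"
  assumes h_int: "integrable lborel h" and h_nonneg: "\<And>x. h x \<ge> 0" and h_pos: "integral\<^sup>L lborel h > 0"
begin

lemma h_measurable [measurable]: "h \<in> borel_measurable borel"
  using borel_measurable_integrable[OF h_int] by simp

lemma set_int: "A \<in> sets borel \<Longrightarrow> set_integrable lborel A h"
  using integrable_mult_indicator[OF _ h_int, of A] unfolding set_integrable_def by simp

lemma emeasure_prop_density:
  assumes [measurable]: "A \<in> sets borel"
  shows "emeasure (prop_density h) A = ennreal ((LINT x:A|lborel. h x) / integral\<^sup>L lborel h)"
proof -
  let ?I = "integral\<^sup>L lborel h"
  have "emeasure (prop_density h) A = (\<integral>\<^sup>+x. ennreal (h x / ?I) * indicator A x \<partial>lborel)"
    unfolding prop_density_def by (rule emeasure_density) auto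
  also have "\<dots> = (\<integral>\<^sup>+x. ennreal (indicator A x * h x / ?I) \<partial>lborel)"
    by (intro nn_integral_cong) (auto simp: indicator_def)
  also have "\<dots> = ennreal (\<integral>x. indicator A x * h x / ?I \<partial>lborel)"
    using set_int[OF assms] h_nonneg h_pos
    by (intro nn_integral_eq_integral) (auto simp: set_integrable_def)
  finally show ?thesis by (simp add: set_lebesgue_integral_def)
qed

lemma sets_prop_density [measurable_cong, simp]: "sets (prop_density h) = sets borel"
  by (simp add: prop_density_def)

lemma prob_space_prop_density: "prob_space (prop_density h)"
proof
  have "emeasure (prop_density h) UNIV = 1"
    using h_pos by (subst emeasure_prop_density) (auto simp: set_lebesgue_integral_def)
  thus "emeasure (prop_density h) (space (prop_density h)) = 1"
    by (simp add: prop_density_def)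
qed

lemma measure_prop_density:
  assumes [measurable]: "A \<in> sets borel"
  shows "measure (prop_density h) A = (LINT x:A|lborel. h x) / integral\<^sup>L lborel h"
  using emeasure_prop_density[OF assms] h_pos h_nonneg unfolding measure_def
  by (simp add: set_lebesgue_integral_def)

lemma emeasure_prop_density_singleton: "emeasure (prop_density h) {x} = 0"
proof -
  have "(LINT y:{x}|lborel. h y) = 0"
    unfolding set_lebesgue_integral_def
    by (rule integral_eq_zero_AE, rule AE_mp[OF AE_lborel_singleton[of x]]) (auto intro!: AE_I2)
  thus ?thesis by (subst emeasure_prop_density) auto
qed

lemma AE_prop_density_pos:
  assumes "\<And>x. x \<le> 0 \<Longrightarrow> h x = 0"
  shows "AE x in prop_density h. x > 0"
proof -
  have "AE x in lborel. ennreal (h x / integral\<^sup>L lborel h) > 0 \<longrightarrow> x > 0"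
    using assms by (intro AE_I2) (auto simp: not_le[symmetric])
  thus ?thesis unfolding prop_density_def by (subst AE_density) auto
qed

lemma set_integral_mono_set:
  assumes "A \<in> sets borel" "B \<in> sets borel" "A \<subseteq> B"
  shows "(LINT x:A|lborel. h x) \<le> (LINT x:B|lborel. h x)"
  using set_int[OF assms(1)] set_int[OF assms(2)] assms(3) h_nonneg
  unfolding set_lebesgue_integral_def set_integrable_def
  by (intro integral_mono) (auto simp: indicator_def)

lemma set_integral_interval_le:
  assumes "\<And>x. h x \<le> K" "u \<le> v" "A \<in> sets borel" "A \<subseteq> {u..v}"
  shows "(LINT x:A|lborel. h x) \<le> K * (v - u)"
proof -
  have "(LINT x:A|lborel. h x) \<le> (LINT x:{u..v}|lborel. h x)"
    using assms by (intro set_integral_mono_set) auto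
  also have "\<dots> \<le> (LINT x:{u..v}|lborel. K)"
    using set_int[of "{u..v}"] assms(1,2) by (intro set_integral_mono) (auto simp: set_integrable_def)
  also have "\<dots> = K * (v - u)"
    using assms(2) by (simp add: set_lebesgue_integral_def)
  finally show ?thesis .
qed

lemma set_integral_approx:
  assumes "u \<le> v" "\<And>x. u < x \<Longrightarrow> x < v \<Longrightarrow> \<bar>c - h x\<bar> \<le> \<eta>"
  shows "\<bar>c * (v - u) - (LINT x:{u..<v}|lborel. h x)\<bar> \<le> \<eta> * (v - u)"
proof -
  have c: "(LINT x:{u..<v}|lborel. (k::real)) = k * (v - u)" for k
    using assms(1) by (simp add: set_lebesgue_integral_def)
  have i: "set_integrable lborel {u..<v} (\<lambda>_. k::real)" for k
    using assms(1) by (auto simp: set_integrable_def)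
  \<comment> \<open>The hypothesis leaves out the left end point, which is a null set.\<close>
  have "(LINT x:{u..<v}|lborel. h x) \<le> (LINT x:{u..<v}|lborel. c + \<eta>)"
    using assms(2) AE_lborel_singleton[of u]
    by (intro set_integral_mono_AE i set_int) (auto simp: abs_le_iff order_less_le algebra_simps)
  moreover have "(LINT x:{u..<v}|lborel. c - \<eta>) \<le> (LINT x:{u..<v}|lborel. h x)"
    using assms(2) AE_lborel_singleton[of u]
    by (intro set_integral_mono_AE i set_int) (auto simp: abs_le_iff order_less_le algebra_simps)
  ultimately show ?thesis unfolding c by (simp add: abs_le_iff algebra_simps)
qed

text \<open>The normalising factor \<open>\<theta>\<close> need not be known: comparing total masses shows that it is close to the
  reciprocal of the integral of \<open>h\<close>.\<close>

lemma kolmogorov_from_local: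
  fixes p :: "nat pmf" and e :: "nat \<Rightarrow> real"
  assumes hK: "\<And>x. h x \<le> K" and h0: "\<And>x. x < 0 \<Longrightarrow> h x = 0"
    and \<sigma>: "\<sigma> > 0" and \<theta>: "\<theta> \<ge> 0"
    and loc: "\<And>j. \<bar>pmf p j - \<theta> * (LINT x:{\<sigma> * real j..<\<sigma> * real (Suc j)}|lborel. h x)\<bar> \<le> \<theta> * \<sigma> * e j"
    and e: "summable e" "suminf e \<le> K" "\<And>j. e j \<ge> 0"
  shows "\<bar>measure_pmf.prob p {j. \<sigma> * real j \<le> t} - measure (prop_density h) {..t}\<bar>
           \<le> 6 * K / integral\<^sup>L lborel h * \<sigma>"
proof -
  define I where "I = integral\<^sup>L lborel h"
  define P where "P j = (LINT x:{\<sigma> * real j..<\<sigma> * real (Suc j)}|lborel. h x)" for j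
  have Ipos: "I > 0" using h_pos by (simp add: I_def)
  have K0: "K \<ge> 0" using hK[of 0] h_nonneg[of 0] by linarith
  interpret pd: prob_space "prop_density h" by (rule prob_space_prop_density)
  have sumP: "(\<Sum>j<N. P j) = (LINT x:{0..<\<sigma> * real N}|lborel. h x)" for N
  proof (induction N)
    case (Suc N)
    have "{0..<\<sigma> * real (Suc N)} = {0..<\<sigma> * real N} \<union> {\<sigma> * real N..<\<sigma> * real (Suc N)}"
      using \<sigma> by (intro ivl_disj_un(17)[symmetric]) auto
    hence "(LINT x:{0..<\<sigma> * real (Suc N)}|lborel. h x) = (LINT x:{0..<\<sigma> * real N}|lborel. h x) + P N"
      unfolding P_def using set_int by (simp only:) (intro set_integral_Un; auto)
    with Suc show ?case by simp
  qed (simp add: set_lebesgue_integral_def)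
  have P0: "P j \<ge> 0" for j
    unfolding P_def set_lebesgue_integral_def using h_nonneg by (intro Bochner_Integration.integral_nonneg) auto
  have all: "(LINT x:{0..}|lborel. h x) = I"
    unfolding I_def set_lebesgue_integral_def using h0
    by (intro Bochner_Integration.integral_cong) (auto simp: indicator_def not_le)
  have Psums: "P sums I"
  proof -
    have "(\<lambda>N. LINT x:{0..<\<sigma> * real N}|lborel. h x) \<longlonglongrightarrow> (LINT x:(\<Union>N. {0..<\<sigma> * real N})|lborel. h x)"
    proof (rule set_integral_cont_up)
      show "incseq (\<lambda>N. {0..<\<sigma> * real N})"
        using \<sigma> by (intro monoI) (auto intro: order_less_le_trans mult_left_mono)
      show "set_integrable lborel (\<Union>N. {0..<\<sigma> * real N}) h" by (intro set_int) auto
    qed auto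
    moreover have "(\<Union>N. {0..<\<sigma> * real N}) = {0..}"
    proof (intro set_eqI iffI)
      fix x :: real assume "x \<in> {0..}"
      moreover obtain N :: nat where "x / \<sigma> < real N" using reals_Archimedean2 by blast
      ultimately show "x \<in> (\<Union>N. {0..<\<sigma> * real N})" using \<sigma> by (auto simp: field_simps)
    qed auto
    ultimately show ?thesis unfolding sums_def sumP using all by simp
  qed
  have psums: "pmf p sums 1"
    using sums_infsetsum_nat[of "pmf p" UNIV] infsetsum_pmf_eq_1[of p UNIV] pmf_abs_summable[of p UNIV] by simp
  have esum: "(\<Sum>j<N. e j) \<le> K" for N
    using sum_le_suminf[OF e(1), of "{..<N}"] e by auto
  have part: "\<bar>(\<Sum>j<N. pmf p j) - \<theta> * (\<Sum>j<N. P j)\<bar> \<le> \<theta> * \<sigma> * K" for N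
  proof -
    have "\<bar>(\<Sum>j<N. pmf p j) - \<theta> * (\<Sum>j<N. P j)\<bar> = \<bar>\<Sum>j<N. pmf p j - \<theta> * P j\<bar>"
      by (simp add: sum_subtractf sum_distrib_left)
    also have "\<dots> \<le> (\<Sum>j<N. \<bar>pmf p j - \<theta> * P j\<bar>)" by (rule sum_abs)
    also have "\<dots> \<le> (\<Sum>j<N. \<theta> * \<sigma> * e j)" using loc unfolding P_def by (intro sum_mono) auto
    also have "\<dots> \<le> \<theta> * \<sigma> * K" 
      unfolding sum_distrib_left[symmetric] using esum \<theta> \<sigma> by (intro mult_left_mono) auto
    finally show ?thesis .
  qed
  have tot: "\<bar>1 - \<theta> * I\<bar> \<le> \<theta> * \<sigma> * K"
  proof (rule LIMSEQ_le_const2)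
    show "(\<lambda>N. \<bar>(\<Sum>j<N. pmf p j) - \<theta> * (\<Sum>j<N. P j)\<bar>) \<longlonglongrightarrow> \<bar>1 - \<theta> * I\<bar>"
      using Psums psums unfolding sums_def by (intro tendsto_intros)
  qed (use part in blast)
  define F where "F = measure_pmf.prob p {j. \<sigma> * real j \<le> t}"
  define H where "H = (LINT x:{..t}|lborel. h x)"
  have G: "measure (prop_density h) {..t} = H / I"
    unfolding H_def I_def by (rule measure_prop_density) auto
  have HI: "H \<le> I" "0 \<le> H"
    using pd.prob_le_1[of "{..t}"] measure_nonneg[of "prop_density h" "{..t}"] Ipos
    unfolding G by (auto simp: field_simps zero_le_divide_iff)
  show ?thesis
  proof (cases "\<sigma> * K \<le> I / 2")
    \<comment> \<open>For a mesh this small, the comparison of total masses yields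
      \<open>\<theta> \<le> 2 / I\<close>; for a larger one the claimed bound exceeds 1.\<close>
    case True
    have "\<theta> * (\<sigma> * K) \<le> \<theta> * (I / 2)" using True \<theta> by (rule mult_left_mono)
    hence \<theta>2: "\<theta> * I \<le> 2" using tot by (auto simp: abs_le_iff algebra_simps)
    have \<theta>I: "\<theta> \<le> 2 / I" using \<theta>2 Ipos by (simp add: field_simps)
    \<comment> \<open>One error term is the sum of the local errors, the other the part beyond
      \<open>t\<close> of the cell containing \<open>t\<close>. The normalisation adds a third, and
      \<open>\<theta> \<le> 2 / I\<close> makes the 6.\<close>
    have bd: "\<bar>F - \<theta> * H\<bar> \<le> 2 * \<theta> * \<sigma> * K"
    proof (cases "t < 0")
      case True
      have "H = 0" unfolding H_def set_lebesgue_integral_def using True h0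
        by (intro integral_eq_zero_AE AE_I2) (auto simp: indicator_def)
      moreover have "{j. \<sigma> * real j \<le> t} = {}"
        using True \<sigma> by (auto simp: not_le intro: less_le_trans)
      ultimately show ?thesis using \<theta> \<sigma> K0 by (simp add: F_def)
    next
      case t: False
      define N where "N = Suc (nat \<lfloor>t / \<sigma>\<rfloor>)"
      have set: "{j. \<sigma> * real j \<le> t} = {..<N}"
      proof (intro set_eqI)
        fix j
        have "\<sigma> * real j \<le> t \<longleftrightarrow> real j \<le> t / \<sigma>" using \<sigma> by (simp add: field_simps)
        also have "\<dots> \<longleftrightarrow> int j \<le> \<lfloor>t / \<sigma>\<rfloor>" by (simp add: le_floor_iff)
        also have "\<dots> \<longleftrightarrow> j < N" unfolding N_def using t \<sigma> by (auto simp: less_Suc_eq_le le_nat_iff)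
        finally show "j \<in> {j. \<sigma> * real j \<le> t} \<longleftrightarrow> j \<in> {..<N}" by simp
      qed
      have F: "F = (\<Sum>j<N. pmf p j)"
        unfolding F_def set by (rule measure_measure_pmf_finite) auto
      have tl: "\<sigma> * real N > t" 
      proof -
        have "N \<notin> {j. \<sigma> * real j \<le> t}" unfolding set by simp
        thus ?thesis by simp
      qed
      have tu: "\<sigma> * real N \<le> t + \<sigma>" 
      proof -
        have "N - 1 \<in> {j. \<sigma> * real j \<le> t}" unfolding set by (simp add: N_def)
        thus ?thesis by (simp add: N_def algebra_simps)
      qed
      have H: "H = (LINT x:{0..t}|lborel. h x)"
        unfolding H_def set_lebesgue_integral_def using h0
        by (intro Bochner_Integration.integral_cong) (auto simp: indicator_def not_le)
      have "(LINT x:{0..<\<sigma> * real N}|lborel. h x) = H + (LINT x:{t<..<\<sigma> * real N}|lborel. h x)"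
      proof -
        have "{0..<\<sigma> * real N} = {0..t} \<union> {t<..<\<sigma> * real N}" using tl t by auto
        thus ?thesis unfolding H using set_int by (simp only:) (intro set_integral_Un; auto)
      qed
      moreover have "(LINT x:{t<..<\<sigma> * real N}|lborel. h x) \<le> K * \<sigma>"
      proof -
        have "(LINT x:{t<..<\<sigma> * real N}|lborel. h x) \<le> K * (\<sigma> * real N - t)"
          using tl hK by (intro set_integral_interval_le) auto
        also have "\<dots> \<le> K * \<sigma>" using tu K0 by (intro mult_left_mono) auto
        finally show ?thesis .
      qed
      moreover have "(LINT x:{t<..<\<sigma> * real N}|lborel. h x) \<ge> 0"
        unfolding set_lebesgue_integral_def using h_nonneg by (intro Bochner_Integration.integral_nonneg) auto
      ultimately have "\<bar>(\<Sum>j<N. P j) - H\<bar> \<le> K * \<sigma>" unfolding sumP by auto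
      hence "\<bar>\<theta> * (\<Sum>j<N. P j) - \<theta> * H\<bar> \<le> \<theta> * (K * \<sigma>)"
        unfolding right_diff_distrib[symmetric] abs_mult using \<theta> by (simp add: mult_left_mono)
      thus ?thesis using part[of N] unfolding F by (simp add: algebra_simps abs_le_iff)
    qed
    have "\<bar>\<theta> * H - H / I\<bar> = \<bar>1 - \<theta> * I\<bar> * (H / I)"
    proof -
      have "\<theta> * H - H / I = - ((1 - \<theta> * I) * (H / I))" using Ipos by (simp add: field_simps)
      thus ?thesis using HI Ipos by (simp add: abs_mult)
    qed
    also have "\<dots> \<le> \<theta> * \<sigma> * K * 1"
      using tot HI Ipos \<theta> \<sigma> K0 by (intro mult_mono) auto
    finally have "\<bar>F - H / I\<bar> \<le> 3 * (\<theta> * \<sigma> * K)" using bd by linarith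
    also have "\<dots> \<le> 3 * (2 / I * \<sigma> * K)"
      using \<theta>I \<sigma> K0 by (intro mult_left_mono mult_right_mono) auto
    finally show ?thesis unfolding F_def G I_def by (simp add: algebra_simps)
  next
    case False
    have "0 \<le> F" "F \<le> 1" unfolding F_def by auto
    moreover have "0 \<le> H / I" "H / I \<le> 1" using HI Ipos by auto
    ultimately have "\<bar>F - H / I\<bar> \<le> 1" by linarith
    also have "1 \<le> 6 * K / I * \<sigma>"
    proof -
      have "I \<le> 6 * (\<sigma> * K)" using False Ipos by linarith
      thus ?thesis using Ipos by (simp add: field_simps)
    qed
    finally show ?thesis unfolding F_def G I_def .
  qed
qed

end

section \<open>Random walks of urn type\<close>

text \<open>Only the weight \<open>x\<close> of the tracked colour is random; the total
  \<open>T\<close> is deterministic and supplied from outside. This lets \<open>walk\<close> serve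
  both the Polya urn and the urn with immigration.\<close>

definition draw :: "nat \<Rightarrow> nat \<Rightarrow> nat pmf" where
  "draw T x = map_pmf (\<lambda>b. if b then Suc x else x) (bernoulli_pmf (real x / real T))"

primrec walk :: "(nat \<Rightarrow> nat) \<Rightarrow> nat \<Rightarrow> nat \<Rightarrow> nat pmf" where
  "walk T m 0 = return_pmf m"
| "walk T m (Suc t) = bind_pmf (walk T m t) (draw (T t))"

lemma set_pmf_draw: "set_pmf (draw T x) \<subseteq> {x, Suc x}"
  unfolding draw_def set_map_pmf by (rule image_subsetI) simp

lemma set_pmf_walk: "set_pmf (walk T m t) \<subseteq> {m..m + t}"
proof (induction t)
  case (Suc t)
  show ?case
  proof
    fix x assume "x \<in> set_pmf (walk T m (Suc t))"
    then obtain y where "y \<in> set_pmf (walk T m t)" "x \<in> set_pmf (draw (T t) y)" by auto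
    hence "y \<in> {m..m + t}" "x \<in> {y, Suc y}" using Suc set_pmf_draw[of "T t" y] by blast+
    thus "x \<in> {m..m + Suc t}" by auto
  qed
qed auto

lemma finite_set_pmf_walk: "finite (set_pmf (walk T m t))"
  by (rule finite_subset[OF set_pmf_walk]) simp

lemma pmf_draw:
  assumes "y \<le> T"
  shows "pmf (draw T y) x = (if x = y then 1 - real y / real T else 0) + (if x = Suc y then real y / real T else 0)"
proof -
  define p where "p = real y / real T"
  have p: "p \<in> {0..1}" using assms by (cases "T = 0") (auto simp: p_def)
  have "draw T y = bind_pmf (bernoulli_pmf p) (\<lambda>b. return_pmf (if b then Suc y else y))"
    unfolding draw_def map_pmf_def p_def ..
  thus ?thesis unfolding p_def[symmetric] using p by (auto simp: pmf_bind)
qed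

lemma expectation_draw:
  fixes f :: "nat \<Rightarrow> real"
  assumes "y \<le> T"
  shows "measure_pmf.expectation (draw T y) f = (1 - real y / real T) * f y + real y / real T * f (Suc y)"
proof -
  define p where "p = real y / real T"
  have p: "p \<in> {0..1}" using assms by (cases "T = 0") (auto simp: p_def)
  thus ?thesis unfolding draw_def p_def[symmetric] by simp
qed

lemma pmf_bind_draw:
  assumes "set_pmf P \<subseteq> {..T}"
  shows "pmf (bind_pmf P (draw T)) x =
    pmf P x * (1 - real x / real T) + (if x = 0 then 0 else pmf P (x - 1) * (real (x - 1) / real T))"
proof -
  let ?f = "\<lambda>y. (if x = y then 1 - real y / real T else 0) + (if x = Suc y then real y / real T else 0)"
  have "pmf (bind_pmf P (draw T)) x = measure_pmf.expectation P (\<lambda>y. pmf (draw T y) x)"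
    by (simp add: pmf_bind)
  also have "\<dots> = measure_pmf.expectation P ?f"
    using assms by (intro integral_cong_AE AE_pmfI) (auto simp: pmf_draw)
  also have "\<dots> = (\<Sum>y\<in>{x - 1, x}. ?f y * pmf P y)"
    by (subst integral_measure_pmf_real[of "{x - 1, x}"]) (auto split: if_splits)
  also have "\<dots> = pmf P x * (1 - real x / real T) + (if x = 0 then 0 else pmf P (x - 1) * (real (x - 1) / real T))"
    by (cases x) auto
  finally show ?thesis .
qed

text \<open>The factor by which the law of a walk differs from \<open>m + j - 1 choose j\<close>, see \<open>pmf_walk\<close>.\<close>

primrec walk_coeff :: "(nat \<Rightarrow> nat) \<Rightarrow> nat \<Rightarrow> nat \<Rightarrow> nat \<Rightarrow> real" where
  "walk_coeff T m 0 j = (if j = 0 then 1 else 0)"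
| "walk_coeff T m (Suc t) j = walk_coeff T m t j * (1 - real (m + j) / real (T t)) + walk_coeff T m t (j - 1) * real j / real (T t)"

lemma walk_coeff_eq_0: "t < j \<Longrightarrow> walk_coeff T m t j = 0"
  by (induction t arbitrary: j) auto

text \<open>Absorption, \<open>j * (m + j - 1 choose j) = (m + j - 1) * (m + j - 2 choose j -
  1)\<close>, turns the weight \<open>m + j - 1\<close> of the draw leading to \<open>m + j\<close>
  into the factor \<open>j\<close> in the recursion of \<open>walk_coeff\<close>.\<close>

lemma pmf_walk:
  assumes m: "m \<ge> 1" and T: "\<And>t. m + t \<le> T t"
  shows "pmf (walk T m t) (m + j) = real (m + j - 1 choose j) * walk_coeff T m t j"
proof (induction t arbitrary: j)
  case 0
  show ?case using m by (auto simp: indicator_def)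
next
  case (Suc t)
  have sub: "set_pmf (walk T m t) \<subseteq> {..T t}" using set_pmf_walk[of T m t] T[of t] by auto
  show ?case
  proof (cases j)
    case 0
    have "pmf (walk T m t) (m - 1) = 0"
      using m set_pmf_walk[of T m t] by (fastforce simp: pmf_eq_0_set_pmf)
    thus ?thesis using Suc[of 0] m 0 pmf_bind_draw[OF sub, of m] by simp
  next
    case (Suc i)
    have "(m + j - 1) * (m + j - 2 choose (j - 1)) = j * (m + j - 1 choose j)"
      using m Suc Suc_times_binomial[of i "m + i - 1"] by (simp add: numeral_2_eq_2)
    hence b: "real (m + j - 2 choose (j - 1)) * real (m + j - 1) = real (m + j - 1 choose j) * real j"
      by (metis mult.commute of_nat_mult)
    have "m + j - 1 = m + i" "m + (j-1) - 1 = m + j - 2" using Suc m by auto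
    hence "pmf (walk T m t) (m + j - 1) = real (m + j - 2 choose (j - 1)) * walk_coeff T m t (j - 1)"
      using Suc.IH[of i] Suc by simp
    hence "pmf (walk T m (Suc t)) (m + j) = real (m + j - 1 choose j) * walk_coeff T m t j * (1 - real (m + j) / real (T t))
        + walk_coeff T m t (j - 1) * (real (m + j - 2 choose (j - 1)) * real (m + j - 1)) / real (T t)"
      using m Suc.IH[of j] pmf_bind_draw[OF sub, of "m + j"] by simp
    thus ?thesis unfolding b by (simp add: algebra_simps)
  qed
qed

text \<open>The function \<open>1 / (x - 1)\<close> is an eigenfunction of every draw, with
  eigenvalue \<open>1 - 1 / T\<close>: its value at \<open>Suc x\<close> is \<open>1 / x\<close>,
  which cancels the weight \<open>x\<close> of that draw.\<close>

lemma expectation_walk_inverse: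
  assumes m: "m \<ge> 2" and T: "\<And>t. m + t \<le> T t"
  shows "measure_pmf.expectation (walk T m t) (\<lambda>x. 1 / (real x - 1)) = (\<Prod>k<t. 1 - 1 / real (T k)) / (real m - 1)"
proof (induction t)
  case (Suc t)
  have bd: "\<bar>1 / (real x - 1)\<bar> \<le> 1" for x
    by (cases "x = 0"; cases "x = 1") (auto simp: field_simps)
  have "measure_pmf.expectation (walk T m (Suc t)) (\<lambda>x. 1 / (real x - 1))
      = measure_pmf.expectation (walk T m t) (\<lambda>y. measure_pmf.expectation (draw (T t) y) (\<lambda>x. 1 / (real x - 1)))"
    unfolding walk.simps measure_pmf_bind
    by (subst integral_bind[where K="count_space UNIV" and B'=1 and B=1])
       (use bd in \<open>auto simp: measure_pmf.emeasure_space_1 measurable_def space_subprob_algebra intro!: prob_space_imp_subprob_space prob_space_measure_pmf\<close>)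
  also have "\<dots> = measure_pmf.expectation (walk T m t) (\<lambda>y. (1 - 1 / real (T t)) * (1 / (real y - 1)))"
  proof (intro integral_cong_AE AE_pmfI)
    fix y assume "y \<in> set_pmf (walk T m t)"
    hence y: "y \<ge> 2" "y \<le> T t" using set_pmf_walk[of T m t] m T[of t] by auto
    define v where "v = real y" define u where "u = real (T t)"
    have v: "v \<ge> 2" "u \<ge> v" using y by (auto simp: v_def u_def)
    have "(1 - v / u) * (1 / (v - 1)) + v / u * (1 / v) = (1 - 1 / u) * (1 / (v - 1))"
      using v by (simp add: field_simps)
    thus "measure_pmf.expectation (draw (T t) y) (\<lambda>x. 1 / (real x - 1)) = (1 - 1 / real (T t)) * (1 / (real y - 1))"
      using y by (simp add: expectation_draw v_def u_def)
  qed auto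
  also have "\<dots> = (1 - 1 / real (T t)) * measure_pmf.expectation (walk T m t) (\<lambda>y. 1 / (real y - 1))"
    by (rule integral_mult_right_zero)
  also have "\<dots> = (\<Prod>k<Suc t. 1 - 1 / real (T k)) / (real m - 1)"
    unfolding Suc by (simp add: mult.commute)
  finally show ?case .
qed auto

definition polya :: "nat \<Rightarrow> nat \<Rightarrow> nat \<Rightarrow> nat pmf" where
  "polya m d t = walk (\<lambda>t. m + d + t) m t"

lemma polya_0 [simp]: "polya m d 0 = return_pmf m"
  by (simp add: polya_def)

lemma polya_Suc: "polya m d (Suc t) = bind_pmf (polya m d t) (draw (m + d + t))"
  by (simp add: polya_def)

lemma set_pmf_polya: "set_pmf (polya m d t) \<subseteq> {m..m + t}"
  unfolding polya_def by (rule set_pmf_walk)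

text \<open>The product telescopes. The result has the same form in the total as the integrand has
  in the tracked weight, which drives \<open>chain_discrepancy\<close>.\<close>

lemma expectation_polya_inverse:
  assumes m: "m \<ge> 2"
  shows "measure_pmf.expectation (polya m d t) (\<lambda>x. 1 / (real x - 1))
     = (real (m + d) - 1) / (real m - 1) / (real (m + d + t) - 1)"
proof -
  have "(\<Prod>k<t. 1 - 1 / real (m + d + k)) = (real (m + d) - 1) / (real (m + d + t) - 1)"
  proof (induction t)
    case (Suc t)
    define v where "v = real m + real d + real t"
    have v: "v \<ge> 2" using m by (auto simp: v_def)
    have e: "real (m + d + t) = v" "real (m + d + Suc t) - 1 = v" by (auto simp: v_def)
    have "(\<Prod>k<Suc t. 1 - 1 / real (m + d + k)) = (real (m + d) - 1) / (v - 1) * (1 - 1 / v)"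
      unfolding prod.lessThan_Suc Suc e ..
    also have "1 - 1 / v = (v - 1) / v" using v by (simp add: diff_divide_distrib)
    finally show ?case unfolding e using v by simp
  qed (use m in auto)
  thus ?thesis unfolding polya_def using m by (subst expectation_walk_inverse) auto
qed

text \<open>Together with \<open>pmf_walk\<close> this is the beta-binomial law: the numerator
  belongs to the other colour, drawn \<open>t - j\<close> times from weight \<open>d\<close>, the
  denominator to the total.\<close>

lemma walk_coeff_polya:
  assumes "m \<ge> 1" "d \<ge> 1" "j \<le> t"
  shows "walk_coeff (\<lambda>t. m + d + t) m t j = real (t - j + d - 1 choose (d - 1)) / real (m + d + t - 1 choose (m + d - 1))"
  using assms(3)
proof (induction t arbitrary: j)
  case (Suc t)
  define T where "T = m + d + t"
  have T: "real T > 0" using assms by (simp add: T_def)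
  define B where "B = real (T - 1 choose (m + d - 1))"
  define B' where "B' = real (T choose (m + d - 1))"
  have "(T - (m + d - 1)) * (T choose (m + d - 1)) = T * (T - 1 choose (m + d - 1))"
    using assms by (intro binomial_absorb_comp)
  moreover have "T - (m + d - 1) = Suc t" using assms by (simp add: T_def)
  ultimately have BB: "real (Suc t) * B' = real T * B" unfolding B_def B'_def by (metis of_nat_mult)
  have pos: "B > 0" "B' > 0" using assms unfolding B_def B'_def T_def by auto
  \<comment> \<open>The recursion reduces to this: by absorption the second term is
    \<open>Suc t - j\<close> times the binomial of the first. For \<open>j = Suc t\<close> the
    truncated \<open>t - j\<close> would give a nonzero binomial, hence the explicit zero.\<close>
  have "(real j * real (Suc t - j + d - 1 choose (d - 1)) + real (T - m - j) * (if j \<le> t then real (t - j + d - 1 choose (d - 1)) else 0))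
      = real (Suc t) * real (Suc t - j + d - 1 choose (d - 1))"
  proof (cases "j \<le> t")
    case True
    have "(t - j + d - (d - 1)) * (t - j + d choose (d - 1)) = (t - j + d) * (t - j + d - 1 choose (d - 1))"
      by (rule binomial_absorb_comp)
    moreover have "t - j + d - (d - 1) = Suc t - j" "T - m - j = t - j + d" "Suc t - j + d - 1 = t - j + d"
      using True assms by (auto simp: T_def)
    ultimately have "real (T - m - j) * real (t - j + d - 1 choose (d - 1)) = real (Suc t - j) * real (Suc t - j + d - 1 choose (d - 1))"
      by (metis of_nat_mult)
    thus ?thesis using True by (simp add: of_nat_diff algebra_simps)
  next
    case False
    thus ?thesis using Suc.prems by simp
  qed
  moreover have gj: "walk_coeff (\<lambda>t. m + d + t) m t j = (if j \<le> t then real (t - j + d - 1 choose (d - 1)) else 0) / B"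
    using Suc.IH[of j] unfolding B_def T_def by (auto simp: walk_coeff_eq_0)
  moreover have gj1: "walk_coeff (\<lambda>t. m + d + t) m t (j - 1) * real j = real (Suc t - j + d - 1 choose (d - 1)) * real j / B"
    using Suc.IH[of "j - 1"] Suc.prems unfolding B_def T_def by (cases j) auto
  moreover have "1 - real (m + j) / real T = (real (T - m - j)) / real T" if "j \<le> t"
    using that T by (simp add: of_nat_diff T_def field_simps)
  ultimately have key: "walk_coeff (\<lambda>t. m + d + t) m t j * (1 - real (m + j) / real T) * (B * real T)
      + walk_coeff (\<lambda>t. m + d + t) m t (j - 1) * real j * B = real (Suc t) * real (Suc t - j + d - 1 choose (d - 1))"
    using pos T by (cases "j \<le> t") (simp_all add: mult.commute)
  have "walk_coeff (\<lambda>t. m + d + t) m (Suc t) j = (walk_coeff (\<lambda>t. m + d + t) m t j * (1 - real (m + j) / real T) * (B * real T)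
      + walk_coeff (\<lambda>t. m + d + t) m t (j - 1) * real j * B) / (B * real T)"
    unfolding walk_coeff.simps T_def[symmetric] using pos T by (simp add: add_divide_distrib)
  also have "\<dots> = real (Suc t) * real (Suc t - j + d - 1 choose (d - 1)) / (B * real T)"
    unfolding key ..
  also have "\<dots> = real (Suc t - j + d - 1 choose (d - 1)) / B'"
    unfolding mult.commute[of B] BB[symmetric] by simp
  finally show ?case by (simp add: B'_def T_def)
qed (use assms in simp)

text \<open>Outside the support one of the binomials vanishes, so a single formula covers all
  lattice points strictly between 0 and the total, as the comparison cell by cell requires.\<close>

lemma pmf_polya:
  assumes m: "m \<ge> 1" and d: "d \<ge> 1" and x: "1 \<le> x" "x < m + d + t"
  shows "pmf (polya m d t) x = real (x - 1 choose (m - 1)) * real (m + d + t - x - 1 choose (d - 1)) / real (m + d + t - 1 choose (m + d - 1))"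
proof (cases "m \<le> x \<and> x \<le> m + t")
  case True
  then obtain j where j: "x = m + j" "j \<le> t" by (metis le_add_diff_inverse add_le_cancel_left)
  have "pmf (polya m d t) x = real (m + j - 1 choose j) * walk_coeff (\<lambda>t. m + d + t) m t j"
    unfolding j polya_def using m by (intro pmf_walk) auto
  moreover have "(m + j - 1 choose j) = (x - 1 choose (m - 1))"
    using m j binomial_symmetric[of j "m + j - 1"] by simp
  moreover have "m + d + t - x - 1 = t - j + d - 1" using j d by auto
  ultimately show ?thesis using walk_coeff_polya[OF m d j(2)] by simp
next
  case False
  hence "pmf (polya m d t) x = 0" using set_pmf_polya[of m d t] by (fastforce simp: pmf_eq_0_set_pmf)
  moreover have "(x - 1 choose (m - 1)) = 0 \<or> (m + d + t - x - 1 choose (d - 1)) = 0"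
    using False x m d by auto
  ultimately show ?thesis by auto
qed

section \<open>Polya urns and beta laws\<close>

definition beta_dens :: "nat \<Rightarrow> nat \<Rightarrow> real \<Rightarrow> real" where
  "beta_dens m d = (\<lambda>x. indicator {0<..<1} x * x powr (real m - 1) * (1 - x) powr (real d - 1))"

lemma beta_dens_eq:
  assumes "m \<ge> 1" "d \<ge> 1"
  shows "beta_dens m d x = indicator {0<..<1} x * (x ^ (m - 1) * (1 - x) ^ (d - 1))"
proof (cases "x \<in> {0<..<1}")
  case True
  hence "x powr (real m - 1) = x ^ (m - 1)" "(1 - x) powr (real d - 1) = (1 - x) ^ (d - 1)"
    using assms by (simp_all add: powr_realpow[symmetric] of_nat_diff)
  thus ?thesis by (simp add: beta_dens_def)
qed (simp add: beta_dens_def)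

lemma beta_dens_bounds:
  assumes "m \<ge> 1" "d \<ge> 1"
  shows "beta_dens m d x \<ge> 0" "beta_dens m d x \<le> 1"
  unfolding beta_dens_eq[OF assms]
  by (auto simp: indicator_def intro!: mult_nonneg_nonneg mult_le_one power_le_one)

lemma finite_density_beta:
  assumes "m \<ge> 1" "d \<ge> 1"
  shows "finite_density (beta_dens m d)"
proof
  note b = beta_dens_bounds[OF assms]
  have meas: "beta_dens m d \<in> borel_measurable lborel"
    unfolding beta_dens_def by measurable
  have dom: "norm (beta_dens m d x) \<le> norm (indicator {0<..<1} x :: real)" for x
    using b[of x] by (cases "x \<in> {0<..<1}") (auto simp: beta_dens_eq[OF assms])
  show int: "integrable lborel (beta_dens m d)"
    by (rule Bochner_Integration.integrable_bound[where f="indicator {0<..<1::real}", OF _ meas])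
       (use dom in auto)
  show "beta_dens m d x \<ge> 0" for x by (rule b)
  have ind: "u \<le> v \<Longrightarrow> integrable lborel (indicator {u..v::real} :: real \<Rightarrow> real)" for u v by simp
  have ii: "integrable lborel (indicator {1/4..3/4::real} :: real \<Rightarrow> real)" by (rule ind) simp
  define c where "c = (1 / 4 :: real) ^ (m - 1) * (1 / 4) ^ (d - 1)"
  have "c * (1 / 2) = (\<integral>x. c * indicator {1/4..3/4::real} x \<partial>lborel)" by simp
  also have "\<dots> \<le> integral\<^sup>L lborel (beta_dens m d)"
  proof (intro integral_mono int)
    fix x :: real
    show "c * indicator {1/4..3/4} x \<le> beta_dens m d x"
    proof (cases "x \<in> {1/4..3/4}")
      case True
      hence "c \<le> x ^ (m - 1) * (1 - x) ^ (d - 1)"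
        unfolding c_def by (intro mult_mono power_mono) auto
      with True show ?thesis by (simp add: beta_dens_eq[OF assms])
    qed (use b in auto)
  qed (use ii in auto)
  finally show "integral\<^sup>L lborel (beta_dens m d) > 0" unfolding c_def by (smt (verit) zero_less_mult_iff zero_less_power divide_pos_pos)
qed

lemma binomial_fact_prod: "real (fact k) * real (n choose k) = (\<Prod>i<k. real n - real i)"
  using gbinomial_mult_fact[of k "real n"] by (simp add: binomial_gbinomial atLeast0LessThan)

lemma prod_approx:
  fixes u \<eta> :: real
  assumes "\<And>i. i < k \<Longrightarrow> \<bar>z i - u\<bar> \<le> \<eta>" "\<And>i. i < k \<Longrightarrow> \<bar>z i\<bar> \<le> 1" "\<bar>u\<bar> \<le> 1"
  shows "\<bar>(\<Prod>i<k. z i) - u ^ k\<bar> \<le> real k * \<eta>"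
proof -
  have "norm ((\<Prod>i<k. z i) - (\<Prod>i<k. u)) \<le> (\<Sum>i<k. norm (z i - u))"
    using assms by (intro norm_prod_diff) auto
  also have "\<dots> \<le> (\<Sum>i<k. \<eta>)" using assms by (intro sum_mono) auto
  finally show ?thesis by simp
qed

text \<open>On the cell of \<open>j\<close> the two binomials of \<open>pmf_polya\<close>, rescaled
  by powers of \<open>y\<close>, differ from \<open>x ^ (m - 1)\<close> and
  \<open>(1 - x) ^ (d - 1)\<close> by \<open>O(1 / y)\<close> uniformly. There are \<open>y\<close>
  cells, so the local errors add up to a constant and only the mesh \<open>1 / y\<close>
  remains.\<close>

lemma polya_kolmogorov:
  fixes m d t :: nat and u :: real
  assumes m: "m \<ge> 1" and d: "d \<ge> 1"
  defines "y \<equiv> m + d + t"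
  shows "\<bar>measure_pmf.prob (polya m d t) {x. real x / real y \<le> u} - measure (beta_distr (real m) (real d)) {..u}\<bar>
    \<le> 6 * (real m ^ 2 + real d ^ 2 + 1) / integral\<^sup>L lborel (beta_dens m d) / real y"
proof -
  interpret finite_density "beta_dens m d" by (rule finite_density_beta[OF m d])
  define K where "K = real m ^ 2 + real d ^ 2"
  define \<sigma> where "\<sigma> = 1 / real y"
  have y: "y \<ge> 2" "y \<ge> m" "y \<ge> d" using m d by (auto simp: y_def)
  have \<sigma>: "\<sigma> > 0" using y by (simp add: \<sigma>_def)
  \<comment> \<open>All of \<open>pmf_polya\<close> that does not depend on \<open>j\<close>, with
    the powers of \<open>y\<close> that turn falling factorials into \<open>A\<close> and
    \<open>B\<close> below and one more \<open>y\<close> for the length of a cell.\<close>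
  define \<theta> where "\<theta> = real y * real y ^ (m - 1) * real y ^ (d - 1)
     / (real (fact (m - 1)) * real (fact (d - 1)) * real (y - 1 choose (m + d - 1)))"
  have bpos: "real (y - 1 choose (m + d - 1)) > 0" using m d by (simp add: y_def)
  have \<theta>: "\<theta> \<ge> 0" unfolding \<theta>_def by simp
  \<comment> \<open>Cell 0 carries no mass of the urn and is not covered by
    \<open>pmf_polya\<close>; it is paid for by the bound 1 on the density.\<close>
  define e where "e j = (if j = 0 then 1 else if j < y then K / real y else 0)" for j :: nat
  have e0: "e j \<ge> 0" for j by (simp add: e_def K_def)
  have esums: "e sums (\<Sum>j<y. e j)" by (rule sums_finite) (use y in \<open>auto simp: e_def\<close>)
  have ele: "(\<Sum>j<y. e j) \<le> K + 1"
  proof -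
    have "(\<Sum>j<y. e j) \<le> (\<Sum>j<y. (if j = 0 then 1 else 0) + K / real y)"
      by (intro sum_mono) (auto simp: e_def K_def)
    also have "\<dots> = K + 1" using y by (simp add: sum.distrib)
    finally show ?thesis .
  qed
  have le1: "beta_dens m d x \<le> K + 1" for x
    using beta_dens_bounds(2)[OF m d, of x] by (simp add: K_def add.commute add_increasing2 order_trans)
  have "\<bar>measure_pmf.prob (polya m d t) {x. \<sigma> * real x \<le> u} - measure (prop_density (beta_dens m d)) {..u}\<bar>
       \<le> 6 * (K + 1) / integral\<^sup>L lborel (beta_dens m d) * \<sigma>"
  proof (rule kolmogorov_from_local[where \<theta>=\<theta> and e=e, OF le1])
    show "beta_dens m d x = 0" if "x < 0" for x using that by (simp add: beta_dens_def)
    show "suminf e \<le> K + 1" using ele sums_unique[OF esums] by simp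
    fix j
    define P where "P = (LINT x:{\<sigma> * real j..<\<sigma> * real (Suc j)}|lborel. beta_dens m d x)"
    have w: "\<sigma> * real (Suc j) - \<sigma> * real j = \<sigma>" by (simp add: algebra_simps)
    have w': "\<sigma> * real j \<le> \<sigma> * real (Suc j)" using \<sigma> by simp
    consider "j = 0" | "j \<ge> y" | "1 \<le> j" "j < y" by linarith
    thus "\<bar>pmf (polya m d t) j - \<theta> * P\<bar> \<le> \<theta> * \<sigma> * e j"
    proof cases
      case 1
      have "pmf (polya m d t) j = 0"
        using 1 m set_pmf_polya[of m d t] by (fastforce simp: pmf_eq_0_set_pmf)
      moreover have "\<bar>0 * (\<sigma> * real (Suc j) - \<sigma> * real j) - P\<bar> \<le> 1 * (\<sigma> * real (Suc j) - \<sigma> * real j)"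
        unfolding P_def using beta_dens_bounds[OF m d] w' by (intro set_integral_approx) (auto simp: abs_le_iff intro: order_trans[of _ 0])
      ultimately show ?thesis using \<theta> 1 unfolding w by (simp add: e_def abs_mult mult_left_mono)
    next
      case 2
      have "j \<notin> set_pmf (polya m d t)"
      proof
        assume "j \<in> set_pmf (polya m d t)"
        hence "j \<le> m + t" using set_pmf_polya[of m d t] by auto
        thus False using 2 d by (simp add: y_def)
      qed
      hence "pmf (polya m d t) j = 0" by (simp add: pmf_eq_0_set_pmf)
      moreover have "\<bar>0 * (\<sigma> * real (Suc j) - \<sigma> * real j) - P\<bar> \<le> 0 * (\<sigma> * real (Suc j) - \<sigma> * real j)"
        unfolding P_def
      proof (intro set_integral_approx w')
        fix x assume "\<sigma> * real j < x"
        moreover have "\<sigma> * real j \<ge> 1" using 2 y by (simp add: \<sigma>_def)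
        ultimately show "\<bar>0 - beta_dens m d x\<bar> \<le> 0" by (simp add: beta_dens_def)
      qed
      ultimately show ?thesis using 2 y by (simp add: e_def)
    next
      case 3
      define A where "A = (\<Prod>i<m - 1. (real (j - 1) - real i) / real y)"
      define B where "B = (\<Prod>i<d - 1. (real (y - j - 1) - real i) / real y)"
      have AB: "A = real (fact (m - 1)) * real (j - 1 choose (m - 1)) / real y ^ (m - 1)"
               "B = real (fact (d - 1)) * real (y - j - 1 choose (d - 1)) / real y ^ (d - 1)"
        unfolding A_def B_def binomial_fact_prod by (simp_all add: prod_dividef)
      have pm: "pmf (polya m d t) j = \<theta> * \<sigma> * (A * B)"
        unfolding AB \<theta>_def \<sigma>_def using pmf_polya[OF m d, of j t] 3 y bpos unfolding y_def[symmetric] by simp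
      have app: "\<bar>A * B - beta_dens m d x\<bar> \<le> K / real y"
        if x: "\<sigma> * real j < x" "x < \<sigma> * real (Suc j)" for x
      proof -
        have xb: "real j / real y \<le> x" "x < (real j + 1) / real y"
          using x by (simp_all add: \<sigma>_def add.commute less_imp_le)
        have x01: "0 < x" "x < 1"
        proof -
          show "0 < x" using xb(1) 3 y by (intro less_le_trans[OF _ xb(1)]) auto
          have "(real j + 1) / real y \<le> 1" using 3 by simp
          thus "x < 1" using xb(2) by linarith
        qed
        have xy: "real j \<le> x * real y" "x * real y < real j + 1"
          using xb y by (simp_all add: field_simps)
        have a1: "\<bar>(real (j - 1) - real i) / real y - x\<bar> \<le> real m / real y" if "i < m - 1" for i
        proof -
          have "\<bar>(real (j - 1) - real i) / real y - x\<bar> = \<bar>(real j - 1 - real i) - x * real y\<bar> / real y"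
            using 3 y by (simp add: of_nat_diff field_simps abs_if)
          also have "\<dots> \<le> real m / real y"
            using xy that by (intro divide_right_mono) (auto simp: abs_le_iff)
          finally show ?thesis .
        qed
        have b1: "\<bar>(real (y - j - 1) - real i) / real y - (1 - x)\<bar> \<le> real d / real y" if "i < d - 1" for i
        proof -
          have "\<bar>(real (y - j - 1) - real i) / real y - (1 - x)\<bar> = \<bar>(x * real y - real j - 1 - real i)\<bar> / real y"
            using 3 y by (simp add: of_nat_diff field_simps abs_if)
          also have "\<dots> \<le> real d / real y"
            using xy that by (intro divide_right_mono) (auto simp: abs_le_iff)
          finally show ?thesis .
        qed
        have a2: "\<bar>(real (j - 1) - real i) / real y\<bar> \<le> 1" if "i < m - 1" for i
          using that 3 y by (auto simp: abs_if field_simps)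
        have b2: "\<bar>(real (y - j - 1) - real i) / real y\<bar> \<le> 1" if "i < d - 1" for i
          using that 3 y by (auto simp: abs_if field_simps)
        have A1: "\<bar>A - x ^ (m - 1)\<bar> \<le> real (m - 1) * (real m / real y)"
          unfolding A_def using a1 a2 x01 by (intro prod_approx) auto
        have B1: "\<bar>B - (1 - x) ^ (d - 1)\<bar> \<le> real (d - 1) * (real d / real y)"
          unfolding B_def using b1 b2 x01 by (intro prod_approx) auto
        have Ale: "\<bar>A\<bar> \<le> 1"
          unfolding A_def abs_prod using a2 by (intro prod_le_1) auto
        have "A * B - x ^ (m - 1) * (1 - x) ^ (d - 1) = A * (B - (1 - x) ^ (d - 1)) + (A - x ^ (m - 1)) * (1 - x) ^ (d - 1)"
          by (simp add: algebra_simps)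
        also have "\<bar>\<dots>\<bar> \<le> \<bar>A\<bar> * \<bar>B - (1 - x) ^ (d - 1)\<bar> + \<bar>A - x ^ (m - 1)\<bar> * \<bar>(1 - x) ^ (d - 1)\<bar>"
          unfolding abs_mult[symmetric] by (rule abs_triangle_ineq)
        also have "\<dots> \<le> 1 * (real (d - 1) * (real d / real y)) + (real (m - 1) * (real m / real y)) * 1"
          using Ale A1 B1 x01 by (intro add_mono mult_mono) (auto intro!: power_le_one)
        also have "\<dots> \<le> K / real y"
        proof -
          have "real (d - 1) * real d + real (m - 1) * real m \<le> K"
            unfolding K_def power2_eq_square add.commute[of "real m * real m"]
            by (intro add_mono mult_right_mono) auto
          thus ?thesis using y by (simp add: add_divide_distrib[symmetric] divide_right_mono)
        qed
        finally show ?thesis using x01 by (simp add: beta_dens_eq[OF m d])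
      qed
      have "\<bar>A * B * (\<sigma> * real (Suc j) - \<sigma> * real j) - P\<bar> \<le> K / real y * (\<sigma> * real (Suc j) - \<sigma> * real j)"
        unfolding P_def using app by (intro set_integral_approx w')
      hence "\<theta> * \<bar>A * B * \<sigma> - P\<bar> \<le> \<theta> * (K / real y * \<sigma>)" unfolding w using \<theta> by (rule mult_left_mono)
      moreover have "\<theta> * \<bar>A * B * \<sigma> - P\<bar> = \<bar>pmf (polya m d t) j - \<theta> * P\<bar>"
      proof -
        have "pmf (polya m d t) j - \<theta> * P = \<theta> * (A * B * \<sigma> - P)" unfolding pm by (simp add: algebra_simps)
        thus ?thesis using \<theta> by (simp add: abs_mult)
      qed
      ultimately show ?thesis using 3 by (simp add: e_def mult_ac)
    qed
  qed (use \<sigma> \<theta> e0 esums in \<open>auto simp: sums_iff\<close>)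
  thus ?thesis by (simp add: \<sigma>_def K_def beta_distr_def beta_dens_def)
qed

section \<open>The urn with immigration\<close>

text \<open>The differences in \<open>j\<close> obey the recursion of \<open>walk_coeff\<close> with
  \<open>m + 1\<close> in place of \<open>m\<close>. Both the monotonicity and the identity for the
  urn with immigration rest on this.\<close>

lemma walk_coeff_diff_Suc:
  "walk_coeff T m (Suc t) j - walk_coeff T m (Suc t) (Suc j) =
     (walk_coeff T m t j - walk_coeff T m t (Suc j)) * (1 - real (m + j + 1) / real (T t))
     + (walk_coeff T m t (j - 1) - walk_coeff T m t j) * (real j / real (T t))"
  by (simp add: add_divide_distrib algebra_simps)

text \<open>Induction through \<open>walk_coeff_diff_Suc\<close>. The strict inequality leaves room
  for \<open>m + j + 1 \<le> T t\<close> when \<open>j \<le> t\<close>, so the weights are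
  nonnegative; beyond that the coefficients vanish.\<close>

lemma walk_coeff_antimono_Suc:
  assumes T: "\<And>t. m + t < T t"
  shows "walk_coeff T m t (Suc j) \<le> walk_coeff T m t j"
proof (induction t arbitrary: j)
  case (Suc t)
  have "(walk_coeff T m t j - walk_coeff T m t (Suc j)) * (1 - real (m + j + 1) / real (T t)) \<ge> 0"
  proof (cases "j \<le> t")
    case True
    hence "real (m + j + 1) \<le> real (T t)" using T[of t] by linarith
    hence "real (m + j + 1) / real (T t) \<le> 1" by (simp add: divide_le_eq_1)
    thus ?thesis using Suc[of j] by (intro mult_nonneg_nonneg) auto
  qed (simp add: walk_coeff_eq_0)
  moreover have "(walk_coeff T m t (j - 1) - walk_coeff T m t j) * (real j / real (T t)) \<ge> 0"
    using Suc[of "j - 1"] by (cases j) auto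
  ultimately show ?case using walk_coeff_diff_Suc[of T m t j] by linarith
qed simp

lemma antimono_gw:
  assumes T: "\<And>t. m + t < T t" and "i \<le> j"
  shows "walk_coeff T m t j \<le> walk_coeff T m t i"
  using assms(2) by (rule lift_Suc_antimono_le[rotated]) (rule walk_coeff_antimono_Suc[OF T])

lemma walk_coeff_nonneg:
  assumes T: "\<And>t. m + t < T t"
  shows "walk_coeff T m t j \<ge> 0"
  using antimono_gw[OF T, of j "max j (Suc t)" t] by (simp add: walk_coeff_eq_0)

text \<open>The two weights in the recursion add up to \<open>1 - m / T\<close>, so a draw replaces
  the coefficient at \<open>i\<close> by this factor times a mean of those at \<open>i\<close> and
  \<open>i - 1\<close>. Monotonicity places it between the two, and \<open>k\<close> draws look back
  at most \<open>k\<close> indices.\<close>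

lemma walk_coeff_draws_bounds:
  assumes T: "\<And>t. m + t < T t"
  shows "(\<Prod>q<k. 1 - real m / real (T (t + q))) * walk_coeff T m t i \<le> walk_coeff T m (t + k) i"
    and "walk_coeff T m (t + k) i \<le> (\<Prod>q<k. 1 - real m / real (T (t + q))) * walk_coeff T m t (i - k)"
proof -
  have fac: "0 \<le> 1 - real m / real (T t)" for t using T[of t] by (simp add: divide_le_eq)
  have step1: "(1 - real m / real (T t)) * walk_coeff T m t i \<le> walk_coeff T m (Suc t) i" for t i
  proof -
    have "walk_coeff T m t i * (real i / real (T t)) \<le> walk_coeff T m t (i - 1) * (real i / real (T t))"
      by (intro mult_right_mono antimono_gw[OF T]) auto
    thus ?thesis by (simp add: algebra_simps add_divide_distrib)
  qed
  have step2: "walk_coeff T m (Suc t) i \<le> (1 - real m / real (T t)) * walk_coeff T m t (i - 1)" for t i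
  proof (cases "i \<le> Suc t")
    case True
    hence "real (m + i) \<le> real (T t)" using T[of t] by linarith
    hence "real (m + i) / real (T t) \<le> 1" using T[of t] by (simp add: divide_le_eq_1)
    hence "walk_coeff T m t i * (1 - real (m + i) / real (T t)) \<le> walk_coeff T m t (i - 1) * (1 - real (m + i) / real (T t))"
      by (intro mult_right_mono antimono_gw[OF T]) auto
    thus ?thesis by (simp add: algebra_simps add_divide_distrib)
  next
    case False
    thus ?thesis using fac walk_coeff_nonneg[OF T] by (simp add: walk_coeff_eq_0 del: walk_coeff.simps)
  qed
  show "(\<Prod>q<k. 1 - real m / real (T (t + q))) * walk_coeff T m t i \<le> walk_coeff T m (t + k) i"
  proof (induction k)
    case (Suc k)
    have "(\<Prod>q<Suc k. 1 - real m / real (T (t + q))) * walk_coeff T m t i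
      = (1 - real m / real (T (t + k))) * ((\<Prod>q<k. 1 - real m / real (T (t + q))) * walk_coeff T m t i)" by simp
    also have "\<dots> \<le> (1 - real m / real (T (t + k))) * walk_coeff T m (t + k) i"
      using Suc fac by (rule mult_left_mono)
    also have "\<dots> \<le> walk_coeff T m (t + Suc k) i" using step1 by simp
    finally show ?case .
  qed simp
  show "walk_coeff T m (t + k) i \<le> (\<Prod>q<k. 1 - real m / real (T (t + q))) * walk_coeff T m t (i - k)"
  proof (induction k arbitrary: i)
    case (Suc k)
    have "walk_coeff T m (t + Suc k) i \<le> (1 - real m / real (T (t + k))) * walk_coeff T m (t + k) (i - 1)" 
      using step2 by simp
    also have "\<dots> \<le> (1 - real m / real (T (t + k))) * ((\<Prod>q<k. 1 - real m / real (T (t + q))) * walk_coeff T m t (i - 1 - k))"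
      using Suc fac by (rule mult_left_mono)
    finally show ?case by (simp add: mult_ac del: walk_coeff.simps)
  qed simp
qed

text \<open>Total weight before draw \<open>t\<close> when the tracked weight starts at
  \<open>a\<close>: one unit has immigrated at the outset and another arrives after every
  \<open>l\<close> draws.\<close>

definition urn_total :: "nat \<Rightarrow> nat \<Rightarrow> nat \<Rightarrow> nat" where
  "urn_total l a t = a + 1 + t + t div l"

lemma urn_total_gt: "a + t < urn_total l a t"
  by (simp add: urn_total_def)

text \<open>The falling factorial \<open>j (j - 1) ... (j - k + 1)\<close>. It vanishes for
  \<open>j < k\<close>, which neutralises the truncated subtraction in \<open>j - l\<close>
  below.\<close>

definition ffact :: "nat \<Rightarrow> nat \<Rightarrow> real" where
  "ffact k j = real (fact k) * real (j choose k)"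

lemma ffact_shift: "ffact k (j - 1) * real j = ffact k j * real (j - k)"
proof -
  have "(j - k) * (j choose k) = j * (j - 1 choose k)" by (rule binomial_absorb_comp)
  hence "real (j - k) * real (j choose k) = real j * real (j - 1 choose k)" by (metis of_nat_mult)
  thus ?thesis by (simp add: ffact_def mult_ac)
qed

text \<open>Until the second immigrant arrives this is a Polya urn with a single other unit, whose
  coefficients are constant in \<open>j\<close>. It provides the base case of
  \<open>walk_coeff_urn_diff\<close>.\<close>

lemma walk_coeff_urn_first_round:
  assumes "t \<le> l"
  shows "walk_coeff (urn_total l a) a t j = (if j \<le> t then (\<Prod>k<t. 1 - real a / real (urn_total l a k)) else 0)"
  using assms
proof (induction t arbitrary: j)
  case (Suc t)
  define \<kappa> where "\<kappa> = (\<Prod>k<t. 1 - real a / real (urn_total l a k))"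
  have U: "urn_total l a t = a + 1 + t" using Suc.prems by (simp add: urn_total_def)
  have IH: "walk_coeff (urn_total l a) a t j = (if j \<le> t then \<kappa> else 0)" for j
    using Suc unfolding \<kappa>_def by simp
  consider "j \<le> t" | "j = Suc t" | "j > Suc t" by linarith
  thus ?case
  proof cases
    case 2
    have "real (Suc t) / real (urn_total l a t) = 1 - real a / real (urn_total l a t)"
      by (simp add: U field_simps)
    hence "\<kappa> * real (Suc t) / real (urn_total l a t) = \<kappa> * (1 - real a / real (urn_total l a t))"
      unfolding times_divide_eq_right[symmetric] by simp
    thus ?thesis using 2 by (simp add: IH \<kappa>_def[symmetric])
  qed (auto simp: IH \<kappa>_def[symmetric] add_divide_distrib algebra_simps)
qed simp

text \<open>For fixed \<open>j\<close> both sides obey the same recursion in \<open>t\<close>, since \<open>urn_total l a (t + l) = urn_total l a t + l + 1\<close>.\<close>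

lemma walk_coeff_urn_diff:
  assumes l: "l \<ge> 1"
  shows "walk_coeff (urn_total l a) a (t + l) j - walk_coeff (urn_total l a) a (t + l) (Suc j)
    = ffact l j * walk_coeff (urn_total l a) a t (j - l) / (\<Prod>k<l. real (urn_total l a (t + k)))"
proof (induction t arbitrary: j)
  case 0
  have U: "urn_total l a k = a + 1 + k" if "k < l" for k using that by (simp add: urn_total_def)
  have "(\<Prod>k<l. 1 - real a / real (urn_total l a k)) = (\<Prod>k<l. real (Suc k) / real (urn_total l a k))"
    by (intro prod.cong) (auto simp: U field_simps)
  also have "\<dots> = real (fact l) / (\<Prod>k<l. real (urn_total l a k))"
    by (simp add: prod_dividef fact_prod_Suc atLeast0LessThan)
  finally show ?case
    by (cases "j < l"; cases "j = l") (auto simp: walk_coeff_urn_first_round ffact_def)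
next
  case (Suc t)
  define T where "T = real (urn_total l a t)"
  define T' where "T' = real (urn_total l a (t + l))"
  define PP where "PP = (\<Prod>k<l. real (urn_total l a (t + k)))"
  define PP' where "PP' = (\<Prod>k<l. real (urn_total l a (Suc t + k)))"
  define G where "G = walk_coeff (urn_total l a) a t"
  have T': "T' = T + real l + 1" using l by (simp add: T_def T'_def urn_total_def)
  have pos: "T > 0" "T' > 0" "PP > 0" "PP' > 0"
    unfolding T_def T'_def PP_def PP'_def by (auto simp: urn_total_def intro!: prod_pos)
  \<comment> \<open>Moving the window of \<open>l\<close> totals by one exchanges \<open>T\<close>
    for \<open>T'\<close>.\<close>
  have PP: "PP' * T = PP * T'"
  proof -
    have "PP * T' = (\<Prod>k<Suc l. real (urn_total l a (t + k)))" by (simp add: PP_def T'_def)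
    also have "\<dots> = T * (\<Prod>k<l. real (urn_total l a (t + Suc k)))"
      unfolding prod.lessThan_Suc_shift by (simp add: T_def)
    finally show ?thesis by (simp add: PP'_def)
  qed
  have "walk_coeff (urn_total l a) a (Suc t + l) j - walk_coeff (urn_total l a) a (Suc t + l) (Suc j)
    = ffact l j * G (j - l) / PP * (1 - real (a + j + 1) / T')
     + (walk_coeff (urn_total l a) a (t + l) (j - 1) - walk_coeff (urn_total l a) a (t + l) j) * (real j / T')"
    unfolding add_Suc walk_coeff_diff_Suc Suc.IH PP_def T'_def G_def ..
  also have "(walk_coeff (urn_total l a) a (t + l) (j - 1) - walk_coeff (urn_total l a) a (t + l) j) * (real j / T')
      = ffact l j * real (j - l) * G (j - 1 - l) / PP / T'"
  proof (cases j)
    case (Suc i)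
    hence "walk_coeff (urn_total l a) a (t + l) (j - 1) - walk_coeff (urn_total l a) a (t + l) j = ffact l (j - 1) * G (j - 1 - l) / PP"
      using Suc.IH[of i] by (simp add: G_def PP_def)
    hence "(walk_coeff (urn_total l a) a (t + l) (j - 1) - walk_coeff (urn_total l a) a (t + l) j) * (real j / T')
       = (ffact l (j - 1) * real j) * G (j - 1 - l) / PP / T'" by simp
    thus ?thesis unfolding ffact_shift .
  qed simp
  also have "ffact l j * G (j - l) / PP * (1 - real (a + j + 1) / T') + ffact l j * real (j - l) * G (j - 1 - l) / PP / T'
     = ffact l j * (G (j - l) * (T' - real (a + j + 1)) + G (j - 1 - l) * real (j - l)) / (PP * T')"
    using pos by (simp add: field_simps)
  \<comment> \<open>For \<open>j \<ge> l\<close>, \<open>T' = T + l + 1\<close> absorbs the shift of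
    the index by \<open>l\<close>; for \<open>j < l\<close> the falling factorial vanishes.\<close>
  also have "\<dots> = ffact l j * (G (j - l) * (T - real (a + (j - l))) + G (j - l - 1) * real (j - l)) / (PP' * T)"
    unfolding PP by (cases "j < l") (auto simp: ffact_def T' of_nat_diff algebra_simps diff_commute)
  also have "\<dots> = ffact l j * walk_coeff (urn_total l a) a (Suc t) (j - l) / PP'"
    unfolding walk_coeff.simps T_def[symmetric] G_def[symmetric] using pos by (simp add: field_simps)
  finally show ?case by (simp add: PP'_def)
qed

text \<open>The product of \<open>urn_total l a t - a\<close> over one round of draws; it does not depend on \<open>a\<close>.\<close>

definition round_prod :: "nat \<Rightarrow> nat \<Rightarrow> real" where
  "round_prod l n = (\<Prod>k<l. 1 + real k + (real l + 1) * real n)"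

text \<open>The identity \<open>walk_coeff_urn_diff\<close> involves the coefficients of one round
  earlier. The bounds over \<open>l\<close> draws trade them for current ones at the indices
  \<open>j\<close> and \<open>j - l\<close>, and the factor \<open>\<kappa>\<close> in those bounds
  combines with the product of totals to \<open>round_prod\<close>.\<close>

lemma walk_coeff_urn_sandwich:
  fixes l a n j :: nat
  assumes l: "l \<ge> 1"
  defines "G \<equiv> walk_coeff (urn_total l a) a (l * Suc n)"
  shows "ffact l j / round_prod l n * G j \<le> G j - G (Suc j)"
    and "G j - G (Suc j) \<le> ffact l j / round_prod l n * G (j - l)"
proof -
  define t where "t = l * n"
  define PP where "PP = (\<Prod>k<l. real (urn_total l a (t + k)))"
  define \<kappa> where "\<kappa> = (\<Prod>q<l. 1 - real a / real (urn_total l a (t + q)))"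
  define g where "g = walk_coeff (urn_total l a) a t (j - l)"
  have G: "G = walk_coeff (urn_total l a) a (t + l)" by (simp add: G_def t_def add.commute)
  have U: "real (urn_total l a (t + k)) - real a = 1 + real k + (real l + 1) * real n" if "k < l" for k
    using that l by (simp add: urn_total_def t_def algebra_simps)
  have PPpos: "PP > 0" unfolding PP_def by (auto simp: urn_total_def intro!: prod_pos)
  have "PP * \<kappa> = (\<Prod>k<l. real (urn_total l a (t + k)) - real a)"
    unfolding PP_def \<kappa>_def prod.distrib[symmetric] using urn_total_gt
    by (intro prod.cong) (auto simp: field_simps urn_total_def)
  also have "\<dots> = round_prod l n" unfolding round_prod_def using U by (intro prod.cong) auto
  finally have R: "round_prod l n = PP * \<kappa>" by simp
  have Rpos: "round_prod l n > 0" unfolding round_prod_def by (intro prod_pos) (auto intro: add_pos_nonneg)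
  hence \<kappa>pos: "\<kappa> > 0" using R PPpos by (simp add: zero_less_mult_iff)
  have D: "G j - G (Suc j) = ffact l j / round_prod l n * (\<kappa> * g)"
    unfolding G walk_coeff_urn_diff[OF l] R g_def PP_def[symmetric] using \<kappa>pos by simp
  have f: "ffact l j / round_prod l n \<ge> 0" using Rpos by (simp add: ffact_def)
  have 1: "G j \<le> \<kappa> * g" "\<kappa> * g \<le> G (j - l)"
    unfolding G \<kappa>_def g_def using walk_coeff_draws_bounds[where T="urn_total l a", OF urn_total_gt] by auto
  show "ffact l j / round_prod l n * G j \<le> G j - G (Suc j)"
       "G j - G (Suc j) \<le> ffact l j / round_prod l n * G (j - l)"
    unfolding D by (intro mult_left_mono f 1)+
qed

section \<open>Falling factorials and the discrete differential inequality\<close>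

lemma ffact_nonneg: "ffact k j \<ge> 0"
  by (simp add: ffact_def)

lemma ffact_mono: "i \<le> j \<Longrightarrow> ffact k i \<le> ffact k j"
  unfolding ffact_def by (intro mult_left_mono of_nat_mono binomial_right_mono) auto

lemma ffact_Suc: "ffact (Suc k) j = (real j - real k) * ffact k j"
proof (cases "k \<le> j")
  case True
  have "Suc k * (j choose Suc k) = (j - k) * (j choose k)" by (rule binomial_absorption[of k j, unfolded binomial_absorb_comp[symmetric]])
  hence "real (Suc k) * real (j choose Suc k) = real (j - k) * real (j choose k)" by (metis of_nat_mult)
  moreover have "ffact (Suc k) j = real (fact k) * (real (Suc k) * real (j choose Suc k))"
    unfolding ffact_def fact_Suc of_nat_mult by simp
  ultimately show ?thesis using True by (simp add: ffact_def of_nat_diff)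
qed (simp add: ffact_def binomial_eq_0)

lemma ffact_diff: "ffact (Suc k) (Suc j) - ffact (Suc k) j = real (Suc k) * ffact k j"
  by (simp add: ffact_def algebra_simps)

lemma ffact_le_power: "ffact k j \<le> real j ^ k"
proof (induction k)
  case (Suc k)
  show ?case
  proof (cases "k \<le> j")
    case True
    have "(real j - real k) * ffact k j \<le> real j * real j ^ k"
      using Suc True ffact_nonneg by (intro mult_mono) auto
    thus ?thesis by (simp add: ffact_Suc)
  qed (simp add: ffact_def binomial_eq_0)
qed (simp add: ffact_def)

lemma power_minus_ffact_le: "real j ^ Suc k - ffact (Suc k) j \<le> real (Suc k) ^ 2 * real j ^ k"
proof (induction k)
  case (Suc k)
  have "real j ^ Suc (Suc k) - ffact (Suc (Suc k)) j
     = real j * (real j ^ Suc k - ffact (Suc k) j) + real (Suc k) * ffact (Suc k) j"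
    unfolding ffact_Suc[of "Suc k"] by (simp add: algebra_simps)
  also have "\<dots> \<le> real j * (real (Suc k) ^ 2 * real j ^ k) + real (Suc k) * real j ^ Suc k"
    by (intro add_mono mult_left_mono Suc ffact_le_power) auto
  also have "\<dots> = (real (Suc k) ^ 2 + real (Suc k)) * real j ^ Suc k" by (simp add: algebra_simps)
  also have "\<dots> \<le> real (Suc (Suc k)) ^ 2 * real j ^ Suc k"
    by (intro mult_right_mono) (auto simp: power2_eq_square algebra_simps)
  finally show ?case .
qed (simp add: ffact_def)

lemma exp_minus_le_quadratic: "(x::real) \<ge> 0 \<Longrightarrow> exp (- x) \<le> 1 - x + x ^ 2"
proof (cases "x \<le> 1")
  case True
  assume "x \<ge> 0"
  have "exp (- x) * exp x = 1" by (simp flip: exp_add)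
  moreover have "1 + x \<le> exp x" by simp
  ultimately have "exp (- x) * (1 + x) \<le> 1" by (metis exp_ge_zero mult_left_mono)
  hence "exp (- x) \<le> 1 / (1 + x)" using \<open>x \<ge> 0\<close> by (simp add: field_simps)
  also have "1 / (1 + x) \<le> 1 - x + x ^ 2"
  proof -
    have "1 \<le> (1 - x + x ^ 2) * (1 + x)" using \<open>x \<ge> 0\<close> by (simp add: algebra_simps power2_eq_square)
    thus ?thesis using \<open>x \<ge> 0\<close> by (simp add: field_simps)
  qed
  finally show ?thesis .
next
  case False
  assume "x \<ge> 0"
  hence "exp (- x) \<le> 1" by simp
  also have "1 \<le> 1 - x + x ^ 2" using False by (simp add: power2_eq_square)
  finally show ?thesis .
qed

text \<open>The inequality of \<open>walk_coeff_urn_sandwich\<close> in isolation, with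
  \<open>1 / round_prod\<close> written as \<open>(l + 1) * \<tau>\<close>. The relative decrements
  then add up to \<open>\<tau>\<close> times a falling factorial of order
  \<open>l + 1\<close>.\<close>

locale near_exp =
  fixes G :: "nat \<Rightarrow> real" and l :: nat and \<tau> :: real
  assumes l: "l \<ge> 1" and \<tau>: "\<tau> > 0" and G_nonneg: "\<And>j. G j \<ge> 0"
    and lower: "\<And>j. (real l + 1) * \<tau> * ffact l j * G j \<le> G j - G (Suc j)"
    and upper: "\<And>j. G j - G (Suc j) \<le> (real l + 1) * \<tau> * ffact l j * G (j - l)"
begin

text \<open>\<open>x j\<close> is the relative decrement prescribed at \<open>j\<close> and also
  \<open>\<tau>\<close> times the forward difference of \<open>ffact (Suc l)\<close>. Hence
  \<open>E\<close> loses exactly the factor \<open>exp (- x j)\<close> in each step.\<close>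

definition x :: "nat \<Rightarrow> real" where "x j = (real l + 1) * \<tau> * ffact l j"
definition E :: "nat \<Rightarrow> real" where "E j = exp (- \<tau> * ffact (Suc l) j)"

lemma x_nonneg: "x j \<ge> 0"
  using \<tau> ffact_nonneg by (simp add: x_def)

lemma x_mono: "i \<le> j \<Longrightarrow> x i \<le> x j"
  unfolding x_def using \<tau> by (intro mult_left_mono ffact_mono) auto

lemma E_Suc: "E (Suc j) = exp (- x j) * E j"
proof -
  have "ffact (Suc l) (Suc j) = ffact (Suc l) j + (real l + 1) * ffact l j"
    using ffact_diff[of l j] by (simp add: algebra_simps)
  thus ?thesis unfolding E_def x_def exp_add[symmetric] by (simp add: algebra_simps)
qed

lemma E_0 [simp]: "E 0 = 1"
  by (simp add: E_def ffact_def)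

lemma E_pos: "E j > 0"
  by (simp add: E_def)

lemma G_antimono: "i \<le> j \<Longrightarrow> G j \<le> G i"
proof (rule lift_Suc_antimono_le[of G])
  fix j
  have "x j * G j \<ge> 0" using x_nonneg G_nonneg by simp
  thus "G (Suc j) \<le> G j" using lower[of j] unfolding x_def by linarith
qed

text \<open>From \<open>lower\<close> and \<open>1 - x \<le> exp (- x)\<close>.\<close>

lemma G_le: "G j \<le> G 0 * E j"
proof (induction j)
  case (Suc j)
  have "G (Suc j) \<le> (1 - x j) * G j" using lower[of j] by (simp add: x_def algebra_simps)
  also have "\<dots> \<le> exp (- x j) * G j"
    using exp_ge_add_one_self[of "- x j"] G_nonneg by (intro mult_right_mono) auto
  also have "\<dots> \<le> exp (- x j) * (G 0 * E j)" using Suc by (intro mult_left_mono) auto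
  finally show ?case by (simp add: E_Suc mult_ac)
qed simp

lemma E_shift: "E (j - k) \<le> E j * exp (real k * x j)"
proof (induction k)
  case (Suc k)
  show ?case
  proof (cases "k < j")
    case True
    define i where "i = j - Suc k"
    have i: "j - k = Suc i" "i \<le> j" using True by (auto simp: i_def)
    have "E i = E (Suc i) * exp (x i)" by (simp add: E_Suc mult_exp_exp)
    also have "\<dots> \<le> (E j * exp (real k * x j)) * exp (x j)"
      using Suc i x_mono E_pos by (intro mult_mono) (auto intro: less_imp_le)
    finally show ?thesis by (simp add: i_def algebra_simps mult_exp_exp flip: mult.assoc)
  next
    case False
    hence "E (j - Suc k) \<le> E j * exp (real k * x j)" using Suc by simp
    also have "\<dots> \<le> E j * exp (real (Suc k) * x j)"
      using x_nonneg E_pos by (intro mult_left_mono) (auto intro: less_imp_le mult_right_mono)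
    finally show ?thesis .
  qed
qed simp

lemma G_drop: "G (j - k) - G j \<le> real k * x j * G (j - k - l)"
proof (induction k)
  case (Suc k)
  have mono: "real k * x j * G (j - k - l) \<le> real k * x j * G (j - Suc k - l)"
    using x_nonneg by (intro mult_left_mono G_antimono) auto
  show ?case
  proof (cases "k < j")
    case True
    define i where "i = j - Suc k"
    have i: "j - k = Suc i" "i \<le> j" using True by (auto simp: i_def)
    have "G i - G (Suc i) \<le> x i * G (i - l)" using upper[of i] by (simp add: x_def)
    also have "\<dots> \<le> x j * G (i - l)" using i x_mono G_nonneg by (intro mult_right_mono) auto
    finally show ?thesis using Suc mono unfolding i(1) i_def[symmetric] by (simp add: algebra_simps)
  next
    case False
    hence "G (j - Suc k) - G j \<le> real k * x j * G (j - k - l)" using Suc by simp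
    also have "\<dots> \<le> real (Suc k) * x j * G (j - Suc k - l)"
      using mono x_nonneg[of j] G_nonneg[of "j - Suc k - l"]
      by (simp add: distrib_right) (smt (verit) mult_nonneg_nonneg)
    finally show ?thesis .
  qed
qed simp

text \<open>Each step contributes at most \<open>l + 1\<close> terms of second order in
  \<open>x j\<close>: \<open>l\<close> from replacing \<open>G (j - l)\<close> by
  \<open>G j\<close>, one from \<open>exp (- x)\<close> against \<open>1 - x\<close>. There are
  \<open>j\<close> steps, and the exponential factor pays for comparing earlier values of
  \<open>E\<close> with the current one.\<close>

lemma G_ge: "G 0 * E j - G j \<le> (real l + 1) * real j * (x j) ^ 2 * exp (2 * (real l + 1) * x j) * (G 0 * E j)"
proof (induction j)
  case (Suc j)
  define D where "D = G 0 * E j - G j"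
  \<comment> \<open>The index goes back by \<open>2 * l\<close>: \<open>l\<close> in
    \<open>upper\<close>, and \<open>l\<close> more in the decrements between \<open>j - l\<close>
    and \<open>j\<close>.\<close>
  define W where "W = (x j) ^ 2 * (G 0 * E (j - 2 * l))"
  have D0: "D \<ge> 0" using G_le[of j] by (simp add: D_def)
  have W0: "W \<ge> 0" unfolding W_def using G_nonneg E_pos by (intro mult_nonneg_nonneg) (auto intro: less_imp_le)
  have "G j - G (Suc j) \<le> x j * G (j - l)" using upper[of j] by (simp add: x_def)
  also have "\<dots> \<le> x j * (G j + real l * x j * G (j - 2 * l))"
    using G_drop[of j l] x_nonneg by (intro mult_left_mono) (auto simp: mult_2 diff_diff_left)
  also have "\<dots> \<le> x j * G j + real l * W"
  proof -
    have "x j ^ 2 * G (j - 2 * l) \<le> W" unfolding W_def by (intro mult_left_mono G_le) auto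
    hence "real l * (x j ^ 2 * G (j - 2 * l)) \<le> real l * W" by (rule mult_left_mono) auto
    thus ?thesis by (simp add: algebra_simps power2_eq_square)
  qed
  finally have 1: "G (Suc j) \<ge> (1 - x j) * G j - real l * W" by (simp add: algebra_simps)
  have 2: "exp (- x j) * (G 0 * E j) \<le> (1 - x j) * (G 0 * E j) + W"
  proof -
    have E2: "E j \<le> E (j - 2 * l)" unfolding E_def using \<tau> by (simp add: ffact_mono)
    have "exp (- x j) * (G 0 * E j) \<le> (1 - x j + x j ^ 2) * (G 0 * E j)"
      using exp_minus_le_quadratic[OF x_nonneg] G_nonneg E_pos
      by (intro mult_right_mono mult_nonneg_nonneg) (auto intro: less_imp_le)
    also have "\<dots> = (1 - x j) * (G 0 * E j) + x j ^ 2 * (G 0 * E j)" by (simp add: algebra_simps)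
    also have "x j ^ 2 * (G 0 * E j) \<le> W" unfolding W_def
      using E2 G_nonneg by (intro mult_left_mono) auto
    finally show ?thesis by simp
  qed
  have "G 0 * E (Suc j) - G (Suc j) \<le> (1 - x j) * D + (real l + 1) * W"
    using 1 2 unfolding D_def E_Suc by (simp add: algebra_simps)
  also have "(1 - x j) * D \<le> exp (- x j) * D"
    using D0 exp_ge_add_one_self[of "- x j"] by (intro mult_right_mono) auto
  also have "exp (- x j) * D \<le> exp (- x j) * ((real l + 1) * real j * (x j) ^ 2 * exp (2 * (real l + 1) * x j) * (G 0 * E j))"
    using Suc unfolding D_def by (rule mult_left_mono) auto
  also have "\<dots> = (real l + 1) * real j * ((x j) ^ 2 * exp (2 * (real l + 1) * x j) * (G 0 * E (Suc j)))"
    by (simp add: E_Suc mult_ac)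
  also have "(real l + 1) * W \<le> (real l + 1) * ((x j) ^ 2 * exp (2 * (real l + 1) * x j) * (G 0 * E (Suc j)))"
  proof -
    have "E (j - 2 * l) \<le> E j * exp (real (2 * l) * x j)" by (rule E_shift)
    also have "\<dots> = E (Suc j) * (exp (x j) * exp (real (2 * l) * x j))" by (simp add: E_Suc mult_exp_exp)
    also have "\<dots> \<le> E (Suc j) * exp (2 * (real l + 1) * x j)"
      unfolding mult_exp_exp using E_pos x_nonneg[of j] by (intro mult_left_mono) (auto intro: less_imp_le simp: algebra_simps)
    finally have "W \<le> (x j) ^ 2 * (G 0 * (E (Suc j) * exp (2 * (real l + 1) * x j)))"
      unfolding W_def using G_nonneg by (intro mult_left_mono) auto
    thus ?thesis by (intro mult_left_mono) (auto simp: mult_ac)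
  qed
  finally have "G 0 * E (Suc j) - G (Suc j) \<le> (real l + 1) * real (Suc j) * ((x j) ^ 2 * exp (2 * (real l + 1) * x j) * (G 0 * E (Suc j)))"
    by (simp add: algebra_simps)
  also have "\<dots> \<le> (real l + 1) * real (Suc j) * ((x (Suc j)) ^ 2 * exp (2 * (real l + 1) * x (Suc j)) * (G 0 * E (Suc j)))"
    using x_mono[of j "Suc j"] x_nonneg mult_nonneg_nonneg[OF G_nonneg[of 0] less_imp_le[OF E_pos[of "Suc j"]]]
    by (intro mult_left_mono mult_right_mono mult_mono power_mono) auto
  finally show ?case by (simp add: mult_ac)
qed simp

end

text \<open>Two errors of order \<open>\<sigma>\<close>: falling factorials against powers of
  \<open>j\<close> give the term with \<open>z ^ l\<close>, and \<open>G_ge\<close>, where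
  \<open>j * (x j)\<^sup>2\<close> is at most a multiple of
  \<open>\<sigma> * z ^ (2 * l + 1)\<close>, gives the other. The remaining exponential factor has
  an exponent of degree \<open>l\<close> only and is harmless against
  \<open>exp (- (z ^ Suc l))\<close>.\<close>

lemma near_exp_local:
  fixes \<sigma> :: real and j :: nat
  assumes "near_exp G l \<tau>" and \<sigma>: "0 < \<sigma>" "\<sigma> \<le> 1" "\<tau> = \<sigma> ^ Suc l" and G0: "G 0 = 1"
  defines "z \<equiv> \<sigma> * real j" and "b \<equiv> real l + 1"
  shows "G j \<le> exp (3 * b\<^sup>2 * z ^ l - z ^ Suc l)"
    and "\<bar>G j - exp (- (z ^ Suc l))\<bar> \<le> \<sigma> * b ^ 3 * (z ^ l + z ^ (2 * l + 1)) * exp (3 * b\<^sup>2 * z ^ l - z ^ Suc l)"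
proof -
  interpret near_exp G l \<tau> by fact
  have z0: "z \<ge> 0" using \<sigma> by (simp add: z_def)
  have b1: "b \<ge> 1" by (simp add: b_def)
  have zS: "z ^ Suc l = \<tau> * real j ^ Suc l" unfolding z_def \<sigma>(3) by (rule power_mult_distrib)
  have zl: "\<sigma> * z ^ l = \<tau> * real j ^ l" unfolding z_def \<sigma>(3) by (simp add: power_mult_distrib)
  have "\<tau> * real j ^ Suc l - \<tau> * ffact (Suc l) j \<le> \<tau> * (b\<^sup>2 * real j ^ l)"
    unfolding right_diff_distrib[symmetric] using \<tau> power_minus_ffact_le[of j l]
    by (intro mult_left_mono) (auto simp: b_def add.commute)
  hence d1: "z ^ Suc l - \<tau> * ffact (Suc l) j \<le> b\<^sup>2 * (\<sigma> * z ^ l)"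
    unfolding zS zl by (simp add: mult_ac)
  have d0: "\<tau> * ffact (Suc l) j \<le> z ^ Suc l"
    unfolding zS using \<tau> by (intro mult_left_mono ffact_le_power) auto
  \<comment> \<open>\<open>\<sigma> * c\<close> bounds the error in the exponent of
    \<open>E\<close>, and \<open>c\<close> bounds \<open>b * x j\<close>. Of the 3 in the final
    exponent, 1 goes to \<open>E\<close> and 2 to the exponential in \<open>G_ge\<close>.\<close>
  define c where "c = b\<^sup>2 * z ^ l"
  have c0: "c \<ge> 0" using z0 by (simp add: c_def)
  have d1': "z ^ Suc l - \<tau> * ffact (Suc l) j \<le> \<sigma> * c" using d1 by (simp add: c_def mult_ac)
  have \<sigma>c: "\<sigma> * c \<le> c" using \<sigma> c0 by (simp add: mult_left_le_one_le)
  have EE: "E j = exp (- (z ^ Suc l)) * exp (z ^ Suc l - \<tau> * ffact (Suc l) j)"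
    unfolding E_def exp_add[symmetric] by simp
  have E_up: "E j \<le> exp (- (z ^ Suc l)) * exp c"
    unfolding EE using d1' \<sigma>c by (intro mult_left_mono) auto
  have E_lo: "exp (- (z ^ Suc l)) \<le> E j" using d0 by (simp add: E_def)
  have X: "exp (3 * b\<^sup>2 * z ^ l - z ^ Suc l) = exp (- (z ^ Suc l)) * exp (3 * c)"
    unfolding exp_add[symmetric] by (simp add: c_def)
  show "G j \<le> exp (3 * b\<^sup>2 * z ^ l - z ^ Suc l)"
  proof -
    have "G j \<le> E j" using G_le[of j] G0 by simp
    also note E_up
    also have "exp (- (z ^ Suc l)) * exp c \<le> exp (- (z ^ Suc l)) * exp (3 * c)" using c0 by simp
    finally show ?thesis unfolding X .
  qed
  have Eup2: "E j - exp (- (z ^ Suc l)) \<le> \<sigma> * b ^ 3 * z ^ l * (exp (- (z ^ Suc l)) * exp (3 * c))"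
  proof -
    have "exp (\<sigma> * c) - 1 \<le> \<sigma> * c * exp (\<sigma> * c)"
    proof -
      have "(1 - \<sigma> * c) * exp (\<sigma> * c) \<le> exp (- (\<sigma> * c)) * exp (\<sigma> * c)"
        using exp_ge_add_one_self[of "- (\<sigma> * c)"] by (intro mult_right_mono) auto
      also have "\<dots> = 1" by (simp flip: exp_add)
      finally show ?thesis by (simp add: algebra_simps)
    qed
    also have "\<dots> \<le> \<sigma> * (b ^ 3 * z ^ l) * exp (3 * c)"
    proof (intro mult_mono)
      have "b\<^sup>2 \<le> b ^ 3" using b1 by (intro power_increasing) auto
      thus "c \<le> b ^ 3 * z ^ l" unfolding c_def using z0 by (intro mult_right_mono) auto
    qed (use \<sigma> c0 z0 b1 \<sigma>c in auto)
    finally have 1: "exp (\<sigma> * c) - 1 \<le> \<sigma> * (b ^ 3 * z ^ l) * exp (3 * c)" .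
    have "E j - exp (- (z ^ Suc l)) = exp (- (z ^ Suc l)) * (exp (z ^ Suc l - \<tau> * ffact (Suc l) j) - 1)"
      unfolding EE by (simp add: algebra_simps)
    also have "\<dots> \<le> exp (- (z ^ Suc l)) * (exp (\<sigma> * c) - 1)"
      using d1' by (intro mult_left_mono) auto
    also have "\<dots> \<le> exp (- (z ^ Suc l)) * (\<sigma> * (b ^ 3 * z ^ l) * exp (3 * c))"
      using 1 by (intro mult_left_mono) auto
    finally show ?thesis by (simp add: mult_ac)
  qed
  have xle: "x j \<le> b * (\<sigma> * z ^ l)"
    unfolding zl x_def b_def[symmetric] mult.assoc using \<tau> b1 ffact_le_power by (intro mult_left_mono) auto
  have "x j \<le> \<sigma> * c / b"
    using xle b1 by (simp add: c_def power2_eq_square field_simps)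
  hence xb: "b * x j \<le> c" using \<sigma>c b1 by (simp add: field_simps)
  have lo: "E j - G j \<le> \<sigma> * b ^ 3 * z ^ (2 * l + 1) * (exp (- (z ^ Suc l)) * exp (3 * c))"
  proof -
    have "E j - G j \<le> b * real j * (x j) ^ 2 * exp (2 * b * x j) * E j"
      using G_ge[of j] G0 by (simp add: b_def)
    also have "\<dots> \<le> b * real j * (b * (\<sigma> * z ^ l)) ^ 2 * exp (2 * c) * (exp (- (z ^ Suc l)) * exp c)"
      using xle xb x_nonneg E_up E_pos b1 z0 \<sigma>
      by (intro mult_mono power_mono) (auto intro: less_imp_le mult_nonneg_nonneg)
    also have "\<dots> = (b * real j * (b * (\<sigma> * z ^ l)) ^ 2) * (exp (2 * c) * (exp (- (z ^ Suc l)) * exp c))"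
      by (simp only: mult.assoc)
    also have "b * real j * (b * (\<sigma> * z ^ l)) ^ 2 = \<sigma> * b ^ 3 * (z * z ^ l * z ^ l)"
      unfolding z_def by (simp add: power2_eq_square power3_eq_cube)
    also have "z * z ^ l * z ^ l = z ^ (2 * l + 1)" by (simp add: power_add mult_2)
    also have "exp (2 * c) * (exp (- (z ^ Suc l)) * exp c) = exp (- (z ^ Suc l)) * exp (3 * c)"
      unfolding mult_exp_exp by simp
    finally show ?thesis .
  qed
  have nn: "\<sigma> * b ^ 3 * z ^ l * (exp (- (z ^ Suc l)) * exp (3 * c)) \<ge> 0"
       "\<sigma> * b ^ 3 * z ^ (2 * l + 1) * (exp (- (z ^ Suc l)) * exp (3 * c)) \<ge> 0"
    using \<sigma> b1 z0 by auto
  have "G j \<le> E j" using G_le[of j] G0 by simp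
  thus "\<bar>G j - exp (- (z ^ Suc l))\<bar> \<le> \<sigma> * b ^ 3 * (z ^ l + z ^ (2 * l + 1)) * exp (3 * b\<^sup>2 * z ^ l - z ^ Suc l)"
    unfolding X using lo Eup2 E_lo nn by (simp only: distrib_left distrib_right abs_le_iff) linarith
qed

section \<open>The generalised gamma density\<close>

lemma power_div_fact_le_exp:
  fixes w :: real
  assumes "w \<ge> 0"
  shows "w ^ k \<le> real (fact k) * exp w"
proof -
  have "w ^ k / fact k \<le> (\<Sum>n. w ^ n / fact n)"
    using sum_le_suminf[OF summable_exp_generic[of w], of "{k}"] assms
    by (simp add: divide_inverse mult.commute)
  also have "\<dots> = exp w" by (simp add: exp_def divide_inverse mult.commute)
  finally show ?thesis by (simp add: field_simps)
qed

text \<open>\<open>z ^ Suc l\<close> dominates \<open>c * z ^ l + 2 * z\<close> up to a constant. Of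
  the added \<open>2 * z\<close>, one half pays for the polynomial through
  \<open>exp (z + q)\<close>, the other leaves the tail \<open>exp (- z)\<close>.\<close>

lemma power_times_exp_bound:
  fixes c q :: real
  assumes l: "l \<ge> 1" and c: "c \<ge> 0" and q: "q \<ge> 0"
  shows "\<exists>K>0. \<forall>z\<ge>0. (z + q) ^ k * exp (c * z ^ l - z ^ Suc l) \<le> K * exp (- z)"
proof (intro exI conjI allI impI)
  let ?K = "real (fact k) * exp q * exp ((c + 2) ^ Suc l)"
  show "?K > 0" by simp
  fix z :: real assume z: "z \<ge> 0"
  have main: "c * z ^ l + 2 * z - z ^ Suc l \<le> (c + 2) ^ Suc l"
  proof (cases "z \<le> 1")
    case True
    have "c * z ^ l + 2 * z - z ^ Suc l \<le> c * 1 + 2 * 1 - 0"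
      using True z c by (intro diff_mono add_mono mult_left_mono) (auto intro: power_le_one)
    also have "\<dots> = (c + 2) ^ 1" by simp
    also have "\<dots> \<le> (c + 2) ^ Suc l" using c by (intro power_increasing) auto
    finally show ?thesis .
  next
    case False
    have "z ^ 1 \<le> z ^ l" using l False by (intro power_increasing) auto
    hence "c * z ^ l + 2 * z - z ^ Suc l \<le> (c + 2 - z) * z ^ l" by (simp add: algebra_simps)
    also have "\<dots> \<le> (c + 2) ^ Suc l"
    proof (cases "z \<le> c + 2")
      case True
      have "(c + 2 - z) * z ^ l \<le> (c + 2) * (c + 2) ^ l"
        using True z by (intro mult_mono power_mono) auto
      thus ?thesis by simp
    next
      case False
      have "(c + 2 - z) * z ^ l \<le> 0" using False z by (intro mult_nonpos_nonneg) auto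
      also have "0 \<le> (c + 2) ^ Suc l" using c by simp
      finally show ?thesis .
    qed
    finally show ?thesis .
  qed
  have "(z + q) ^ k * exp (c * z ^ l - z ^ Suc l) \<le> real (fact k) * exp (z + q) * exp (c * z ^ l - z ^ Suc l)"
    using z q by (intro mult_right_mono power_div_fact_le_exp) auto
  also have "\<dots> = real (fact k) * exp q * exp (c * z ^ l + 2 * z - z ^ Suc l) * exp (- z)"
    by (simp add: mult_exp_exp mult.assoc algebra_simps)
  also have "\<dots> \<le> ?K * exp (- z)"
    using main by (intro mult_right_mono mult_left_mono) auto
  finally show "(z + q) ^ k * exp (c * z ^ l - z ^ Suc l) \<le> ?K * exp (- z)" .
qed

corollary power_times_exp_bound_0:
  assumes l: "l \<ge> 1"
  obtains K :: real where "K > 0" "\<And>z. z \<ge> 0 \<Longrightarrow> z ^ k * exp (- (z ^ Suc l)) \<le> K * exp (- z)"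
  using power_times_exp_bound[OF l, of 0 0 k] that by auto

lemma power_diff_le:
  fixes y z W :: real
  assumes "0 \<le> z" "z \<le> y" "y \<le> W" "1 \<le> W"
  shows "y ^ k - z ^ k \<le> real k * (y - z) * W ^ k"
proof (induction k)
  case (Suc k)
  have W: "W ^ k \<le> W ^ Suc k" using assms by (intro power_increasing) auto
  have "y ^ Suc k - z ^ Suc k = y * (y ^ k - z ^ k) + (y - z) * z ^ k" by (simp add: algebra_simps)
  also have "\<dots> \<le> W * (real k * (y - z) * W ^ k) + (y - z) * W ^ Suc k"
  proof (intro add_mono mult_mono Suc mult_left_mono)
    have "z ^ k \<le> W ^ k" using assms by (intro power_mono) auto
    thus "z ^ k \<le> W ^ Suc k" using W by linarith
    show "0 \<le> y ^ k - z ^ k" using assms by (simp add: power_mono)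
  qed (use assms in auto)
  also have "\<dots> = real (Suc k) * (y - z) * W ^ Suc k" by (simp add: algebra_simps)
  finally show ?case .
qed simp

definition gga_dens :: "nat \<Rightarrow> nat \<Rightarrow> real \<Rightarrow> real" where
  "gga_dens a b = (\<lambda>x. indicator {0<..} x * x powr (real a - 1) * exp (- (x powr real b)))"

lemma gga_dens_eq:
  assumes "a \<ge> 1" "b \<ge> 1"
  shows "gga_dens a b x = indicator {0<..} x * (x ^ (a - 1) * exp (- (x ^ b)))"
proof (cases "x > 0")
  case True
  hence "x powr (real a - 1) = x ^ (a - 1)" "x powr real b = x ^ b"
    using assms by (simp_all add: powr_realpow[symmetric] of_nat_diff)
  thus ?thesis by (simp add: gga_dens_def)
qed (simp add: gga_dens_def)

lemma gga_dens_nonneg: "gga_dens a b x \<ge> 0"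
  by (simp add: gga_dens_def)

text \<open>The bounds serve three ends: Lipschitz continuity of the distribution function,
  integrability, and changes of scale, where intervals have a length proportional to their distance
  from 0.\<close>

lemma gga_dens_bounds:
  assumes a: "a \<ge> 1" and l: "l \<ge> 1"
  shows "\<exists>K>0. \<forall>x. gga_dens a (Suc l) x \<le> K \<and> gga_dens a (Suc l) x \<le> K * exp (- x) \<and> \<bar>x\<bar> * gga_dens a (Suc l) x \<le> K"
proof -
  obtain K1 :: real where K1: "K1 > 0" "\<And>z. z \<ge> 0 \<Longrightarrow> z ^ (a - 1) * exp (- (z ^ Suc l)) \<le> K1 * exp (- z)"
    by (rule power_times_exp_bound_0[OF l, of "a - 1"]) (rule that)
  obtain K2 :: real where K2: "K2 > 0" "\<And>z. z \<ge> 0 \<Longrightarrow> z ^ a * exp (- (z ^ Suc l)) \<le> K2 * exp (- z)"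
    by (rule power_times_exp_bound_0[OF l, of a]) (rule that)
  have "gga_dens a (Suc l) x \<le> K1 + K2 \<and> gga_dens a (Suc l) x \<le> (K1 + K2) * exp (- x) \<and> \<bar>x\<bar> * gga_dens a (Suc l) x \<le> K1 + K2" for x
  proof (cases "x > 0")
    case True
    hence h: "gga_dens a (Suc l) x = x ^ (a - 1) * exp (- (x ^ Suc l))" using a by (simp add: gga_dens_eq)
    have 1: "gga_dens a (Suc l) x \<le> K1 * exp (- x)" using K1(2)[of x] True unfolding h by simp
    have 3: "K1 * exp (- x) \<le> (K1 + K2) * exp (- x)" using K2(1) by (intro mult_right_mono) auto
    have 4: "(K1 + K2) * exp (- x) \<le> (K1 + K2) * 1" using K1(1) K2(1) True by (intro mult_left_mono) auto
    have "\<bar>x\<bar> * gga_dens a (Suc l) x = x ^ a * exp (- (x ^ Suc l))"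
      using True a unfolding h by (cases a) auto
    also have "\<dots> \<le> K2 * exp (- x)" using K2(2)[of x] True by simp
    also have "\<dots> \<le> (K1 + K2) * exp (- x)" using K1(1) by (intro mult_right_mono) auto
    finally show ?thesis using 1 3 4 unfolding mult_1_right by (intro conjI; linarith)
  qed (use K1(1) K2(1) in \<open>auto simp: gga_dens_def\<close>)
  thus ?thesis using K1(1) K2(1) by (intro exI[of _ "K1 + K2"]) auto
qed

lemma finite_density_gga:
  assumes a: "a \<ge> 1" and l: "l \<ge> 1"
  shows "finite_density (gga_dens a (Suc l))"
proof
  let ?h = "gga_dens a (Suc l)"
  obtain K where K: "K > 0" "\<And>x. ?h x \<le> K * exp (- x)" using gga_dens_bounds[OF a l] by blast
  show nn: "?h x \<ge> 0" for x by (rule gga_dens_nonneg)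
  have meas: "?h \<in> borel_measurable lborel" unfolding gga_dens_def by measurable
  have "set_integrable lborel {0<..} (\<lambda>x::real. exp (- x))"
    using integrable_I0i_exp_mscale[of 1] by simp
  hence ei: "integrable lborel (\<lambda>x. K * (indicator {0<..} x * exp (- x)))"
    by (auto simp: set_integrable_def)
  have dom: "norm (?h x) \<le> norm (K * (indicator {0<..} x * exp (- x)))" for x
  proof (cases "x > 0")
    case False thus ?thesis by (simp add: gga_dens_def)
  qed (use K nn in auto)
  show int: "integrable lborel ?h"
    by (rule Bochner_Integration.integrable_bound[OF ei meas]) (use dom in auto)
  have ind: "u \<le> v \<Longrightarrow> integrable lborel (indicator {u..v::real} :: real \<Rightarrow> real)" for u v by simp
  have ii: "integrable lborel (indicator {1..2::real} :: real \<Rightarrow> real)" by (rule ind) simp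
  define c where "c = exp (- (2 ^ Suc l :: real))"
  have "c = (\<integral>x. c * indicator {1..2::real} x \<partial>lborel)" by simp
  also have "\<dots> \<le> integral\<^sup>L lborel ?h"
  proof (intro integral_mono int)
    fix x :: real
    show "c * indicator {1..2} x \<le> ?h x"
    proof (cases "x \<in> {1..2}")
      case True
      hence "1 * c \<le> x ^ (a - 1) * exp (- (x ^ Suc l))"
        unfolding c_def by (intro mult_mono) (auto intro!: mult_mono power_mono)
      with True show ?thesis using a by (simp add: gga_dens_eq)
    qed (use nn in auto)
  qed (use ii in auto)
  finally show "integral\<^sup>L lborel ?h > 0" unfolding c_def using exp_gt_zero less_le_trans by blast
qed

lemma gga_distr_eq: "gga_distr (real a) (real b) = prop_density (gga_dens a b)"
  by (simp add: gga_distr_def gga_dens_def)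

section \<open>The urn with immigration at its own scale\<close>

text \<open>The mesh for which the constant in \<open>walk_coeff_urn_sandwich\<close> is exactly
  \<open>(l + 1) * \<sigma> ^ Suc l\<close>, so that the limiting exponent is
  \<open>z ^ Suc l\<close> with coefficient 1. It is of order
  \<open>n powr (- l / (l + 1))\<close>.\<close>

definition urn_scale :: "nat \<Rightarrow> nat \<Rightarrow> real" where
  "urn_scale l n = root (Suc l) (1 / ((real l + 1) * round_prod l n))"

lemma round_prod_ge_1: "round_prod l n \<ge> 1"
  unfolding round_prod_def by (intro prod_ge_1) auto

lemma urn_scale_bounds: "urn_scale l n > 0" "urn_scale l n \<le> 1"
  and urn_scale_power: "urn_scale l n ^ Suc l = 1 / ((real l + 1) * round_prod l n)"
proof -
  have R: "(real l + 1) * round_prod l n \<ge> 1"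
    using mult_mono[of 1 "real l + 1" 1 "round_prod l n"] round_prod_ge_1[of l n] by simp
  show "urn_scale l n > 0" unfolding urn_scale_def using R by (intro real_root_gt_zero) auto
  show "urn_scale l n \<le> 1" unfolding urn_scale_def using R by (subst real_root_le_1_iff) auto
  show "urn_scale l n ^ Suc l = 1 / ((real l + 1) * round_prod l n)"
    unfolding urn_scale_def using R by (intro real_root_pow_pos2) auto
qed

text \<open>A Riemann sum for the integral of \<open>K * exp (- z)\<close>, bounded uniformly in the
  mesh because \<open>1 - exp (- \<sigma>) \<ge> \<sigma> / 2\<close> for
  \<open>\<sigma> \<le> 1\<close>.\<close>

lemma exp_geometric_suminf:
  assumes "0 < \<sigma>" "\<sigma> \<le> 1" "K \<ge> 0"
  shows "summable (\<lambda>j. K * \<sigma> * exp (- (\<sigma> * real j)))" "(\<Sum>j. K * \<sigma> * exp (- (\<sigma> * real j))) \<le> 2 * K"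
proof -
  have e: "exp (- (\<sigma> * real j)) = exp (- \<sigma>) ^ j" for j by (simp add: exp_of_nat_mult[symmetric] mult.commute)
  have lt: "norm (exp (- \<sigma>)) < 1" using assms by simp
  show "summable (\<lambda>j. K * \<sigma> * exp (- (\<sigma> * real j)))"
    unfolding e by (intro summable_mult summable_geometric lt)
  have "(\<Sum>j. K * \<sigma> * exp (- (\<sigma> * real j))) = K * \<sigma> * (1 / (1 - exp (- \<sigma>)))"
    unfolding e suminf_mult[OF summable_geometric[OF lt]] suminf_geometric[OF lt] ..
  also have "\<dots> \<le> K * \<sigma> * (2 / \<sigma>)"
  proof (intro mult_left_mono)
    have "exp (- \<sigma>) * (1 + \<sigma>) \<le> exp (- \<sigma>) * exp \<sigma>" by (intro mult_left_mono) auto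
    also have "\<dots> = 1" by (simp flip: exp_add)
    finally have "exp (- \<sigma>) \<le> 1 / (1 + \<sigma>)" using assms by (simp add: field_simps)
    also have "\<dots> \<le> 1 - \<sigma> / 2"
    proof -
      have "1 \<le> (1 - \<sigma> / 2) * (1 + \<sigma>)" using assms by (simp add: algebra_simps mult_left_le)
      thus ?thesis using assms by (simp add: divide_le_eq)
    qed
    finally have "\<sigma> / 2 \<le> 1 - exp (- \<sigma>)" by simp
    thus "1 / (1 - exp (- \<sigma>)) \<le> 2 / \<sigma>" using assms frac_le[of 1 1 "\<sigma> / 2" "1 - exp (- \<sigma>)"] by simp
  qed (use assms in auto)
  finally show "(\<Sum>j. K * \<sigma> * exp (- (\<sigma> * real j))) \<le> 2 * K" using assms by simp
qed

text \<open>The product, a rescaled binomial from \<open>pmf_walk\<close>, approximates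
  \<open>u ^ (a - 1)\<close>; the quotient approximates \<open>exp (- (u ^ Suc l))\<close> by
  \<open>near_exp_local\<close>. The exponential factor on the right keeps the errors summable over
  infinitely many cells.\<close>

lemma urn_local:
  assumes a: "a \<ge> 1" and l: "l \<ge> 1"
  shows "\<exists>K>0. \<forall>n j u. urn_scale l n * real j < u \<longrightarrow> u < urn_scale l n * real (Suc j) \<longrightarrow>
    \<bar>(\<Prod>i<a - 1. urn_scale l n * (real (a + j - 1) - real i)) *
      (walk_coeff (urn_total l a) a (l * Suc n) j / walk_coeff (urn_total l a) a (l * Suc n) 0) - gga_dens a (Suc l) u\<bar>
    \<le> K * urn_scale l n * exp (- (urn_scale l n * real j))"
proof -
  define b where "b = real l + 1"
  define c where "c = 3 * b\<^sup>2"
  \<comment> \<open>Enough for all polynomial factors: \<open>w ^ a\<close> from the product and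
    \<open>w ^ (2 * Suc l)\<close> from the exponentials. The summands of \<open>K0\<close> belong
    to \<open>t1\<close>, \<open>t2\<close> and \<open>t3\<close>.\<close>
  define k where "k = a + 2 * Suc l"
  define K0 where "K0 = real a ^ 2 + 2 * b ^ 3 + b"
  have b1: "b \<ge> 1" by (simp add: b_def)
  obtain K1 where K1: "K1 > 0" "\<And>z. z \<ge> 0 \<Longrightarrow> (z + (1 + real a)) ^ k * exp (c * z ^ l - z ^ Suc l) \<le> K1 * exp (- z)"
    using power_times_exp_bound[OF l, of c "1 + real a" k] by (auto simp: c_def)
  have K0: "K0 > 0" using b1 by (auto simp: K0_def intro: add_nonneg_pos)
  show ?thesis
  proof (intro exI[of _ "K0 * K1"] conjI allI impI)
    show "K0 * K1 > 0" using K0 K1 by simp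
    fix n j u
    define \<sigma> where "\<sigma> = urn_scale l n"
    define z where "z = \<sigma> * real j"
    define G where "G = walk_coeff (urn_total l a) a (l * Suc n)"
    assume u: "urn_scale l n * real j < u" "u < urn_scale l n * real (Suc j)"
    note \<sigma> = urn_scale_bounds[of l n, folded \<sigma>_def]
    have uz: "z < u" "u \<le> z + \<sigma>" using u by (auto simp: z_def \<sigma>_def algebra_simps)
    have z0: "z \<ge> 0" using \<sigma> by (simp add: z_def)
    have G0: "G 0 > 0"
    proof -
      have "0 < (\<Prod>q<l * Suc n. 1 - real a / real (urn_total l a (0 + q)))"
        by (intro prod_pos) (auto simp: urn_total_def)
      also have "\<dots> \<le> G 0" unfolding G_def
        using walk_coeff_draws_bounds(1)[where m=a and T="urn_total l a" and k="l * Suc n" and t=0 and i=0, OF urn_total_gt] by (simp del: walk_coeff.simps(2) mult_Suc_right)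
      finally show ?thesis .
    qed
    define R where "R j = G j / G 0" for j
    have \<tau>: "(real l + 1) * (1 / ((real l + 1) * round_prod l n)) = 1 / round_prod l n" by simp
    have ne: "near_exp R l (1 / ((real l + 1) * round_prod l n))"
    proof
      have "round_prod l n > 0" using round_prod_ge_1[of l n] by linarith
      thus "1 / ((real l + 1) * round_prod l n) > 0" by simp
      fix j
      show "R j \<ge> 0" unfolding R_def G_def
        by (intro divide_nonneg_nonneg walk_coeff_nonneg urn_total_gt)
      have "ffact l j / round_prod l n * G j / G 0 \<le> (G j - G (Suc j)) / G 0"
        using walk_coeff_urn_sandwich(1)[OF l] G0 unfolding G_def by (intro divide_right_mono) auto
      thus "(real l + 1) * (1 / ((real l + 1) * round_prod l n)) * ffact l j * R j \<le> R j - R (Suc j)"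
        unfolding \<tau> R_def by (simp add: diff_divide_distrib)
      have "(G j - G (Suc j)) / G 0 \<le> ffact l j / round_prod l n * G (j - l) / G 0"
        using walk_coeff_urn_sandwich(2)[OF l] G0 unfolding G_def by (intro divide_right_mono) auto
      thus "R j - R (Suc j) \<le> (real l + 1) * (1 / ((real l + 1) * round_prod l n)) * ffact l j * R (j - l)"
        unfolding \<tau> R_def by (simp add: diff_divide_distrib)
    qed (rule l)
    define X where "X = exp (c * z ^ l - z ^ Suc l)"
    have R0: "R 0 = 1" using G0 by (simp add: R_def)
    note loc0 = near_exp_local[OF ne, of \<sigma> j, OF \<sigma> urn_scale_power[symmetric, of l n, folded \<sigma>_def] R0]
    have loc: "R j \<le> X" "\<bar>R j - exp (- (z ^ Suc l))\<bar> \<le> \<sigma> * b ^ 3 * (z ^ l + z ^ (2 * l + 1)) * X"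
      unfolding X_def c_def b_def z_def by (rule loc0)+
    have Rnn: "R j \<ge> 0" by (rule near_exp.G_nonneg[OF ne])
    \<comment> \<open>A common bound, at least 1, for \<open>z\<close>, \<open>u\<close> and the
      factors of the product, so that powers of different degree can be compared.\<close>
    define w where "w = z + (1 + real a)"
    have w1: "w \<ge> 1" using z0 by (simp add: w_def)
    have zw: "z \<le> w" "u \<le> w" "z + \<sigma> * real a \<le> w"
    proof -
      have "\<sigma> * real a \<le> 1 * real a" using \<sigma> by (intro mult_right_mono) auto
      thus "z \<le> w" "u \<le> w" "z + \<sigma> * real a \<le> w" using \<sigma> uz by (auto simp: w_def)
    qed
    have X0: "X > 0" by (simp add: X_def)
    define A where "A = (\<Prod>i<a - 1. \<sigma> * (real (a + j - 1) - real i))"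
    have za: "z + \<sigma> \<le> z + \<sigma> * real a" using a \<sigma> by (simp add: mult_le_cancel_left1)
    have fac: "z \<le> \<sigma> * (real (a + j - 1) - real i)" "\<sigma> * (real (a + j - 1) - real i) \<le> z + \<sigma> * real a"
      if "i < a - 1" for i
    proof -
      have "real j \<le> real (a + j - 1) - real i" "real (a + j - 1) - real i \<le> real j + real a"
        using that by linarith+
      hence "\<sigma> * real j \<le> \<sigma> * (real (a + j - 1) - real i)" "\<sigma> * (real (a + j - 1) - real i) \<le> \<sigma> * (real j + real a)"
        using \<sigma> by (intro mult_left_mono; simp)+
      thus "z \<le> \<sigma> * (real (a + j - 1) - real i)" "\<sigma> * (real (a + j - 1) - real i) \<le> z + \<sigma> * real a"
        by (auto simp: z_def algebra_simps)
    qed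
    have A_lo: "z ^ (a - 1) \<le> A"
      using prod_mono[of "{..<a-1}" "\<lambda>_. z" "\<lambda>i. \<sigma> * (real (a + j - 1) - real i)"] fac z0 by (simp add: A_def)
    have A_up: "A \<le> (z + \<sigma> * real a) ^ (a - 1)"
    proof -
      have "0 \<le> \<sigma> * (real (a + j - 1) - real i) \<and> \<sigma> * (real (a + j - 1) - real i) \<le> z + \<sigma> * real a"
        if "i \<in> {..<a - 1}" for i using fac[of i] z0 that by auto
      hence "A \<le> (\<Prod>i<a - 1. z + \<sigma> * real a)" unfolding A_def by (rule prod_mono)
      thus ?thesis by simp
    qed
    have u_lo: "z ^ (a - 1) \<le> u ^ (a - 1)" using uz z0 by (intro power_mono) auto
    have u_up: "u ^ (a - 1) \<le> (z + \<sigma> * real a) ^ (a - 1)" using order_trans[OF uz(2) za] uz z0 by (intro power_mono) auto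
    have "(z + \<sigma> * real a) ^ (a - 1) - z ^ (a - 1) \<le> real (a - 1) * (z + \<sigma> * real a - z) * w ^ (a - 1)"
      using z0 \<sigma> zw w1 by (intro power_diff_le) auto
    also have "\<dots> \<le> real a * (\<sigma> * real a) * w ^ a"
      using \<sigma> w1 by (intro mult_mono power_increasing) auto
    finally have diff: "\<bar>A - u ^ (a - 1)\<bar> \<le> \<sigma> * real a ^ 2 * w ^ a"
      using A_lo A_up u_lo u_up by (simp add: power2_eq_square algebra_simps abs_le_iff)
    have wk: "w ^ i \<le> w ^ k" if "i \<le> k" for i using that w1 by (intro power_increasing) auto
    have t1: "\<bar>A - u ^ (a - 1)\<bar> * R j \<le> \<sigma> * real a ^ 2 * w ^ k * X"
    proof (rule mult_mono)
      show "\<bar>A - u ^ (a - 1)\<bar> \<le> \<sigma> * real a ^ 2 * w ^ k"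
        using diff by (rule order_trans) (use \<sigma> wk[of a] in \<open>auto simp: k_def intro!: mult_left_mono\<close>)
      show "R j \<le> X" by (rule loc(1))
    qed (use \<sigma> w1 Rnn in auto)
    have uw: "u ^ (a - 1) \<le> w ^ a"
      using uz z0 zw power_mono[of u w "a - 1"] power_increasing[of "a - 1" a w] w1 by fastforce
    have zi: "z ^ i \<le> w ^ (2 * Suc l)" if "i \<le> 2 * Suc l" for i
      by (rule order_trans[OF power_mono[OF zw(1) z0] power_increasing[OF that w1]])
    have zl: "z ^ l \<le> w ^ (2 * Suc l)" "z ^ (2 * l + 1) \<le> w ^ (2 * Suc l)"
      by (rule zi; simp)+
    have t2: "u ^ (a - 1) * \<bar>R j - exp (- (z ^ Suc l))\<bar> \<le> \<sigma> * (2 * b ^ 3) * w ^ k * X"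
    proof -
      have "u ^ (a - 1) * \<bar>R j - exp (- (z ^ Suc l))\<bar> \<le> w ^ a * (\<sigma> * b ^ 3 * (z ^ l + z ^ (2 * l + 1)) * X)"
        using uw loc(2) uz z0 w1 by (intro mult_mono) auto
      also have "\<dots> \<le> w ^ a * (\<sigma> * b ^ 3 * (2 * w ^ (2 * Suc l)) * X)"
        using zl X0 b1 \<sigma> w1 by (intro mult_left_mono mult_right_mono) auto
      also have "\<dots> = \<sigma> * (2 * b ^ 3) * w ^ k * X" by (simp add: k_def power_add mult_ac)
      finally show ?thesis .
    qed
    have t3: "u ^ (a - 1) * \<bar>exp (- (z ^ Suc l)) - exp (- (u ^ Suc l))\<bar> \<le> \<sigma> * b * w ^ k * X"
    proof -
      have zu: "z ^ Suc l \<le> u ^ Suc l" using uz z0 by (intro power_mono) auto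
      have "\<bar>exp (- (z ^ Suc l)) - exp (- (u ^ Suc l))\<bar> = exp (- (z ^ Suc l)) * (1 - exp (- (u ^ Suc l - z ^ Suc l)))"
        using zu by (simp add: algebra_simps mult_exp_exp)
      also have "\<dots> \<le> X * (u ^ Suc l - z ^ Suc l)"
      proof (rule mult_mono)
        show "exp (- (z ^ Suc l)) \<le> X" using z0 by (simp add: X_def c_def)
        show "1 - exp (- (u ^ Suc l - z ^ Suc l)) \<le> u ^ Suc l - z ^ Suc l"
          using exp_ge_add_one_self[of "- (u ^ Suc l - z ^ Suc l)"] by linarith
      qed (use zu X0 in auto)
      also have "\<dots> \<le> X * (real (Suc l) * (u - z) * w ^ Suc l)"
        using X0 z0 uz zw w1 by (intro mult_left_mono power_diff_le) auto
      also have "\<dots> \<le> X * (b * \<sigma> * w ^ (2 * Suc l))"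
        using X0 uz w1 \<sigma> by (intro mult_left_mono mult_mono power_increasing) (auto simp: b_def)
      finally have "u ^ (a - 1) * \<bar>exp (- (z ^ Suc l)) - exp (- (u ^ Suc l))\<bar> \<le> w ^ a * (X * (b * \<sigma> * w ^ (2 * Suc l)))"
        using uw w1 by (intro mult_mono) auto
      thus ?thesis by (simp add: k_def power_add mult_ac)
    qed
    have h: "gga_dens a (Suc l) u = u ^ (a - 1) * exp (- (u ^ Suc l))"
      using uz z0 a by (simp add: gga_dens_eq)
    have "A * R j - gga_dens a (Suc l) u = (A - u ^ (a - 1)) * R j + u ^ (a - 1) * (R j - exp (- (z ^ Suc l)))
        + u ^ (a - 1) * (exp (- (z ^ Suc l)) - exp (- (u ^ Suc l)))"
      unfolding h by (simp add: algebra_simps)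
    hence "\<bar>A * R j - gga_dens a (Suc l) u\<bar> \<le> \<bar>(A - u ^ (a - 1)) * R j\<bar> + \<bar>u ^ (a - 1) * (R j - exp (- (z ^ Suc l)))\<bar>
        + \<bar>u ^ (a - 1) * (exp (- (z ^ Suc l)) - exp (- (u ^ Suc l)))\<bar>"
      by linarith
    also have "\<dots> \<le> \<sigma> * real a ^ 2 * w ^ k * X + \<sigma> * (2 * b ^ 3) * w ^ k * X + \<sigma> * b * w ^ k * X"
      using t1 t2 t3 Rnn uz z0 by (intro add_mono) (simp_all add: abs_mult)
    also have "\<dots> = K0 * \<sigma> * (w ^ k * X)" by (simp add: K0_def algebra_simps)
    also have "\<dots> \<le> K0 * \<sigma> * (K1 * exp (- z))"
      using K1(2)[OF z0] K0 \<sigma> unfolding w_def X_def by (intro mult_left_mono) auto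
    finally show "\<bar>(\<Prod>i<a - 1. urn_scale l n * (real (a + j - 1) - real i)) *
      (walk_coeff (urn_total l a) a (l * Suc n) j / walk_coeff (urn_total l a) a (l * Suc n) 0) - gga_dens a (Suc l) u\<bar>
       \<le> K0 * K1 * urn_scale l n * exp (- (urn_scale l n * real j))"
      by (simp add: A_def R_def G_def z_def \<sigma>_def mult_ac)
  qed
qed

lemma pmf_map_diff:
  fixes p :: "nat pmf"
  assumes "set_pmf p \<subseteq> {a..}"
  shows "pmf (map_pmf (\<lambda>x. x - a) p) j = pmf p (a + j)"
proof -
  have "(\<lambda>x. x - a) -` {j} \<inter> set_pmf p = {a + j} \<inter> set_pmf p"
    using assms by (force simp: subset_iff)
  hence "measure_pmf.prob p ((\<lambda>x. x - a) -` {j}) = measure_pmf.prob p {a + j}"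
    by (metis measure_Int_set_pmf)
  thus ?thesis by (simp add: pmf_map measure_pmf_single)
qed

text \<open>\<open>kolmogorov_from_local\<close> applied to \<open>x - a\<close>, the number of
  successful draws, whose atoms start at 0. The shift by \<open>a\<close> is undone later through a
  Lipschitz bound.\<close>

lemma urn_kolmogorov:
  assumes a: "a \<ge> 1" and l: "l \<ge> 1"
  shows "\<exists>C>0. \<forall>n t. \<bar>measure_pmf.prob (walk (urn_total l a) a (l * Suc n)) {x. urn_scale l n * (real x - real a) \<le> t}
      - measure (prop_density (gga_dens a (Suc l))) {..t}\<bar> \<le> C * urn_scale l n"
proof -
  interpret finite_density "gga_dens a (Suc l)" by (rule finite_density_gga[OF a l])
  obtain K1 where K1: "K1 > 0" "\<And>x. gga_dens a (Suc l) x \<le> K1" using gga_dens_bounds[OF a l] by blast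
  obtain K2 where K2: "K2 > 0" and loc: "\<And>n j u. urn_scale l n * real j < u \<Longrightarrow> u < urn_scale l n * real (Suc j) \<Longrightarrow>
    \<bar>(\<Prod>i<a - 1. urn_scale l n * (real (a + j - 1) - real i)) *
      (walk_coeff (urn_total l a) a (l * Suc n) j / walk_coeff (urn_total l a) a (l * Suc n) 0) - gga_dens a (Suc l) u\<bar>
    \<le> K2 * urn_scale l n * exp (- (urn_scale l n * real j))"
    using urn_local[OF a l] by blast
  define K where "K = K1 + 2 * K2"
  have K: "K > 0" "K1 \<le> K" "2 * K2 \<le> K" using K1(1) K2 by (auto simp: K_def)
  define I where "I = integral\<^sup>L lborel (gga_dens a (Suc l))"
  have I: "I > 0" using h_pos by (simp add: I_def)
  have "\<bar>measure_pmf.prob (walk (urn_total l a) a (l * Suc n)) {x. urn_scale l n * (real x - real a) \<le> t}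
      - measure (prop_density (gga_dens a (Suc l))) {..t}\<bar> \<le> 6 * K / I * urn_scale l n" for n t
  proof -
    define W where "W = walk (urn_total l a) a (l * Suc n)"
    define \<sigma> where "\<sigma> = urn_scale l n"
    define G where "G = walk_coeff (urn_total l a) a (l * Suc n)"
    define p where "p = map_pmf (\<lambda>x. x - a) W"
    \<comment> \<open>Chosen so that
      \<open>pmf p j = \<theta> * \<sigma> * (A * (G j / G 0))\<close> with the product
      \<open>A\<close> of \<open>urn_local\<close>.\<close>
    define \<theta> where "\<theta> = G 0 / (\<sigma> ^ a * real (fact (a - 1)))"
    note \<sigma> = urn_scale_bounds[of l n, folded \<sigma>_def]
    have supp: "set_pmf W \<subseteq> {a..}" unfolding W_def using set_pmf_walk by fastforce
    have pmf: "pmf p j = real (a + j - 1 choose j) * G j" for j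
      unfolding p_def pmf_map_diff[OF supp] unfolding W_def G_def
      using a urn_total_gt by (intro pmf_walk) (auto intro: less_imp_le)
    have G: "G 0 > 0"
    proof -
      have "0 < (\<Prod>q<l * Suc n. 1 - real a / real (urn_total l a (0 + q)))"
        by (intro prod_pos) (auto simp: urn_total_def)
      also have "\<dots> \<le> G 0" unfolding G_def
        using walk_coeff_draws_bounds(1)[where m=a and T="urn_total l a" and k="l * Suc n" and t=0 and i=0, OF urn_total_gt]
        by (simp del: walk_coeff.simps(2) mult_Suc_right)
      finally show ?thesis .
    qed
    have "\<bar>measure_pmf.prob p {j. \<sigma> * real j \<le> t} - measure (prop_density (gga_dens a (Suc l))) {..t}\<bar> \<le> 6 * K / I * \<sigma>"
      unfolding I_def
    proof (rule kolmogorov_from_local[where \<theta>=\<theta> and e="\<lambda>j. K2 * \<sigma> * exp (- (\<sigma> * real j))"])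
      show "gga_dens a (Suc l) x \<le> K" for x using K1(2)[of x] K by linarith
      show "gga_dens a (Suc l) x = 0" if "x < 0" for x using that by (simp add: gga_dens_def)
      show "\<theta> \<ge> 0" using G \<sigma> by (simp add: \<theta>_def)
      show "summable (\<lambda>j. K2 * \<sigma> * exp (- (\<sigma> * real j)))" using exp_geometric_suminf(1)[OF \<sigma>, of K2] K2 by simp
      show "(\<Sum>j. K2 * \<sigma> * exp (- (\<sigma> * real j))) \<le> K"
        using exp_geometric_suminf(2)[OF \<sigma>, of K2] K K2 by simp
      fix j
      show "0 \<le> K2 * \<sigma> * exp (- (\<sigma> * real j))" using K2 \<sigma> by simp
      define A where "A = (\<Prod>i<a - 1. \<sigma> * (real (a + j - 1) - real i))"
      define P where "P = (LINT x:{\<sigma> * real j..<\<sigma> * real (Suc j)}|lborel. gga_dens a (Suc l) x)"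
      have w: "\<sigma> * real (Suc j) - \<sigma> * real j = \<sigma>" by (simp add: algebra_simps)
      have "\<bar>A * (G j / G 0) * (\<sigma> * real (Suc j) - \<sigma> * real j) - P\<bar>
          \<le> K2 * \<sigma> * exp (- (\<sigma> * real j)) * (\<sigma> * real (Suc j) - \<sigma> * real j)"
        unfolding P_def using \<sigma> loc unfolding A_def G_def \<sigma>_def by (intro set_integral_approx) auto
      hence "\<theta> * \<bar>A * (G j / G 0) * \<sigma> - P\<bar> \<le> \<theta> * (K2 * \<sigma> * exp (- (\<sigma> * real j)) * \<sigma>)"
        unfolding w using G \<sigma> by (intro mult_left_mono) (auto simp: \<theta>_def)
      moreover have "pmf p j - \<theta> * P = \<theta> * (A * (G j / G 0) * \<sigma> - P)"
      proof -
        have "A = \<sigma> ^ (a - 1) * (real (fact (a - 1)) * real (a + j - 1 choose (a - 1)))"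
          unfolding A_def prod.distrib binomial_fact_prod by simp
        moreover have "(a + j - 1 choose (a - 1)) = (a + j - 1 choose j)"
          using a binomial_symmetric[of j "a + j - 1"] by simp
        moreover have "\<sigma> ^ a = \<sigma> ^ (a - 1) * \<sigma>" using a by (cases a) auto
        ultimately have "\<theta> * (A * (G j / G 0) * \<sigma>) = pmf p j"
          unfolding pmf \<theta>_def using \<sigma> G by simp
        thus ?thesis by (simp add: right_diff_distrib)
      qed
      moreover have "\<theta> \<ge> 0" using G \<sigma> by (simp add: \<theta>_def)
      ultimately show "\<bar>pmf p j - \<theta> * (LINT x:{\<sigma> * real j..<\<sigma> * real (Suc j)}|lborel. gga_dens a (Suc l) x)\<bar>
           \<le> \<theta> * \<sigma> * (K2 * \<sigma> * exp (- (\<sigma> * real j)))"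
        unfolding P_def[symmetric] by (simp add: abs_mult mult_ac)
    qed (rule \<sigma>)
    moreover have "measure_pmf.prob p {j. \<sigma> * real j \<le> t} = measure_pmf.prob W {x. \<sigma> * (real x - real a) \<le> t}"
    proof -
      have "(\<lambda>x. x - a) -` {j. \<sigma> * real j \<le> t} \<inter> set_pmf W = {x. \<sigma> * (real x - real a) \<le> t} \<inter> set_pmf W"
        using supp by (auto simp: of_nat_diff subset_iff)
      thus ?thesis unfolding p_def measure_map_pmf by (metis measure_Int_set_pmf)
    qed
    ultimately show ?thesis by (simp add: W_def \<sigma>_def)
  qed
  thus ?thesis using K I by (intro exI[of _ "6 * K / I"]) auto
qed

text \<open>Stability under shifts and changes of scale. For the latter, the density on
  \<open>{t<..c * t}\<close> with \<open>t > 0\<close> is at most \<open>K / t\<close> and the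
  length is \<open>(c - 1) * t\<close>, so \<open>t\<close> cancels.\<close>

lemma gga_cdf_bounds:
  assumes a: "a \<ge> 1" and l: "l \<ge> 1"
  shows "\<exists>C>0. (\<forall>t u. t \<le> u \<longrightarrow>
      \<bar>measure (prop_density (gga_dens a (Suc l))) {..u} - measure (prop_density (gga_dens a (Suc l))) {..t}\<bar> \<le> C * (u - t)) \<and>
    (\<forall>t c. c \<ge> 1 \<longrightarrow>
      \<bar>measure (prop_density (gga_dens a (Suc l))) {..c * t} - measure (prop_density (gga_dens a (Suc l))) {..t}\<bar> \<le> C * (c - 1))"
proof -
  interpret finite_density "gga_dens a (Suc l)" by (rule finite_density_gga[OF a l])
  interpret P: prob_space "prop_density (gga_dens a (Suc l))" by (rule prob_space_prop_density)
  define h where "h = gga_dens a (Suc l)"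
  define I where "I = integral\<^sup>L lborel h"
  define F where "F t = measure (prop_density h) {..t}" for t
  have I: "I > 0" using h_pos by (simp add: I_def h_def)
  obtain K where K: "K > 0" "\<And>x. h x \<le> K" "\<And>x. \<bar>x\<bar> * h x \<le> K"
    using gga_dens_bounds[OF a l] unfolding h_def by blast
  have diff: "F u - F t = (LINT x:{t<..u}|lborel. h x) / I" if "t \<le> u" for t u
  proof -
    have "{t<..u} = {..u} - {..t}" by auto
    hence "F u - F t = measure (prop_density h) {t<..u}"
      unfolding F_def h_def using that by (simp add: P.finite_measure_Diff)
    thus ?thesis unfolding h_def I_def by (simp add: measure_prop_density)
  qed
  have mono: "F t \<le> F u" if "t \<le> u" for t u
    unfolding F_def h_def using that by (intro P.finite_measure_mono) auto
  have 1: "\<bar>F u - F t\<bar> \<le> K / I * (u - t)" if "t \<le> u" for t u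
  proof -
    have "(LINT x:{t<..u}|lborel. h x) \<le> K * (u - t)"
      unfolding h_def using that K(2) by (intro set_integral_interval_le) (auto simp: h_def)
    hence "F u - F t \<le> K * (u - t) / I" unfolding diff[OF that] using I by (intro divide_right_mono) auto
    thus ?thesis using mono[OF that] by simp
  qed
  have 2: "\<bar>F (c * t) - F t\<bar> \<le> K / I * (c - 1)" if c: "c \<ge> 1" for c t
  proof (cases "t > 0")
    case True
    have tc: "t \<le> c * t" using True c by simp
    have "(LINT x:{t<..c * t}|lborel. h x) \<le> (LINT x:{t<..c * t}|lborel. K / t)"
    proof (intro set_integral_mono)
      show "set_integrable lborel {t<..c * t} h" unfolding h_def by (intro set_int) auto
      show "set_integrable lborel {t<..c * t} (\<lambda>_. K / t)" using tc by (auto simp: set_integrable_def)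
      fix x assume x: "x \<in> {t<..c * t}"
      have "t * h x \<le> \<bar>x\<bar> * h x" using x True by (intro mult_right_mono) (auto simp: h_def gga_dens_nonneg)
      also have "\<dots> \<le> K" by (rule K)
      finally show "h x \<le> K / t" using True by (simp add: field_simps)
    qed
    also have "\<dots> = K * (c - 1)"
      using tc True by (simp add: set_lebesgue_integral_def field_simps)
    finally have "F (c * t) - F t \<le> K * (c - 1) / I" unfolding diff[OF tc] using I by (intro divide_right_mono) auto
    thus ?thesis using mono[OF tc] by simp
  next
    case False
    have ct: "c * t \<le> t" using mult_right_mono_neg[OF c, of t] False by simp
    have "(LINT x:{c * t<..t}|lborel. h x) = 0"
      unfolding set_lebesgue_integral_def using False
      by (intro integral_eq_zero_AE AE_I2) (auto simp: h_def gga_dens_def indicator_def)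
    hence "F t - F (c * t) = 0" using diff[OF ct] by simp
    thus ?thesis using K I c by simp
  qed
  show ?thesis using 1 2 K(1) I unfolding F_def h_def by (intro exI[of _ "K / I"]) auto
qed

text \<open>The power \<open>Suc l\<close> of the ratio is a product of \<open>l\<close> quotients
  with numerator \<open>b * n = b * k + q\<close>, each between 1 and \<open>1 + q / Suc k\<close>.
  A ratio that is at least 1 is bounded by its own power, so no root has to be expanded.\<close>

lemma urn_scale_ratio:
  fixes l k c0 :: nat
  assumes l: "l \<ge> 1"
  defines "n \<equiv> real (Suc k + c0)" and "b \<equiv> real l + 1"
  defines "\<epsilon> \<equiv> 1 / (b * n powr (real l / b))" and "q \<equiv> b * (1 + real c0)"
  shows "1 \<le> urn_scale l k / \<epsilon>" "urn_scale l k / \<epsilon> \<le> 1 + real l * q * (1 + q) ^ l / real (Suc k)"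
proof -
  define s where "s = urn_scale l k / \<epsilon>"
  have n: "n \<ge> 1" by (simp add: n_def)
  have b: "b \<ge> 1" by (simp add: b_def)
  have q: "q \<ge> 0" using b by (simp add: q_def)
  have \<epsilon>: "\<epsilon> > 0" using n b by (simp add: \<epsilon>_def)
  have s0: "s > 0" unfolding s_def using \<epsilon> urn_scale_bounds by simp
  have "(n powr (real l / b)) ^ Suc l = n powr (real (Suc l) * (real l / b))"
    using n by (intro powr_power) simp
  also have "real (Suc l) * (real l / b) = real l" by (simp add: b_def field_simps)
  finally have "(n powr (real l / b)) ^ Suc l = n powr real l" .
  hence np: "(n powr (real l / b)) ^ Suc l = n ^ l" using n by (simp add: powr_realpow)
  have "s ^ Suc l = urn_scale l k ^ Suc l * (b * n powr (real l / b)) ^ Suc l"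
    by (simp add: s_def \<epsilon>_def power_mult_distrib)
  also have "\<dots> = 1 / (b * round_prod l k) * (b ^ Suc l * n ^ l)"
    unfolding urn_scale_power power_mult_distrib np by (simp add: b_def add.commute)
  also have "\<dots> = (b * n) ^ l / round_prod l k" using b by (simp add: power_mult_distrib)
  also have "\<dots> = (\<Prod>i<l. b * n / (1 + real i + b * real k))"
    unfolding round_prod_def prod_dividef b_def by simp
  finally have sp: "s ^ Suc l = (\<Prod>i<l. b * n / (1 + real i + b * real k))" .
  have fac: "1 \<le> b * n / (1 + real i + b * real k)" "b * n / (1 + real i + b * real k) \<le> 1 + q / real (Suc k)"
    if i: "i < l" for i
  proof -
    have d: "1 + real i + b * real k > 0" using b by (intro add_pos_nonneg) auto
    have bn: "b * n = b * real k + q" by (simp add: n_def q_def algebra_simps)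
    have ib: "1 + real i \<le> b" using i by (simp add: b_def)
    moreover have "b \<le> q" using b by (simp add: q_def)
    ultimately show "1 \<le> b * n / (1 + real i + b * real k)" unfolding bn using d by (simp add: le_divide_eq)
    have "real (Suc k) \<le> 1 + real i + b * real k" using b mult_right_mono[of 1 b "real k"] by simp
    hence "q / (1 + real i + b * real k) \<le> q / real (Suc k)" using q by (intro divide_left_mono) (auto intro: mult_pos_pos d)
    moreover have "b * n / (1 + real i + b * real k) \<le> (1 + real i + b * real k + q) / (1 + real i + b * real k)"
      unfolding bn using d by (intro divide_right_mono) auto
    ultimately show "b * n / (1 + real i + b * real k) \<le> 1 + q / real (Suc k)"
      using d by (simp add: add_divide_distrib)
  qed
  have s1: "1 \<le> s ^ Suc l" unfolding sp using fac by (intro prod_ge_1) auto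
  show 1: "1 \<le> urn_scale l k / \<epsilon>"
  proof (rule ccontr)
    assume "\<not> 1 \<le> urn_scale l k / \<epsilon>"
    hence "s ^ Suc l < 1" using s0 by (intro power_Suc_less_one) (auto simp: s_def)
    with s1 show False by simp
  qed
  have "s \<le> s ^ Suc l" using 1 by (intro self_le_power) (auto simp: s_def)
  also have "\<dots> \<le> (\<Prod>i<l. 1 + q / real (Suc k))"
    unfolding sp
  proof (rule prod_mono)
    fix i assume "i \<in> {..<l}"
    thus "0 \<le> b * n / (1 + real i + b * real k) \<and> b * n / (1 + real i + b * real k) \<le> 1 + q / real (Suc k)"
      using fac[of i] by auto
  qed
  also have "\<dots> = 1 + ((1 + q / real (Suc k)) ^ l - 1 ^ l)" by simp
  also have "\<dots> \<le> 1 + real l * (1 + q / real (Suc k) - 1) * (1 + q) ^ l"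
  proof (rule add_left_mono, rule power_diff_le)
    have "q / real (Suc k) \<le> q / 1" using q by (intro divide_left_mono) auto
    thus "1 + q / real (Suc k) \<le> 1 + q" by (simp only: div_by_1)
  qed (use q in auto)
  finally show "urn_scale l k / \<epsilon> \<le> 1 + real l * q * (1 + q) ^ l / real (Suc k)"
    by (simp add: s_def)
qed

text \<open>Three errors: the urn at its own scale, the shift by \<open>a\<close>, and the change to
  the scale of the theorem at time \<open>Suc k + c0\<close>. The last is \<open>O(1 / k)\<close>,
  within the rate since the exponent \<open>l / (l + 1)\<close> is below 1.\<close>

lemma urn_gga_kolmogorov:
  fixes a l c0 :: nat
  assumes a: "a \<ge> 1" and l: "l \<ge> 1"
  shows "\<exists>C>0. \<forall>k t. \<bar>measure_pmf.prob (walk (urn_total l a) a (l * Suc k))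
        {x. real x / ((real l + 1) * real (Suc k + c0) powr (real l / (real l + 1))) \<le> t}
      - measure (gga_distr (real a) (real (Suc l))) {..t}\<bar> \<le> C / real (Suc k + c0) powr (real l / (real l + 1))"
proof -
  obtain C0 where C0: "C0 > 0" "\<And>n t. \<bar>measure_pmf.prob (walk (urn_total l a) a (l * Suc n)) {x. urn_scale l n * (real x - real a) \<le> t}
      - measure (prop_density (gga_dens a (Suc l))) {..t}\<bar> \<le> C0 * urn_scale l n"
    using urn_kolmogorov[OF a l] by blast
  define F where "F t = measure (prop_density (gga_dens a (Suc l))) {..t}" for t
  obtain C1 where C1: "C1 > 0" "\<And>t u. t \<le> u \<Longrightarrow> \<bar>F u - F t\<bar> \<le> C1 * (u - t)"
      "\<And>t c. c \<ge> 1 \<Longrightarrow> \<bar>F (c * t) - F t\<bar> \<le> C1 * (c - 1)"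
    using gga_cdf_bounds[OF a l] unfolding F_def by blast
  define b where "b = real l + 1"
  define q where "q = b * (1 + real c0)"
  define Q where "Q = real l * q * (1 + q) ^ l"
  define C where "C = (C0 + C1 * real a) * (1 + Q) + C1 * Q * (1 + real c0)"
  have q: "q \<ge> 0" by (simp add: q_def b_def)
  have Q: "Q \<ge> 0" using q by (simp add: Q_def)
  have C: "C > 0" unfolding C_def using C0(1) C1(1) Q by (intro add_pos_nonneg mult_pos_pos) auto
  have "\<bar>measure_pmf.prob (walk (urn_total l a) a (l * Suc k)) {x. real x / (b * real (Suc k + c0) powr (real l / b)) \<le> t}
      - F t\<bar> \<le> C / real (Suc k + c0) powr (real l / b)" for k t
  proof -
    define n where "n = real (Suc k + c0)"
    define \<epsilon> where "\<epsilon> = 1 / (b * n powr (real l / b))"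
    define \<sigma> where "\<sigma> = urn_scale l k"
    define s where "s = \<sigma> / \<epsilon>"
    have n: "n \<ge> 1" by (simp add: n_def)
    have b: "b \<ge> 1" by (simp add: b_def)
    have pn: "n powr (real l / b) > 0" using n by simp
    have \<epsilon>: "\<epsilon> > 0" using n b by (simp add: \<epsilon>_def)
    have s: "1 \<le> s" "s \<le> 1 + Q / real (Suc k)"
      using urn_scale_ratio[OF l, where k=k and ?c0.0=c0] unfolding s_def \<sigma>_def \<epsilon>_def n_def b_def Q_def q_def by blast+
    have \<sigma>: "\<sigma> = s * \<epsilon>" using \<epsilon> by (simp add: s_def)
    have \<sigma>0: "\<sigma> > 0" by (simp add: \<sigma>_def urn_scale_bounds)
    have "Q / real (Suc k) \<le> Q / 1" using Q by (intro divide_left_mono) auto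
    hence "\<sigma> \<le> (1 + Q) * \<epsilon>" unfolding \<sigma> using s \<epsilon> by (intro mult_right_mono) auto
    also have "\<epsilon> \<le> 1 / n powr (real l / b)"
      unfolding \<epsilon>_def using b pn by (intro divide_left_mono) auto
    finally have \<sigma>le: "\<sigma> \<le> (1 + Q) / n powr (real l / b)" using Q by (simp add: mult_left_mono)
    have Nn: "1 / real (Suc k) \<le> (1 + real c0) / n powr (real l / b)"
    proof -
      have "n powr (real l / b) \<le> n powr 1" using n by (intro powr_mono) (auto simp: b_def)
      also have "\<dots> = n" using n by simp
      also have "n \<le> real (Suc k) * (1 + real c0)" by (simp add: n_def algebra_simps)
      finally show ?thesis using pn by (simp add: field_simps)
    qed
    have set: "{x. real x / (b * n powr (real l / b)) \<le> t} = {x. \<sigma> * (real x - real a) \<le> s * t - \<sigma> * real a}"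
    proof (intro Collect_cong)
      fix x
      have "real x / (b * n powr (real l / b)) \<le> t \<longleftrightarrow> \<epsilon> * real x \<le> t" by (simp add: \<epsilon>_def)
      also have "\<dots> \<longleftrightarrow> s * (\<epsilon> * real x) \<le> s * t" using s by simp
      also have "\<dots> \<longleftrightarrow> \<sigma> * (real x - real a) \<le> s * t - \<sigma> * real a"
        unfolding \<sigma> by (simp add: algebra_simps)
      finally show "real x / (b * n powr (real l / b)) \<le> t \<longleftrightarrow> \<sigma> * (real x - real a) \<le> s * t - \<sigma> * real a" .
    qed
    have "\<bar>measure_pmf.prob (walk (urn_total l a) a (l * Suc k)) {x. real x / (b * n powr (real l / b)) \<le> t} - F t\<bar>
      \<le> C0 * \<sigma> + C1 * (\<sigma> * real a) + C1 * (s - 1)"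
    proof -
      have "\<bar>F (s * t) - F (s * t - \<sigma> * real a)\<bar> \<le> C1 * (s * t - (s * t - \<sigma> * real a))"
        using \<sigma>0 by (intro C1(2)) auto
      thus ?thesis
        using C0(2)[of k "s * t - \<sigma> * real a"] C1(3)[OF s(1), of t] unfolding set \<sigma>_def F_def[symmetric] by simp
    qed
    also have "\<dots> = (C0 + C1 * real a) * \<sigma> + C1 * (s - 1)" by (simp add: algebra_simps)
    also have "\<dots> \<le> (C0 + C1 * real a) * ((1 + Q) / n powr (real l / b)) + C1 * (Q * ((1 + real c0) / n powr (real l / b)))"
    proof (intro add_mono mult_left_mono \<sigma>le)
      have "s - 1 \<le> Q * (1 / real (Suc k))" using s by simp
      also have "\<dots> \<le> Q * ((1 + real c0) / n powr (real l / b))" by (rule mult_left_mono[OF Nn Q])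
      finally show "s - 1 \<le> Q * ((1 + real c0) / n powr (real l / b))" .
    qed (use C0(1) C1(1) in auto)
    also have "\<dots> = C / n powr (real l / b)" by (simp add: C_def add_divide_distrib distrib_left distrib_right)
    finally show ?thesis by (simp add: n_def)
  qed
  thus ?thesis unfolding gga_distr_eq F_def b_def using C by blast
qed

section \<open>Convex sets of sequences\<close>

text \<open>In contrast to \<open>convex_in\<close>, not confined to \<open>Rvec r\<close>, all of
  whose subsets have empty interior in the product topology.\<close>

definition cvx :: "(nat \<Rightarrow> real) set \<Rightarrow> bool" where
  "cvx K \<longleftrightarrow> (\<forall>x\<in>K. \<forall>y\<in>K. \<forall>u. 0 \<le> u \<longrightarrow> u \<le> 1 \<longrightarrow> (\<lambda>i. u * x i + (1 - u) * y i) \<in> K)"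

lemma cvxD: "cvx K \<Longrightarrow> x \<in> K \<Longrightarrow> y \<in> K \<Longrightarrow> 0 \<le> u \<Longrightarrow> u \<le> 1 \<Longrightarrow> (\<lambda>i. u * x i + (1 - u) * y i) \<in> K"
  by (auto simp: cvx_def)

lemma continuous_on_proj [continuous_intros]: "continuous_on S (\<lambda>x::nat \<Rightarrow> real. x i)"
  by (rule continuous_on_subset[OF continuous_on_product_coordinates]) simp

lemma continuous_on_funI: "(\<And>i. continuous_on S (\<lambda>x. f x i)) \<Longrightarrow> continuous_on S (f :: (nat \<Rightarrow> real) \<Rightarrow> nat \<Rightarrow> real)"
  by (rule continuous_on_coordinatewise_then_product)

text \<open>Continuity in one point while the other stays in \<open>K\<close>, then continuity in
  the other.\<close>

lemma cvx_closure:
  assumes K: "cvx K"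
  shows "cvx (closure K)"
  unfolding cvx_def
proof (intro ballI allI impI)
  fix x y u assume x: "x \<in> closure K" and y: "y \<in> closure K" and u: "0 \<le> u" "u \<le> (1::real)"
  have c1: "continuous_on S (\<lambda>z i. u * z i + (1 - u) * y i)" for S and y :: "nat \<Rightarrow> real"
    by (intro continuous_on_funI continuous_intros)
  have c2: "continuous_on S (\<lambda>z i. u * x i + (1 - u) * z i)" for S and x :: "nat \<Rightarrow> real"
    by (intro continuous_on_funI continuous_intros)
  have 1: "(\<lambda>i. u * x i + (1 - u) * y i) \<in> closure K" if "y \<in> K" for y
  proof -
    have "(\<lambda>z i. u * z i + (1 - u) * y i) ` closure K \<subseteq> closure K"
      using cvxD[OF K] that u closure_subset[of K] by (intro image_closure_subset c1) auto
    thus ?thesis using x by blast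
  qed
  have "(\<lambda>z i. u * x i + (1 - u) * z i) ` closure K \<subseteq> closure K"
    using 1 by (intro image_closure_subset c2) auto
  thus "(\<lambda>i. u * x i + (1 - u) * y i) \<in> closure K" using y by blast
qed

lemma cvx_interior:
  assumes K: "cvx K"
  shows "cvx (interior K)"
  unfolding cvx_def
proof (intro ballI allI impI)
  fix x y u assume x: "x \<in> interior K" and y: "y \<in> interior K" and u: "0 \<le> u" "u \<le> (1::real)"
  show "(\<lambda>i. u * x i + (1 - u) * y i) \<in> interior K"
  proof (cases "u = 0")
    case False
    \<comment> \<open>The inverse of taking the convex combination with \<open>y\<close>. The
      preimage of the interior is an open neighbourhood of the combination and lies in
      \<open>K\<close>.\<close>
    define \<psi> where "\<psi> z = (\<lambda>i. (z i - (1 - u) * y i) / u)" for z :: "nat \<Rightarrow> real"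
    have "continuous_on UNIV \<psi>" unfolding \<psi>_def
      by (intro continuous_on_funI continuous_intros) (use False in auto)
    hence "open (\<psi> -` interior K)" by (intro open_vimage) auto
    moreover have "\<psi> -` interior K \<subseteq> K"
    proof
      fix z assume "z \<in> \<psi> -` interior K"
      hence "\<psi> z \<in> K" using interior_subset by auto
      hence "(\<lambda>i. u * \<psi> z i + (1 - u) * y i) \<in> K" using y interior_subset u by (intro cvxD[OF K]) auto
      moreover have "(\<lambda>i. u * \<psi> z i + (1 - u) * y i) = z" using False by (auto simp: \<psi>_def)
      ultimately show "z \<in> K" by simp
    qed
    moreover have "\<psi> (\<lambda>i. u * x i + (1 - u) * y i) = x" using False by (auto simp: \<psi>_def)
    ultimately show ?thesis using x by (intro interiorI[of "\<psi> -` interior K"]) auto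
  qed (use y in simp)
qed

text \<open>\<open>K\<close> is a cylinder over the coordinates in \<open>I\<close>; over a finite
  \<open>I\<close> such sets behave as in finite dimension.\<close>

definition depends_on :: "nat set \<Rightarrow> (nat \<Rightarrow> real) set \<Rightarrow> bool" where
  "depends_on I K \<longleftrightarrow> (\<forall>x y. (\<forall>i\<in>I. x i = y i) \<longrightarrow> x \<in> K \<longrightarrow> y \<in> K)"

lemma depends_onD:
  assumes "depends_on I K" "\<And>i. i \<in> I \<Longrightarrow> x i = y i"
  shows "x \<in> K \<longleftrightarrow> y \<in> K"
proof
  have "\<forall>i\<in>I. y i = x i" using assms(2) by simp
  thus "y \<in> K \<Longrightarrow> x \<in> K" using assms(1) unfolding depends_on_def by blast
qed (use assms in \<open>unfold depends_on_def, blast\<close>)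

lemma depends_on_Compl:
  assumes "depends_on I K"
  shows "depends_on I (- K)"
  using depends_onD[OF assms] unfolding depends_on_def Compl_iff by blast

lemma depends_on_closure:
  assumes K: "depends_on I K"
  shows "depends_on I (closure K)"
  unfolding depends_on_def
proof (intro allI impI)
  fix x y assume eq: "\<forall>i\<in>I. x i = y i" and x: "x \<in> closure K"
  \<comment> \<open>Overwrites the coordinates outside \<open>I\<close> by those of
    \<open>y\<close>: a continuous map that preserves \<open>K\<close> and takes \<open>x\<close> to
    \<open>y\<close>.\<close>
  define \<phi> where "\<phi> z = (\<lambda>i. if i \<in> I then z i else y i)" for z :: "nat \<Rightarrow> real"
  have c: "continuous_on S \<phi>" for S
  proof (rule continuous_on_funI)
    fix i show "continuous_on S (\<lambda>z. \<phi> z i)"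
      by (cases "i \<in> I") (auto simp: \<phi>_def intro!: continuous_intros)
  qed
  have "\<phi> ` closure K \<subseteq> closure K"
  proof (intro image_closure_subset c)
    show "\<phi> ` K \<subseteq> closure K"
    proof
      fix w assume "w \<in> \<phi> ` K"
      then obtain z where "z \<in> K" "w = \<phi> z" by auto
      moreover from this have "w \<in> K" using depends_onD[OF K, of z w] by (auto simp: \<phi>_def)
      ultimately show "w \<in> closure K" using closure_subset by auto
    qed
  qed auto
  moreover have "\<phi> x = y" using eq by (auto simp: \<phi>_def)
  ultimately show "y \<in> closure K" using x by blast
qed

lemma depends_on_interior: "depends_on I K \<Longrightarrow> depends_on I (interior K)"
  unfolding interior_closure by (intro depends_on_Compl depends_on_closure)

lemma finite_no_chain3:
  fixes T :: "real set"
  assumes "\<And>a b c. a \<in> T \<Longrightarrow> b \<in> T \<Longrightarrow> c \<in> T \<Longrightarrow> a < b \<Longrightarrow> b < c \<Longrightarrow> False"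
  shows "finite T"
proof (rule ccontr)
  assume inf: "infinite T"
  obtain a where a: "a \<in> T" using inf by (metis finite.emptyI all_not_in_conv)
  have "infinite (T - {a})" using inf by simp
  then obtain b where b: "b \<in> T" "b \<noteq> a" by (metis finite.emptyI all_not_in_conv Diff_iff singletonI)
  have "infinite (T - {a} - {b})" using inf by simp
  then obtain c where "c \<in> T - {a} - {b}" by (metis finite.emptyI all_not_in_conv)
  thus False using a b assms[of a b c] assms[of a c b] assms[of b a c] assms[of b c a] assms[of c a b] assms[of c b a]
    by (auto simp: neq_iff)
qed

text \<open>Without atoms, finitely many bad values of one factor are null, which is how frontiers
  are shown to be null. Positivity makes \<open>Z\<^sub>k\<close> a nonconstant function of its own
  factor.\<close>

locale chain_factors =
  fixes B :: "nat \<Rightarrow> real measure" and r :: nat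
  assumes prob_B: "\<And>i. prob_space (B i)" and sets_B [measurable_cong]: "\<And>i. sets (B i) = sets borel"
    and atomless: "\<And>i x. emeasure (B i) {x} = 0" and pos_B: "\<And>i. AE x in B i. x > 0"
    and r: "r \<ge> 1"
begin

definition P where "P = PiM {1..r} B"

sublocale pB: product_prob_space B "{1..r}"
  by (rule product_prob_spaceI) (rule prob_B)

sublocale pP: prob_space P
  unfolding P_def by (rule prob_space_PiM) (rule prob_B)

lemma sets_P [measurable_cong]: "sets P = sets (PiM {1..r} (\<lambda>_. borel))"
  unfolding P_def by (intro sets_PiM_cong refl sets_B)

lemma space_B: "space (B i) = UNIV"
  using sets_eq_imp_space_eq[OF sets_B] by simp

lemma measurable_coord: "i \<in> {1..r} \<Longrightarrow> (\<lambda>\<xi>. \<xi> i) \<in> borel_measurable P"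
  unfolding P_def by (subst measurable_cong_sets[OF refl sets_B[of i, symmetric]]) (rule measurable_component_singleton)

lemma measurable_upd:
  assumes "k \<in> {1..r}"
  shows "(\<lambda>(\<xi>, b). fun_upd \<xi> k b) \<in> measurable (P \<Otimes>\<^sub>M B k) P"
proof -
  have "insert k {1..r} = {1..r}" using assms by auto
  from measurable_add_dim[where i=k and I="{1..r}" and M=B, unfolded this] show ?thesis unfolding P_def .
qed

text \<open>Redrawing factor \<open>k\<close> independently preserves \<open>P\<close>. This allows
  Fubini arguments in one factor without leaving the space over \<open>{1..r}\<close>.\<close>

lemma nn_integral_resample:
  assumes k: "k \<in> {1..r}" and f: "f \<in> borel_measurable P"
  shows "(\<integral>\<^sup>+\<xi>. f \<xi> \<partial>P) = (\<integral>\<^sup>+\<xi>. (\<integral>\<^sup>+b. f (\<xi>(k := b)) \<partial>B k) \<partial>P)"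
proof -
  define I where "I = {1..r} - {k}"
  have ins: "{1..r} = insert k I" "k \<notin> I" "finite I" using k by (auto simp: I_def)
  have f': "f \<in> borel_measurable (PiM (insert k I) B)" using f unfolding P_def ins(1) .
  have f2: "(\<lambda>x. f ((fst x)(k := snd x))) \<in> borel_measurable (P \<Otimes>\<^sub>M B k)"
    using measurable_compose[OF measurable_upd[OF k] f] by (simp add: case_prod_beta)
  have g: "(\<lambda>\<xi>. \<integral>\<^sup>+b. f (\<xi>(k := b)) \<partial>B k) \<in> borel_measurable P"
    using sigma_finite_measure.borel_measurable_nn_integral[OF prob_space_imp_sigma_finite[OF prob_B[of k]], of "\<lambda>\<xi> b. f (\<xi>(k := b))"] f2 by (simp add: case_prod_beta)
  hence g': "(\<lambda>\<xi>. \<integral>\<^sup>+b. f (\<xi>(k := b)) \<partial>B k) \<in> borel_measurable (PiM (insert k I) B)"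
    unfolding P_def ins(1) .
  have "(\<integral>\<^sup>+\<xi>. (\<integral>\<^sup>+b. f (\<xi>(k := b)) \<partial>B k) \<partial>P)
     = (\<integral>\<^sup>+\<xi>. (\<integral>\<^sup>+x. (\<integral>\<^sup>+b. f ((\<xi>(k := x))(k := b)) \<partial>B k) \<partial>B k) \<partial>PiM I B)"
    unfolding P_def ins(1) by (rule pB.product_nn_integral_insert[OF ins(3,2) g'])
  also have "\<dots> = (\<integral>\<^sup>+\<xi>. (\<integral>\<^sup>+b. f (\<xi>(k := b)) \<partial>B k) \<partial>PiM I B)"
    by (simp add: prob_space.emeasure_space_1[OF prob_B])
  also have "\<dots> = (\<integral>\<^sup>+\<xi>. f \<xi> \<partial>P)"
    unfolding P_def ins(1) by (rule pB.product_nn_integral_insert[OF ins(3,2) f', symmetric])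
  finally show ?thesis ..
qed

lemma AE_resample:
  assumes k: "k \<in> {1..r}" and Q: "{\<xi> \<in> space P. \<not> Q \<xi>} \<in> sets P"
    and AE: "AE \<xi> in P. AE b in B k. Q (\<xi>(k := b))"
  shows "AE \<xi> in P. Q \<xi>"
proof -
  define N where "N = {\<xi> \<in> space P. \<not> Q \<xi>}"
  have "emeasure P N = (\<integral>\<^sup>+\<xi>. indicator N \<xi> \<partial>P)" using Q by (simp add: N_def)
  also have "\<dots> = (\<integral>\<^sup>+\<xi>. (\<integral>\<^sup>+b. indicator N (\<xi>(k := b)) \<partial>B k) \<partial>P)"
    using Q by (intro nn_integral_resample[OF k]) (simp add: N_def)
  also have "\<dots> = (\<integral>\<^sup>+\<xi>. 0 \<partial>P)"
  proof (rule nn_integral_cong_AE, rule AE_mp[OF AE], intro AE_I2 impI)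
    fix \<xi> assume "AE b in B k. Q (\<xi>(k := b))"
    hence "(\<integral>\<^sup>+b. indicator N (\<xi>(k := b)) \<partial>B k) = (\<integral>\<^sup>+b. 0 \<partial>B k)"
      by (intro nn_integral_cong_AE) (auto simp: N_def elim!: eventually_mono)
    thus "(\<integral>\<^sup>+b. indicator N (\<xi>(k := b)) \<partial>B k) = 0" by simp
  qed
  finally have "emeasure P N = 0" by simp
  thus ?thesis using Q by (intro AE_I[of _ _ N]) (auto simp: N_def)
qed

lemma AE_pos: "AE \<xi> in P. \<forall>i\<in>{1..r}. \<xi> i > 0"
  unfolding P_def by (intro AE_finite_allI AE_PiM_component prob_B pos_B) auto

lemma AE_not_finite: "finite T \<Longrightarrow> AE b in B k. b \<notin> T"
proof -
  assume T: "finite T"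
  have "AE b in B k. \<forall>y\<in>T. b \<noteq> y"
  proof (intro AE_finite_allI T)
    fix y show "AE b in B k. b \<noteq> y"
      using atomless[of k y] by (intro AE_I[of _ _ "{y}"]) (auto simp: sets_B)
  qed
  thus ?thesis by (auto elim!: eventually_mono)
qed

definition Zv :: "(nat \<Rightarrow> real) \<Rightarrow> nat \<Rightarrow> real" where "Zv \<xi> = Zvar r \<xi>"

lemma measurable_Zv: "Zv \<in> measurable P borel"
proof (rule measurable_coordinatewise_then_product)
  fix i
  show "(\<lambda>\<xi>. Zv \<xi> i) \<in> borel_measurable P"
  proof (cases "i = 0")
    case False
    have "(\<lambda>\<xi>. (\<Prod>j\<in>{i..<r}. \<xi> j) * \<xi> r) \<in> borel_measurable P"
      using False r by (intro borel_measurable_times borel_measurable_prod measurable_coord) auto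
    thus ?thesis using False by (simp add: Zv_def Zvar_def)
  qed (simp add: Zv_def Zvar_def)
qed

text \<open>If a point lies on no frontier of the projections \<open>L q\<close>, \<open>U q\<close> of the parts of \<open>K\<close> above and below a rational
  height, then the line through it in direction \<open>k\<close> meets the frontier of \<open>K\<close> in at most two points.\<close>

lemma frontier_null:
  assumes "1 \<le> k" "k \<le> Suc r" "cvx K" "depends_on {k..r} K"
  shows "AE \<xi> in P. Zv \<xi> \<notin> frontier K"
  using assms(2,1,3,4)
proof (induction k arbitrary: K rule: inc_induct)
  \<comment> \<open>The induction runs downwards from \<open>k = Suc r\<close>, where a set
    depending on no coordinate is empty or everything; each step removes coordinate \<open>k\<close>
    by projection.\<close>
  case base
  hence "K = {} \<or> K = UNIV" unfolding depends_on_def by auto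
  thus ?case by auto
next
  case (step k)
  note K = \<open>cvx K\<close> \<open>depends_on {k..r} K\<close>
  have k: "k \<in> {1..r}" using step by auto
  define L where "L q = {x. \<exists>t>real_of_rat q. x(k := t) \<in> K}" for q
  define U where "U q = {x. \<exists>t<real_of_rat q. x(k := t) \<in> K}" for q
  have comb: "(\<lambda>i. u * x i + (1 - u) * y i)(k := u * t + (1 - u) * t') \<in> K"
    if "x(k := t) \<in> K" "y(k := t') \<in> K" "0 \<le> u" "u \<le> 1" for x y u t t'
  proof -
    have "(\<lambda>i. u * (x(k := t)) i + (1 - u) * (y(k := t')) i) \<in> K" by (rule cvxD[OF K(1) that])
    moreover have "(\<lambda>i. u * (x(k := t)) i + (1 - u) * (y(k := t')) i) = (\<lambda>i. u * x i + (1 - u) * y i)(k := u * t + (1 - u) * t')"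
      by (auto simp: fun_eq_iff)
    ultimately show ?thesis by simp
  qed
  have cL: "cvx (L q)" for q
    unfolding cvx_def
  proof (intro ballI allI impI)
    fix x y u assume "x \<in> L q" "y \<in> L q" and u: "0 \<le> u" "u \<le> (1::real)"
    then obtain t t' where t: "t > real_of_rat q" "x(k := t) \<in> K" "t' > real_of_rat q" "y(k := t') \<in> K"
      by (auto simp: L_def)
    have "u * t + (1 - u) * t' > real_of_rat q"
      using convex_bound_lt[of "- t" "- real_of_rat q" "- t'" u "1 - u"] t u by simp
    thus "(\<lambda>i. u * x i + (1 - u) * y i) \<in> L q" using comb[OF t(2,4) u] by (auto simp: L_def)
  qed
  have cU: "cvx (U q)" for q
    unfolding cvx_def
  proof (intro ballI allI impI)
    fix x y u assume "x \<in> U q" "y \<in> U q" and u: "0 \<le> u" "u \<le> (1::real)"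
    then obtain t t' where t: "t < real_of_rat q" "x(k := t) \<in> K" "t' < real_of_rat q" "y(k := t') \<in> K"
      by (auto simp: U_def)
    have "u * t + (1 - u) * t' < real_of_rat q"
      using convex_bound_lt[of t "real_of_rat q" t' u "1 - u"] t u by simp
    thus "(\<lambda>i. u * x i + (1 - u) * y i) \<in> U q" using comb[OF t(2,4) u] by (auto simp: U_def)
  qed
  have upd: "x(k := t) \<in> K \<longleftrightarrow> y(k := t) \<in> K" if "\<forall>i\<in>{Suc k..r}. x i = y i" for x y t
    using that by (intro depends_onD[OF K(2)]) (auto simp: Suc_le_eq)
  have dL: "depends_on {Suc k..r} (L q)" for q
    unfolding depends_on_def L_def using upd by blast
  have dU: "depends_on {Suc k..r} (U q)" for q
    unfolding depends_on_def U_def using upd by blast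
  have "AE \<xi> in P. Zv \<xi> \<notin> frontier (L q)" "AE \<xi> in P. Zv \<xi> \<notin> frontier (U q)" for q
    using step.IH[OF _ cL dL, of q] step.IH[OF _ cU dU, of q] step.hyps by auto
  hence good: "AE \<xi> in P. \<forall>q. Zv \<xi> \<notin> frontier (L q) \<and> Zv \<xi> \<notin> frontier (U q)"
    by (simp add: AE_all_countable)
  have df: "depends_on {k..r} (frontier K)"
    using depends_onD[OF depends_on_closure[OF K(2)]] depends_onD[OF depends_on_interior[OF K(2)]]
    unfolding depends_on_def frontier_def by blast
  show ?case
  proof (rule AE_resample[OF k])
    have "{\<xi> \<in> space P. Zv \<xi> \<in> frontier K} = Zv -` frontier K \<inter> space P" by auto
    also have "\<dots> \<in> sets P" by (rule measurable_sets[OF measurable_Zv]) (simp add: frontier_closed)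
    finally show "{\<xi> \<in> space P. \<not> Zv \<xi> \<notin> frontier K} \<in> sets P" by simp
    show "AE \<xi> in P. AE b in B k. Zv (\<xi>(k := b)) \<notin> frontier K"
    proof (rule AE_mp[OF good], rule AE_mp[OF AE_pos], rule AE_I2, intro impI)
      fix \<xi> assume pos: "\<forall>i\<in>{1..r}. \<xi> i > 0"
        and g: "\<forall>q. Zv \<xi> \<notin> frontier (L q) \<and> Zv \<xi> \<notin> frontier (U q)"
      define z where "z = Zv \<xi>"
      \<comment> \<open>\<open>Z\<^sub>k\<close> is factor \<open>k\<close> times \<open>c\<close>,
        and \<open>Z\<^sub>i\<close> with \<open>i > k\<close> does not involve this factor.
        Redrawing it thus moves the point in direction \<open>k\<close>, apart from coordinates
        below \<open>k\<close>, on which \<open>K\<close> does not depend.\<close>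
      define c where "c = (if k < r then Zvar r \<xi> (Suc k) else 1)"
      have c: "c \<noteq> 0"
      proof (cases "k < r")
        case True
        have "(\<Prod>j\<in>{Suc k..<r}. \<xi> j) > 0" using pos by (intro prod_pos) auto
        moreover have "\<xi> r > 0" using pos r by auto
        ultimately have "(\<Prod>j\<in>{Suc k..<r}. \<xi> j) * \<xi> r > 0" by (rule mult_pos_pos)
        moreover have "c = (\<Prod>j\<in>{Suc k..<r}. \<xi> j) * \<xi> r" using True by (simp add: c_def Zvar_def)
        ultimately show ?thesis by (metis less_irrefl)
      qed (simp add: c_def)
      define T where "T = {t. z(k := t) \<in> frontier K}"
      have "finite T"
      proof (rule finite_no_chain3)
        fix t1 t2 t3 assume t: "t1 \<in> T" "t2 \<in> T" "t3 \<in> T" "t1 < t2" "t2 < t3"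
        obtain q1 where q1: "t1 < real_of_rat q1" "real_of_rat q1 < t2" using of_rat_dense[OF t(4)] by blast
        obtain q2 where q2: "t2 < real_of_rat q2" "real_of_rat q2 < t3" using of_rat_dense[OF t(5)] by blast
        have opl: "open {w::nat \<Rightarrow> real. w k < a}" for a
          by (rule open_Collect_less) (intro continuous_intros)+
        have opg: "open {w::nat \<Rightarrow> real. a < w k}" for a
          by (rule open_Collect_less) (intro continuous_intros)+
        have "z \<in> closure (U q1)"
        proof -
          have "z(k := t1) \<in> {w. w k < real_of_rat q1} \<inter> closure K"
            using t(1) q1 by (auto simp: T_def frontier_def)
          hence "z(k := t1) \<in> closure ({w. w k < real_of_rat q1} \<inter> K)"
            using open_Int_closure_subset[OF opl] by blast
          also have "\<dots> \<subseteq> closure (U q1)"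
            by (intro closure_mono) (auto simp: U_def intro!: exI[of _ "_ k"])
          finally show ?thesis
            using depends_onD[OF depends_on_closure[OF dU], of "z(k := t1)" z] by auto
        qed
        hence iU: "z \<in> interior (U q1)" using g by (auto simp: frontier_def z_def)
        have "z \<in> closure (L q2)"
        proof -
          have "z(k := t3) \<in> {w. real_of_rat q2 < w k} \<inter> closure K"
            using t(3) q2 by (auto simp: T_def frontier_def)
          hence "z(k := t3) \<in> closure ({w. real_of_rat q2 < w k} \<inter> K)"
            using open_Int_closure_subset[OF opg] by blast
          also have "\<dots> \<subseteq> closure (L q2)"
            by (intro closure_mono) (auto simp: L_def intro!: exI[of _ "_ k"])
          finally show ?thesis
            using depends_onD[OF depends_on_closure[OF dL], of "z(k := t3)" z] by auto
        qed
        hence iL: "z \<in> interior (L q2)" using g by (auto simp: frontier_def z_def)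
        \<comment> \<open>For \<open>w\<close> in this set, the line through \<open>w\<close> in
          direction \<open>k\<close> meets \<open>K\<close> below \<open>q1\<close> and above
          \<open>q2\<close>, with \<open>w\<close> in between, so \<open>w\<close> lies in
          \<open>K\<close> by convexity. The middle one of three frontier points would thus be
          interior.\<close>
        define V where "V = interior (U q1) \<inter> interior (L q2) \<inter> {w. real_of_rat q1 < w k} \<inter> {w. w k < real_of_rat q2}"
        have "open V" unfolding V_def by (intro open_Int open_interior opl opg)
        moreover have "z(k := t2) \<in> V"
          using iU iL q1 q2 depends_onD[OF depends_on_interior[OF dU], of "z(k := t2)" z q1]
            depends_onD[OF depends_on_interior[OF dL], of "z(k := t2)" z q2] by (auto simp: V_def)
        moreover have "V \<subseteq> K"
        proof
          fix w assume w: "w \<in> V"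
          then obtain a b where ab: "a < real_of_rat q1" "w(k := a) \<in> K" "b > real_of_rat q2" "w(k := b) \<in> K"
            using interior_subset unfolding V_def U_def L_def by blast
          have wk: "a < w k" "w k < b" using w ab by (auto simp: V_def)
          define u where "u = (b - w k) / (b - a)"
          have u: "0 \<le> u" "u \<le> 1" using wk by (auto simp: u_def field_simps)
          have "u * (b - a) = b - w k" using wk by (simp add: u_def)
          hence "u * a + (1 - u) * b = w k" by (simp add: algebra_simps)
          moreover have "(\<lambda>i. u * w i + (1 - u) * w i) = w" by (auto simp: algebra_simps)
          ultimately show "w \<in> K" using comb[OF ab(2,4) u] by simp
        qed
        ultimately have "z(k := t2) \<in> interior K" by (intro interiorI)
        thus False using t(2) by (auto simp: T_def frontier_def)
      qed
      hence "finite ((\<lambda>b. b * c) -` T)" using c by (intro finite_vimageI) (auto intro: injI)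
      hence "AE b in B k. b \<notin> (\<lambda>b. b * c) -` T" by (rule AE_not_finite)
      thus "AE b in B k. Zv (\<xi>(k := b)) \<notin> frontier K"
      proof (rule eventually_mono)
        fix b assume b: "b \<notin> (\<lambda>b. b * c) -` T"
        have "Zv (\<xi>(k := b)) \<in> frontier K \<longleftrightarrow> z(k := b * c) \<in> frontier K"
        proof (rule depends_onD[OF df])
          fix i assume i: "i \<in> {k..r}"
          show "Zv (\<xi>(k := b)) i = (z(k := b * c)) i"
          proof (cases "i = k")
            case True
            have "(\<Prod>j\<in>{k..<r}. (\<xi>(k := b)) j) = b * (\<Prod>j\<in>{Suc k..<r}. \<xi> j)" if "k < r"
            proof -
              have "(\<Prod>j\<in>{k..<r}. (\<xi>(k := b)) j) = b * (\<Prod>j\<in>{Suc k..<r}. (\<xi>(k := b)) j)"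
                using that by (subst prod.atLeast_Suc_lessThan) auto
              also have "(\<Prod>j\<in>{Suc k..<r}. (\<xi>(k := b)) j) = (\<Prod>j\<in>{Suc k..<r}. \<xi> j)"
                by (intro prod.cong) auto
              finally show ?thesis .
            qed
            thus ?thesis using True k by (cases "k < r") (auto simp: Zv_def Zvar_def c_def)
          next
            case False
            have "(\<Prod>j\<in>{i..<r}. (\<xi>(k := b)) j) = (\<Prod>j\<in>{i..<r}. \<xi> j)"
              using False i by (intro prod.cong) auto
            thus ?thesis using False i by (auto simp: Zv_def Zvar_def z_def)
          qed
        qed
        thus "Zv (\<xi>(k := b)) \<notin> frontier K" using b by (simp add: T_def)
      qed
    qed
  qed
qed

end

section \<open>Replacing coordinates one at a time\<close>

lemma measure_bind_pmf:
  "measure_pmf.prob (bind_pmf p f) A = measure_pmf.expectation p (\<lambda>x. measure_pmf.prob (f x) A)"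
proof -
  have "ennreal (measure_pmf.prob (bind_pmf p f) A) = (\<integral>\<^sup>+x. ennreal (measure_pmf.prob (f x) A) \<partial>p)"
    by (simp flip: measure_pmf.emeasure_eq_measure)
  also have "\<dots> = ennreal (measure_pmf.expectation p (\<lambda>x. measure_pmf.prob (f x) A))"
    by (intro nn_integral_eq_integral measure_pmf.integrable_const_bound[where B=1]) auto
  finally show ?thesis by (simp add: integral_nonneg_AE)
qed

lemma measure_pmf_eq_sum:
  assumes "finite (set_pmf p)"
  shows "measure_pmf.prob p {t. Q t} = (\<Sum>t\<in>set_pmf p. indicator {t. Q t} t * pmf p t)"
proof -
  have "measure_pmf.prob p {t. Q t} = measure_pmf.expectation p (indicator {t. Q t})" by simp
  also have "\<dots> = (\<Sum>t\<in>set_pmf p. indicator {t. Q t} t * pmf p t)"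
    using assms by (intro integral_measure_pmf_real) auto
  finally show ?thesis .
qed

text \<open>The law of \<open>(S\<^sub>1, \<dots>, S\<^sub>k)\<close> given \<open>S\<^sub>k = y\<close>; the arguments \<open>m j\<close> and \<open>d j\<close> are the values of \<open>S\<^sub>j\<close>
  and of the weight of vertex \<open>j + 1\<close> when their Polya urn starts.\<close>

primrec polya_sums :: "(nat \<Rightarrow> nat) \<Rightarrow> (nat \<Rightarrow> nat) \<Rightarrow> nat \<Rightarrow> nat \<Rightarrow> (nat \<Rightarrow> nat) pmf" where
  "polya_sums m d 0 y = return_pmf (\<lambda>_. 0)"
| "polya_sums m d (Suc k) y = (if k = 0 then return_pmf ((\<lambda>_. 0)(1 := y))
     else bind_pmf (polya (m k) (d k) (y - (m k + d k))) (\<lambda>t. map_pmf (\<lambda>x. x(Suc k := y)) (polya_sums m d k t)))"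

text \<open>The continuous counterpart: \<open>(Z\<^sub>1, \<dots>, Z\<^sub>k)\<close> given \<open>Z\<^sub>k = u\<close>.\<close>

definition beta_sums :: "nat \<Rightarrow> real \<Rightarrow> (nat \<Rightarrow> real) \<Rightarrow> nat \<Rightarrow> real" where
  "beta_sums k u \<xi> = (\<lambda>i. if i \<in> {1..k} then (\<Prod>j\<in>{i..<k}. \<xi> j) * u else 0)"

lemma beta_sums_upd: "k \<le> q \<Longrightarrow> beta_sums k u (\<xi>(q := b)) = beta_sums k u \<xi>"
  unfolding beta_sums_def by (intro ext if_cong refl arg_cong2[where f="(*)"] prod.cong) auto

lemma beta_sums_Suc:
  assumes "k \<ge> 1"
  shows "beta_sums (Suc k) u \<xi> = (beta_sums k (\<xi> k * u) \<xi>)(Suc k := u)"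
proof
  fix i
  show "beta_sums (Suc k) u \<xi> i = ((beta_sums k (\<xi> k * u) \<xi>)(Suc k := u)) i"
    by (cases "i \<in> {1..k}") (auto simp: beta_sums_def le_Suc_eq)
qed

lemma cvx_upd:
  assumes K: "cvx K"
  shows "cvx {z. z(k := c) \<in> K}"
  unfolding cvx_def
proof (intro ballI allI impI, unfold mem_Collect_eq)
  fix x y u assume xy: "x(k := c) \<in> K" "y(k := c) \<in> K" and u: "0 \<le> u" "u \<le> (1::real)"
  have "(\<lambda>i. u * (x(k := c)) i + (1 - u) * (y(k := c)) i) \<in> K" by (rule cvxD[OF K xy u])
  moreover have "(\<lambda>i. u * (x(k := c)) i + (1 - u) * (y(k := c)) i) = (\<lambda>i. u * x i + (1 - u) * y i)(k := c)"
    by (auto simp: fun_eq_iff algebra_simps)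
  ultimately show "(\<lambda>i. u * x i + (1 - u) * y i)(k := c) \<in> K" by simp
qed

lemma borel_upd:
  assumes "K \<in> sets (borel :: (nat \<Rightarrow> real) measure)"
  shows "{z. z(k := c) \<in> K} \<in> sets borel"
proof -
  have "continuous_on UNIV (\<lambda>z::nat \<Rightarrow> real. z(k := c))"
  proof (rule continuous_on_funI)
    fix i show "continuous_on UNIV (\<lambda>z::nat \<Rightarrow> real. (z(k := c)) i)"
      by (cases "i = k") (auto intro!: continuous_intros)
  qed
  hence "(\<lambda>z. z(k := c)) \<in> borel_measurable borel" by (rule borel_measurable_continuous_onI)
  from measurable_sets[OF this assms] show ?thesis by (simp add: vimage_def)
qed

text \<open>\<open>beta_sums\<close> is linear in its top value. This is what reduces the exchange
  of a coordinate to a one-dimensional distance.\<close>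

lemma is_interval_beta_sums:
  assumes K: "cvx K"
  shows "is_interval {u. beta_sums k (u * c) \<xi> \<in> K}"
  unfolding is_interval_1
proof (intro ballI allI impI, unfold mem_Collect_eq)
  fix a b x assume a: "beta_sums k (a * c) \<xi> \<in> K" and b: "beta_sums k (b * c) \<xi> \<in> K" and "a \<le> x \<and> x \<le> (b::real)"
  hence x: "a \<le> x" "x \<le> b" by auto
  show "beta_sums k (x * c) \<xi> \<in> K"
  proof (cases "a = b")
    case False
    hence ab: "a < b" using x by simp
    define v where "v = (b - x) / (b - a)"
    have v: "0 \<le> v" "v \<le> 1" using ab x by (auto simp: v_def field_simps)
    have "v * (b - a) = b - x" using ab by (simp add: v_def)
    hence e: "v * a + (1 - v) * b = x" by (simp add: algebra_simps)
    have "(\<lambda>i. v * beta_sums k (a * c) \<xi> i + (1 - v) * beta_sums k (b * c) \<xi> i) \<in> K" by (rule cvxD[OF K a b v])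
    moreover have "(\<lambda>i. v * beta_sums k (a * c) \<xi> i + (1 - v) * beta_sums k (b * c) \<xi> i) = beta_sums k (x * c) \<xi>"
      unfolding e[symmetric] by (auto simp: fun_eq_iff beta_sums_def algebra_simps)
    ultimately show ?thesis by simp
  qed (use a x in auto)
qed

context chain_factors
begin

lemma upd_space: "\<xi> \<in> space P \<Longrightarrow> k \<in> {1..r} \<Longrightarrow> \<xi>(k := b) \<in> space P"
  unfolding P_def space_PiM by (auto simp: space_B PiE_def extensional_def)

text \<open>With the other factors fixed, the values of factor \<open>k\<close> that lead into
  \<open>K\<close> form an interval, so exchanging its law for that of \<open>g\<close> costs at
  most \<open>\<delta>\<close>; Fubini averages over the rest. Finite support makes the mean over
  \<open>p\<close> a sum, which interchanges with the integral over \<open>P\<close>.\<close>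

lemma mix_interval:
  fixes p :: "nat pmf" and g :: "nat \<Rightarrow> real" and \<psi> :: "real \<Rightarrow> (nat \<Rightarrow> real) \<Rightarrow> nat \<Rightarrow> real"
  assumes k: "k \<in> {1..r}" and fin: "finite (set_pmf p)" and K: "K \<in> sets borel"
    and meas1: "(\<lambda>\<xi>. \<psi> (\<xi> k) \<xi>) \<in> measurable P borel" and meas2: "\<And>u. \<psi> u \<in> measurable P borel"
    and inv: "\<And>u b \<xi>. \<psi> u (\<xi>(k := b)) = \<psi> u \<xi>"
    and J: "\<And>\<xi>. is_interval {u. \<psi> u \<xi> \<in> K}"
    and disc: "\<And>J. is_interval J \<Longrightarrow> \<bar>measure_pmf.prob p {t. g t \<in> J} - measure (B k) J\<bar> \<le> \<delta>"
  shows "\<bar>measure_pmf.expectation p (\<lambda>t. measure P {\<xi> \<in> space P. \<psi> (g t) \<xi> \<in> K})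
       - measure P {\<xi> \<in> space P. \<psi> (\<xi> k) \<xi> \<in> K}\<bar> \<le> \<delta>"
proof -
  define A where "A = {\<xi> \<in> space P. \<psi> (\<xi> k) \<xi> \<in> K}"
  define q where "q \<xi> = measure (B k) {u. \<psi> u \<xi> \<in> K}" for \<xi>
  define H where "H \<xi> = measure_pmf.prob p {t. \<psi> (g t) \<xi> \<in> K}" for \<xi>
  have A: "A \<in> sets P"
  proof -
    have "A = (\<lambda>\<xi>. \<psi> (\<xi> k) \<xi>) -` K \<inter> space P" by (auto simp: A_def)
    thus ?thesis using measurable_sets[OF meas1 K] by simp
  qed
  have A2: "{\<xi> \<in> space P. \<psi> u \<xi> \<in> K} \<in> sets P" for u
  proof -
    have "{\<xi> \<in> space P. \<psi> u \<xi> \<in> K} = \<psi> u -` K \<inter> space P" by auto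
    thus ?thesis using measurable_sets[OF meas2 K] by simp
  qed
  have inner: "(\<integral>\<^sup>+b. indicator A (\<xi>(k := b)) \<partial>B k) = ennreal (q \<xi>)" if "\<xi> \<in> space P" for \<xi>
  proof -
    have "(\<integral>\<^sup>+b. indicator A (\<xi>(k := b)) \<partial>B k) = (\<integral>\<^sup>+b. indicator {u. \<psi> u \<xi> \<in> K} b \<partial>B k)"
      using upd_space[OF that k] by (intro nn_integral_cong) (auto simp: A_def inv indicator_def)
    also have "\<dots> = emeasure (B k) {u. \<psi> u \<xi> \<in> K}"
      using real_interval_borel[OF J] by (simp add: sets_B)
    finally show ?thesis by (simp add: q_def finite_measure.emeasure_eq_measure[OF prob_space.finite_measure[OF prob_B]])
  qed
  have q_meas: "q \<in> borel_measurable P"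
  proof -
    have "(\<lambda>x. indicator A ((fst x)(k := snd x)) :: ennreal) \<in> borel_measurable (P \<Otimes>\<^sub>M B k)"
      using measurable_compose[OF measurable_upd[OF k] borel_measurable_indicator[OF A]] by (simp add: case_prod_beta)
    hence "(\<lambda>\<xi>. \<integral>\<^sup>+b. indicator A (\<xi>(k := b)) \<partial>B k) \<in> borel_measurable P"
      using sigma_finite_measure.borel_measurable_nn_integral[OF prob_space_imp_sigma_finite[OF prob_B[of k]], of "\<lambda>\<xi> b. indicator A (\<xi>(k := b))"]
      by (simp add: case_prod_beta)
    hence "(\<lambda>\<xi>. enn2real (\<integral>\<^sup>+b. indicator A (\<xi>(k := b)) \<partial>B k)) \<in> borel_measurable P" by measurable
    thus ?thesis by (rule measurable_cong[THEN iffD1, rotated]) (simp add: inner q_def)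
  qed
  have q01: "0 \<le> q \<xi>" "q \<xi> \<le> 1" for \<xi> by (auto simp: q_def prob_space.prob_le_1[OF prob_B])
  have q_int: "integrable P q" using q01 q_meas by (intro pP.integrable_const_bound[where B=1]) auto
  have "emeasure P A = (\<integral>\<^sup>+\<xi>. indicator A \<xi> \<partial>P)" using A by simp
  also have "\<dots> = (\<integral>\<^sup>+\<xi>. (\<integral>\<^sup>+b. indicator A (\<xi>(k := b)) \<partial>B k) \<partial>P)"
    using A by (intro nn_integral_resample[OF k]) simp
  also have "\<dots> = (\<integral>\<^sup>+\<xi>. ennreal (q \<xi>) \<partial>P)" by (intro nn_integral_cong inner)
  also have "\<dots> = ennreal (\<integral>\<xi>. q \<xi> \<partial>P)" using q01 q_int by (intro nn_integral_eq_integral) auto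
  finally have PA: "measure P A = (\<integral>\<xi>. q \<xi> \<partial>P)"
    using q01 by (simp add: measure_def integral_nonneg_AE)
  have H_sum: "H \<xi> = (\<Sum>t\<in>set_pmf p. indicator {\<xi> \<in> space P. \<psi> (g t) \<xi> \<in> K} \<xi> * pmf p t)" if "\<xi> \<in> space P" for \<xi>
    unfolding H_def measure_pmf_eq_sum[OF fin] using that by (intro sum.cong) (auto simp: indicator_def)
  have ind_int: "integrable P (\<lambda>\<xi>. indicator {\<xi> \<in> space P. \<psi> (g t) \<xi> \<in> K} \<xi> * pmf p t)" for t
    using A2[of "g t"] by (intro integrable_mult_left integrable_real_indicator) (auto simp: pP.emeasure_eq_measure)
  have H_int: "integrable P H"
    by (subst Bochner_Integration.integrable_cong[OF refl H_sum]) (auto intro: ind_int)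
  have "measure_pmf.expectation p (\<lambda>t. measure P {\<xi> \<in> space P. \<psi> (g t) \<xi> \<in> K})
      = (\<Sum>t\<in>set_pmf p. measure P {\<xi> \<in> space P. \<psi> (g t) \<xi> \<in> K} * pmf p t)"
    using fin by (intro integral_measure_pmf_real) auto
  also have "\<dots> = (\<Sum>t\<in>set_pmf p. \<integral>\<xi>. indicator {\<xi> \<in> space P. \<psi> (g t) \<xi> \<in> K} \<xi> * pmf p t \<partial>P)"
    using A2 by (intro sum.cong) auto
  also have "\<dots> = (\<integral>\<xi>. (\<Sum>t\<in>set_pmf p. indicator {\<xi> \<in> space P. \<psi> (g t) \<xi> \<in> K} \<xi> * pmf p t) \<partial>P)"
    by (rule Bochner_Integration.integral_sum[symmetric]) (rule ind_int)
  also have "\<dots> = (\<integral>\<xi>. H \<xi> \<partial>P)"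
    by (rule Bochner_Integration.integral_cong[OF refl, symmetric]) (rule H_sum)
  finally have EH: "measure_pmf.expectation p (\<lambda>t. measure P {\<xi> \<in> space P. \<psi> (g t) \<xi> \<in> K}) = (\<integral>\<xi>. H \<xi> \<partial>P)" .
  have bd: "\<bar>H \<xi> - q \<xi>\<bar> \<le> \<delta>" for \<xi>
    using disc[OF J[of \<xi>]] by (simp add: H_def q_def)
  have "\<bar>(\<integral>\<xi>. H \<xi> \<partial>P) - (\<integral>\<xi>. q \<xi> \<partial>P)\<bar> = \<bar>\<integral>\<xi>. H \<xi> - q \<xi> \<partial>P\<bar>"
    using H_int q_int by simp
  also have "\<dots> \<le> (\<integral>\<xi>. \<bar>H \<xi> - q \<xi>\<bar> \<partial>P)" by (rule integral_abs_bound)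
  also have "\<dots> \<le> \<delta>" using bd H_int q_int by (intro pP.integral_le_const) auto
  finally show ?thesis unfolding EH PA[symmetric] A_def .
qed

lemma measurable_beta_sums:
  assumes "k \<le> r" "f \<in> borel_measurable P"
  shows "(\<lambda>\<xi>. beta_sums k (f \<xi>) \<xi>) \<in> measurable P borel"
proof (rule measurable_coordinatewise_then_product)
  fix i
  show "(\<lambda>\<xi>. beta_sums k (f \<xi>) \<xi> i) \<in> borel_measurable P"
  proof (cases "i \<in> {1..k}")
    case True
    have "(\<lambda>\<xi>. (\<Prod>j\<in>{i..<k}. \<xi> j) * f \<xi>) \<in> borel_measurable P"
      using True assms by (intro borel_measurable_times borel_measurable_prod measurable_coord) auto
    thus ?thesis using True by (simp add: beta_sums_def)
  qed (auto simp: beta_sums_def)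
qed

text \<open>Two exchanges in a row: given \<open>t\<close>, the lower coordinates pass to the
  continuous chain, with error \<open>C / (t - 1)\<close> averaged over \<open>p\<close>; then
  \<open>t\<close> is replaced by factor \<open>k\<close> times \<open>e\<close>, with one
  \<open>\<delta>\<close> for each end of an interval.\<close>

lemma chain_step:
  fixes p :: "nat pmf" and F :: "nat \<Rightarrow> (nat \<Rightarrow> nat) pmf"
  assumes k: "k \<in> {1..r}" and fin: "finite (set_pmf p)" and K: "K \<in> sets borel" "cvx K" and e: "e > 0"
    and F: "\<And>t. t \<in> set_pmf p \<Longrightarrow> \<bar>measure_pmf.prob (F t) {x. (\<lambda>i. \<epsilon> * real (x i)) \<in> K}
          - measure P {\<xi> \<in> space P. beta_sums k (\<epsilon> * real t) \<xi> \<in> K}\<bar> \<le> C / (real t - 1)"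
    and disc: "\<And>u. \<bar>measure_pmf.prob p {t. \<epsilon> * real t / e \<le> u} - measure (B k) {..u}\<bar> \<le> \<delta>"
  shows "\<bar>measure_pmf.prob (bind_pmf p F) {x. (\<lambda>i. \<epsilon> * real (x i)) \<in> K}
      - measure P {\<xi> \<in> space P. beta_sums k (\<xi> k * e) \<xi> \<in> K}\<bar>
      \<le> C * measure_pmf.expectation p (\<lambda>t. 1 / (real t - 1)) + 2 * \<delta>"
proof -
  define a where "a t = measure_pmf.prob (F t) {x. (\<lambda>i. \<epsilon> * real (x i)) \<in> K}" for t
  define b where "b t = measure P {\<xi> \<in> space P. beta_sums k (\<epsilon> * real t) \<xi> \<in> K}" for t
  have int: "integrable (measure_pmf p) f" for f :: "nat \<Rightarrow> real" by (rule integrable_measure_pmf_finite[OF fin])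
  have "\<bar>measure_pmf.expectation p a - measure_pmf.expectation p b\<bar> = \<bar>measure_pmf.expectation p (\<lambda>t. a t - b t)\<bar>"
    using int by simp
  also have "\<dots> \<le> measure_pmf.expectation p (\<lambda>t. \<bar>a t - b t\<bar>)" by (rule integral_abs_bound)
  also have "\<dots> \<le> measure_pmf.expectation p (\<lambda>t. C * (1 / (real t - 1)))"
    using F unfolding a_def b_def by (intro integral_mono_AE int AE_pmfI) auto
  also have "\<dots> = C * measure_pmf.expectation p (\<lambda>t. 1 / (real t - 1))" by (rule integral_mult_right_zero)
  finally have 1: "\<bar>measure_pmf.expectation p a - measure_pmf.expectation p b\<bar> \<le> C * measure_pmf.expectation p (\<lambda>t. 1 / (real t - 1))" .
  define g where "g t = \<epsilon> * real t / e" for t :: nat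
  have ge: "g t * e = \<epsilon> * real t" for t using e by (simp add: g_def)
  have "\<bar>measure_pmf.expectation p (\<lambda>t. measure P {\<xi> \<in> space P. beta_sums k (g t * e) \<xi> \<in> K})
     - measure P {\<xi> \<in> space P. beta_sums k (\<xi> k * e) \<xi> \<in> K}\<bar> \<le> 2 * \<delta>"
  proof (rule mix_interval[OF k fin K(1), where \<psi>="\<lambda>u. beta_sums k (u * e)"])
    show "(\<lambda>\<xi>. beta_sums k (\<xi> k * e) \<xi>) \<in> measurable P borel"
      using k by (intro measurable_beta_sums borel_measurable_times measurable_coord) auto
    show "beta_sums k (u * e) \<in> measurable P borel" for u using k measurable_beta_sums[of k "\<lambda>_. u * e"] by simp
    show "beta_sums k (u * e) (\<xi>(k := b)) = beta_sums k (u * e) \<xi>" for u b \<xi> by (simp add: beta_sums_upd)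
    show "is_interval {u. beta_sums k (u * e) \<xi> \<in> K}" for \<xi> by (rule is_interval_beta_sums[OF K(2)])
    fix J :: "real set" assume J: "is_interval J"
    have *: "measure (distr p borel g) X = measure_pmf.prob p {t. g t \<in> X}" if "X \<in> sets borel" for X
      using that by (subst measure_distr) (auto simp: vimage_def)
    have "\<bar>measure (distr p borel g) J - measure (B k) J\<bar> \<le> 2 * \<delta>"
    proof (rule interval_discrepancy)
      show "prob_space (distr (measure_pmf p) borel g)" by (intro measure_pmf.prob_space_distr) simp
      show "\<bar>measure (distr p borel g) {..t} - measure (B k) {..t}\<bar> \<le> \<delta>" for t
        using disc[of t] by (simp add: * g_def)
    qed (use J prob_B sets_B in auto)
    thus "\<bar>measure_pmf.prob p {t. g t \<in> J} - measure (B k) J\<bar> \<le> 2 * \<delta>"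
      using *[OF real_interval_borel[OF J]] by simp
  qed
  thus ?thesis using 1 unfolding ge measure_bind_pmf a_def b_def by linarith
qed

end

text \<open>\<open>md\<close> is an inequality because further edges may be received before the next
  urn starts. \<open>k \<le> m k\<close> yields \<open>m k \<ge> 2\<close> from the second vertex
  on, as the inverse moment requires.\<close>

locale polya_chain = chain_factors +
  fixes m d :: "nat \<Rightarrow> nat"
  assumes m: "\<And>k. 1 \<le> k \<Longrightarrow> k \<le> r \<Longrightarrow> k \<le> m k" and d: "\<And>k. 1 \<le> k \<Longrightarrow> k < r \<Longrightarrow> d k \<ge> 1"
    and md: "\<And>k. 1 \<le> k \<Longrightarrow> k < r \<Longrightarrow> m k + d k \<le> m (Suc k)"
    and B_beta: "\<And>k. 1 \<le> k \<Longrightarrow> k < r \<Longrightarrow> B k = beta_distr (real (m k)) (real (d k))"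
begin

lemma chain_discrepancy:
  assumes "1 \<le> k" "k \<le> r"
  shows "\<exists>C\<ge>0. (k = 1 \<longrightarrow> C = 0) \<and> (\<forall>K \<epsilon> y. K \<in> sets borel \<longrightarrow> cvx K \<longrightarrow> \<epsilon> > 0 \<longrightarrow> m k \<le> y \<longrightarrow>
    \<bar>measure_pmf.prob (polya_sums m d k y) {x. (\<lambda>i. \<epsilon> * real (x i)) \<in> K}
      - measure P {\<xi> \<in> space P. beta_sums k (\<epsilon> * real y) \<xi> \<in> K}\<bar> \<le> C / (real y - 1))"
  using assms
proof (induction k rule: nat_induct_at_least)
  case base
  show ?case
  proof (intro exI[of _ 0] conjI impI allI)
    fix K :: "(nat \<Rightarrow> real) set" and \<epsilon> :: real and y :: nat
    have "(\<lambda>i. \<epsilon> * real (((\<lambda>_. 0)(1 := y)) i)) = beta_sums 1 (\<epsilon> * real y) \<xi>" for \<xi>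
      by (auto simp: beta_sums_def fun_eq_iff)
    thus "\<bar>measure_pmf.prob (polya_sums m d 1 y) {x. (\<lambda>i. \<epsilon> * real (x i)) \<in> K}
      - measure P {\<xi> \<in> space P. beta_sums 1 (\<epsilon> * real y) \<xi> \<in> K}\<bar> \<le> 0 / (real y - 1)"
      by (cases "beta_sums 1 (\<epsilon> * real y) undefined \<in> K") (auto simp: measure_return pP.prob_space beta_sums_def indicator_def)
  qed simp_all
next
  case (Suc k)
  note k = \<open>1 \<le> k\<close>
  have kr: "k < r" "k \<in> {1..r}" using Suc by auto
  obtain C where C: "C \<ge> 0" "k = 1 \<Longrightarrow> C = 0"
    and IH: "\<And>K \<epsilon> y. K \<in> sets borel \<Longrightarrow> cvx K \<Longrightarrow> \<epsilon> > 0 \<Longrightarrow> m k \<le> y \<Longrightarrow>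
    \<bar>measure_pmf.prob (polya_sums m d k y) {x. (\<lambda>i. \<epsilon> * real (x i)) \<in> K}
      - measure P {\<xi> \<in> space P. beta_sums k (\<epsilon> * real y) \<xi> \<in> K}\<bar> \<le> C / (real y - 1)"
    using Suc.IH kr by auto
  have m1: "m k \<ge> 1" using m[of k] k kr by auto
  have d1: "d k \<ge> 1" using d k kr by auto
  define C1 where "C1 = 6 * (real (m k) ^ 2 + real (d k) ^ 2 + 1) / integral\<^sup>L lborel (beta_dens (m k) (d k))"
  have C1: "C1 \<ge> 0" using finite_density.h_pos[OF finite_density_beta[OF m1 d1]] by (simp add: C1_def)
  define C2 where "C2 = C * ((real (m k + d k) - 1) / (real (m k) - 1)) + 2 * C1"
  have C2: "C2 \<ge> 0" using C(1) C1 m1 by (simp add: C2_def)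
  show ?case
  proof (intro exI[of _ C2] conjI impI allI C2)
    fix K :: "(nat \<Rightarrow> real) set" and \<epsilon> :: real and y :: nat
    assume K: "K \<in> sets borel" "cvx K" and \<epsilon>: "\<epsilon> > 0" and y: "m (Suc k) \<le> y"
    define t where "t = y - (m k + d k)"
    have yt: "y = m k + d k + t" using y md[of k] k kr by (simp add: t_def)
    have y2: "real y \<ge> 2" using yt m1 d1 by simp
    \<comment> \<open>The top coordinate is \<open>\<epsilon> * y\<close> in both chains, so
      \<open>K\<close> may be replaced by its slice.\<close>
    define K' where "K' = {z. z(Suc k := \<epsilon> * real y) \<in> K}"
    have K': "K' \<in> sets borel" "cvx K'" unfolding K'_def using K by (auto intro: borel_upd cvx_upd)
    define p where "p = polya (m k) (d k) t"
    have pge: "m k \<le> q" if "q \<in> set_pmf p" for q using that set_pmf_polya unfolding p_def by fastforce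
    have "polya_sums m d (Suc k) y = map_pmf (\<lambda>x. x(Suc k := y)) (bind_pmf p (polya_sums m d k))"
      using k unfolding p_def t_def by (simp add: map_bind_pmf)
    hence L: "measure_pmf.prob (polya_sums m d (Suc k) y) {x. (\<lambda>i. \<epsilon> * real (x i)) \<in> K}
      = measure_pmf.prob (bind_pmf p (polya_sums m d k)) {x. (\<lambda>i. \<epsilon> * real (x i)) \<in> K'}"
    proof -
      have "(\<lambda>i. \<epsilon> * real ((x(Suc k := y)) i)) = (\<lambda>i. \<epsilon> * real (x i))(Suc k := \<epsilon> * real y)" for x :: "nat \<Rightarrow> nat"
        by (auto simp: fun_eq_iff)
      thus ?thesis unfolding \<open>polya_sums m d (Suc k) y = _\<close> by (simp add: K'_def vimage_def)
    qed
    have R: "{\<xi> \<in> space P. beta_sums (Suc k) (\<epsilon> * real y) \<xi> \<in> K} = {\<xi> \<in> space P. beta_sums k (\<xi> k * (\<epsilon> * real y)) \<xi> \<in> K'}"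
      unfolding K'_def using beta_sums_Suc[OF k] by simp
    have "\<bar>measure_pmf.prob (bind_pmf p (polya_sums m d k)) {x. (\<lambda>i. \<epsilon> * real (x i)) \<in> K'}
      - measure P {\<xi> \<in> space P. beta_sums k (\<xi> k * (\<epsilon> * real y)) \<xi> \<in> K'}\<bar>
      \<le> C * measure_pmf.expectation p (\<lambda>t. 1 / (real t - 1)) + 2 * (C1 / real y)"
    proof (rule chain_step[OF kr(2) _ K'])
      show "finite (set_pmf p)" unfolding p_def polya_def by (rule finite_set_pmf_walk)
      show "\<epsilon> * real y > 0" using \<epsilon> y2 by simp
      show "\<bar>measure_pmf.prob (polya_sums m d k q) {x. (\<lambda>i. \<epsilon> * real (x i)) \<in> K'}
          - measure P {\<xi> \<in> space P. beta_sums k (\<epsilon> * real q) \<xi> \<in> K'}\<bar> \<le> C / (real q - 1)" if "q \<in> set_pmf p" for q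
        by (rule IH[OF K' \<epsilon> pge[OF that]])
      fix u
      have "{q. \<epsilon> * real q / (\<epsilon> * real y) \<le> u} = {q. real q / real y \<le> u}" using \<epsilon> by simp
      thus "\<bar>measure_pmf.prob p {q. \<epsilon> * real q / (\<epsilon> * real y) \<le> u} - measure (B k) {..u}\<bar> \<le> C1 / real y"
        using polya_kolmogorov[OF m1 d1, of t u] B_beta[of k] k kr unfolding p_def yt C1_def by simp
    qed
    also have "\<dots> \<le> C2 / (real y - 1)"
    proof -
      have "C * measure_pmf.expectation p (\<lambda>t. 1 / (real t - 1)) \<le> C * ((real (m k + d k) - 1) / (real (m k) - 1)) / (real y - 1)"
      proof (cases "k = 1")
        case False
        hence "m k \<ge> 2" using m[of k] k kr by auto
        thus ?thesis unfolding p_def yt by (simp add: expectation_polya_inverse)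
      qed (use C in auto)
      moreover have "2 * (C1 / real y) \<le> 2 * C1 / (real y - 1)"
        using C1 y2 by (simp add: frac_le)
      ultimately show ?thesis by (simp add: C2_def add_divide_distrib)
    qed
    finally show "\<bar>measure_pmf.prob (polya_sums m d (Suc k) y) {x. (\<lambda>i. \<epsilon> * real (x i)) \<in> K}
      - measure P {\<xi> \<in> space P. beta_sums (Suc k) (\<epsilon> * real y) \<xi> \<in> K}\<bar> \<le> C2 / (real y - 1)"
      unfolding L R .
  qed (use k in auto)
qed

end

section \<open>Partial sums of the weights\<close>

text \<open>The effect on the partial sums of an edge received by one of the vertices \<open>1, \<dots>, k\<close>; whether the vertex
  is among the first \<open>j\<close> is decided for decreasing \<open>j\<close>.\<close>

primrec draw_sums :: "nat \<Rightarrow> (nat \<Rightarrow> nat) \<Rightarrow> (nat \<Rightarrow> nat) pmf" where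
  "draw_sums 0 x = return_pmf x"
| "draw_sums (Suc k) x = (if k = 0 then return_pmf (x(1 := Suc (x 1)))
     else bind_pmf (bernoulli_pmf (real (x k) / real (x (Suc k))))
       (\<lambda>b. if b then map_pmf (\<lambda>z. z(Suc k := Suc (x (Suc k)))) (draw_sums k x) else return_pmf (x(Suc k := Suc (x (Suc k))))))"

lemma draw_sums_upd: "k < q \<Longrightarrow> draw_sums k (x(q := c)) = map_pmf (\<lambda>z. z(q := c)) (draw_sums k x)"
proof (induction k)
  case (Suc k)
  have tw: "(z(q := c))(Suc k := v) = (z(Suc k := v))(q := c)" for z :: "nat \<Rightarrow> nat" and v
    using Suc.prems by (auto simp: fun_upd_twist)
  have e: "(x(q := c)) k = x k" "(x(q := c)) (Suc k) = x (Suc k)" "(x(q := c)) (Suc 0) = x (Suc 0)"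
    using Suc.prems by auto
  show ?case
  proof (cases "k = 0")
    case True
    hence "q \<noteq> 1" using Suc.prems by simp
    thus ?thesis using True by (auto simp: fun_eq_iff)
  next
    case False
    have "draw_sums k (x(q := c)) = map_pmf (\<lambda>z. z(q := c)) (draw_sums k x)"
      by (rule Suc.IH) (use Suc.prems in simp)
    hence "draw_sums (Suc k) (x(q := c)) = bind_pmf (bernoulli_pmf (real (x k) / real (x (Suc k))))
       (\<lambda>b. if b then map_pmf (\<lambda>z. (z(q := c))(Suc k := Suc (x (Suc k)))) (draw_sums k x) else return_pmf ((x(q := c))(Suc k := Suc (x (Suc k)))))"
      unfolding draw_sums.simps e using False by (simp add: pmf.map_comp o_def cong: if_cong)
    also have "\<dots> = map_pmf (\<lambda>z. z(q := c)) (draw_sums (Suc k) x)"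
      unfolding tw using False by (simp add: map_bind_pmf pmf.map_comp o_def if_distrib[of "map_pmf _"] cong: if_cong)
    finally show ?thesis .
  qed
qed simp

lemma polya_sums_top: "k \<ge> 1 \<Longrightarrow> x \<in> set_pmf (polya_sums m d k y) \<Longrightarrow> x k = y"
  by (cases k) (auto split: if_splits)

text \<open>Whether an edge to the first \<open>Suc k\<close> vertices goes to the first
  \<open>k\<close> depends on \<open>S\<^sub>k\<close> alone and is a draw of its Polya urn; below
  that, the induction hypothesis applies. The conditional structure thus survives every edge. The
  last assumption keeps the subtraction in \<open>polya_sums\<close> exact, so that one more unit of
  \<open>y\<close> is one more draw.\<close>

lemma polya_sums_draw_sums:
  assumes md: "\<And>k. 1 \<le> k \<Longrightarrow> k < r \<Longrightarrow> m k + d k \<le> m (Suc k)"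
  assumes "1 \<le> k" "k \<le> r" "k > 1 \<Longrightarrow> m (k - 1) + d (k - 1) \<le> y"
  shows "bind_pmf (polya_sums m d k y) (draw_sums k) = polya_sums m d k (Suc y)"
  using assms(2-)
proof (induction k arbitrary: y rule: nat_induct_at_least)
  case base
  show ?case by (simp add: bind_return_pmf)
next
  case (Suc k)
  define i where "i = y - (m k + d k)"
  have y: "y = m k + d k + i" using Suc.prems Suc.hyps by (simp add: i_def)
  define Q where "Q = polya (m k) (d k) i"
  define U where "U = (\<lambda>x::nat \<Rightarrow> nat. x(Suc k := Suc y))"
  have IH: "bind_pmf (polya_sums m d k t) (draw_sums k) = polya_sums m d k (Suc t)" if "t \<in> set_pmf Q" for t
  proof (rule Suc.IH)
    assume "1 < k"
    hence "m (k - 1) + d (k - 1) \<le> m (Suc (k - 1))" using Suc.prems by (intro md) auto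
    also have "\<dots> = m k" using \<open>1 < k\<close> by simp
    also have "m k \<le> t" using that set_pmf_polya unfolding Q_def by fastforce
    finally show "m (k - 1) + d (k - 1) \<le> t" .
  qed (use Suc.prems in auto)
  have "bind_pmf (polya_sums m d (Suc k) y) (draw_sums (Suc k))
     = bind_pmf Q (\<lambda>t. bind_pmf (polya_sums m d k t) (\<lambda>x. draw_sums (Suc k) (x(Suc k := y))))"
    using Suc.hyps by (simp add: Q_def i_def bind_assoc_pmf bind_map_pmf del: draw_sums.simps)
  also have "\<dots> = bind_pmf Q (\<lambda>t. bind_pmf (draw y t) (\<lambda>t'. map_pmf U (polya_sums m d k t')))"
  proof (intro bind_pmf_cong refl)
    fix t assume t: "t \<in> set_pmf Q"
    have "bind_pmf (polya_sums m d k t) (\<lambda>x. draw_sums (Suc k) (x(Suc k := y)))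
      = bind_pmf (polya_sums m d k t) (\<lambda>x. bind_pmf (bernoulli_pmf (real t / real y))
          (\<lambda>b. if b then map_pmf U (draw_sums k x) else return_pmf (U x)))"
    proof (intro bind_pmf_cong refl)
      fix x assume "x \<in> set_pmf (polya_sums m d k t)"
      hence "x k = t" using polya_sums_top Suc.hyps by blast
      thus "draw_sums (Suc k) (x(Suc k := y)) = bind_pmf (bernoulli_pmf (real t / real y))
          (\<lambda>b. if b then map_pmf U (draw_sums k x) else return_pmf (U x))"
        using Suc.hyps by (simp add: draw_sums_upd pmf.map_comp o_def U_def cong: if_cong)
    qed
    also have "\<dots> = bind_pmf (bernoulli_pmf (real t / real y))
          (\<lambda>b. bind_pmf (polya_sums m d k t) (\<lambda>x. if b then map_pmf U (draw_sums k x) else return_pmf (U x)))"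
      by (rule bind_commute_pmf)
    also have "\<dots> = bind_pmf (bernoulli_pmf (real t / real y)) (\<lambda>b. map_pmf U (polya_sums m d k (if b then Suc t else t)))"
    proof (intro bind_pmf_cong refl)
      fix b
      show "bind_pmf (polya_sums m d k t) (\<lambda>x. if b then map_pmf U (draw_sums k x) else return_pmf (U x))
        = map_pmf U (polya_sums m d k (if b then Suc t else t))"
        using IH[OF t] by (cases b) (simp_all add: map_bind_pmf[symmetric] map_pmf_def[symmetric])
    qed
    also have "\<dots> = bind_pmf (draw y t) (\<lambda>t'. map_pmf U (polya_sums m d k t'))"
      by (simp add: draw_def bind_map_pmf)
    finally show "bind_pmf (polya_sums m d k t) (\<lambda>x. draw_sums (Suc k) (x(Suc k := y)))
       = bind_pmf (draw y t) (\<lambda>t'. map_pmf U (polya_sums m d k t'))" .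
  qed
  also have "\<dots> = bind_pmf (polya (m k) (d k) (Suc i)) (\<lambda>t'. map_pmf U (polya_sums m d k t'))"
    unfolding polya_Suc Q_def y[symmetric] bind_assoc_pmf ..
  also have "\<dots> = polya_sums m d (Suc k) (Suc y)"
    using Suc.hyps y by (simp add: U_def)
  finally show ?case .
qed

lemma pmf_of_multiset_add:
  assumes "A \<noteq> {#}"
  shows "pmf_of_multiset (A + B) = bind_pmf (bernoulli_pmf (real (size A) / real (size (A + B))))
    (\<lambda>b. pmf_of_multiset (if b then A else B))"
proof (rule pmf_eqI)
  fix i
  define p where "p = real (size A) / real (size (A + B))"
  have sA: "size A > 0" using assms by (simp add: nonempty_has_size)
  have p: "p \<in> {0..1}" using sA by (simp add: p_def divide_le_eq_1)
  have AB: "A + B \<noteq> {#}" using assms by simp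
  have "pmf (bind_pmf (bernoulli_pmf p) (\<lambda>b. pmf_of_multiset (if b then A else B))) i
     = p * pmf (pmf_of_multiset A) i + (1 - p) * pmf (pmf_of_multiset B) i"
    using p by (simp add: pmf_bind)
  also have "\<dots> = (real (count A i) + real (count B i)) / real (size (A + B))"
  \<comment> \<open>For empty \<open>B\<close> the second branch is an unspecified law, but it has
    probability 0.\<close>
  proof (cases "B = {#}")
    case True
    thus ?thesis using sA assms by (simp add: p_def)
  next
    case False
    hence sB: "size B > 0" by (simp add: nonempty_has_size)
    have "1 - p = real (size B) / real (size (A + B))" using sA by (simp add: p_def field_simps)
    thus ?thesis using sA sB assms False by (simp add: p_def add_divide_distrib)
  qed
  finally show "pmf (pmf_of_multiset (A + B)) i = pmf (bind_pmf (bernoulli_pmf (real (size A) / real (size (A + B))))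
    (\<lambda>b. pmf_of_multiset (if b then A else B))) i"
    using AB by (simp add: p_def)
qed

definition wmset :: "(nat \<Rightarrow> nat) \<Rightarrow> nat set \<Rightarrow> nat multiset" where
  "wmset w V = (\<Sum>k\<in>V. replicate_mset (w k) k)"

lemma size_wmset: "finite V \<Longrightarrow> size (wmset w V) = (\<Sum>k\<in>V. w k)"
  unfolding wmset_def by (induction V rule: finite_induct) auto

lemma set_wmset: "finite V \<Longrightarrow> set_mset (wmset w V) \<subseteq> V"
  unfolding wmset_def by (induction V rule: finite_induct) (auto split: if_splits)

lemma wmset_union: "finite V \<Longrightarrow> finite W \<Longrightarrow> V \<inter> W = {} \<Longrightarrow> wmset w (V \<union> W) = wmset w V + wmset w W"
  unfolding wmset_def by (rule sum.union_disjoint)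

text \<open>What an edge received by vertex \<open>q\<close> does to the first \<open>k\<close>
  partial sums.\<close>

definition bump :: "nat \<Rightarrow> nat \<Rightarrow> (nat \<Rightarrow> nat) \<Rightarrow> nat \<Rightarrow> nat" where
  "bump k q x = (\<lambda>i. if q \<le> i \<and> i \<le> k then Suc (x i) else x i)"

definition psum :: "nat \<Rightarrow> (nat \<Rightarrow> nat) \<Rightarrow> nat \<Rightarrow> nat" where
  "psum r w = (\<lambda>i. if i \<in> {1..r} then \<Sum>j\<in>{1..i}. w j else 0)"

lemma pmf_of_multiset_replicate: "n > 0 \<Longrightarrow> pmf_of_multiset (replicate_mset n x) = return_pmf x"
  by (rule pmf_eqI) (auto simp: indicator_def gr0_conv_Suc)

text \<open>A vertex drawn in proportion to its weight from the first \<open>Suc k\<close> is among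
  the first \<open>k\<close> with probability \<open>x k / x (Suc k)\<close>, and given this it is
  again drawn in proportion to weight.\<close>

lemma map_bump_wmset:
  assumes "1 \<le> k" "\<And>i. i \<in> {1..k} \<Longrightarrow> w i > 0" "\<And>i. i \<in> {1..k} \<Longrightarrow> x i = (\<Sum>j\<in>{1..i}. w j)"
  shows "map_pmf (\<lambda>q. bump k q x) (pmf_of_multiset (wmset w {1..k})) = draw_sums k x"
  using assms
proof (induction k rule: nat_induct_at_least)
  case base
  have "wmset w {1..1} = replicate_mset (w 1) 1" by (simp add: wmset_def)
  moreover have "bump 1 1 x = x(1 := Suc (x 1))" by (auto simp: bump_def fun_eq_iff)
  ultimately show ?case using base by (simp add: pmf_of_multiset_replicate)
next
  case (Suc k)
  have U: "{1..Suc k} = {1..k} \<union> {Suc k}" by auto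
  have M: "wmset w {1..Suc k} = wmset w {1..k} + replicate_mset (w (Suc k)) (Suc k)"
    unfolding U by (subst wmset_union) (auto simp: wmset_def)
  have sz: "size (wmset w {1..k}) = x k" using Suc by (simp add: size_wmset)
  have sz': "size (wmset w {1..Suc k}) = x (Suc k)" using Suc.prems by (simp add: size_wmset del: sum.cl_ivl_Suc)
  have xk: "x k > 0"
  proof -
    have "w 1 \<le> (\<Sum>j\<in>{1..k}. w j)" using Suc.hyps by (intro member_le_sum) auto
    thus ?thesis using Suc.prems(1)[of 1] Suc.prems(2)[of k] Suc.hyps by auto
  qed
  hence ne: "wmset w {1..k} \<noteq> {#}" using sz by auto
  have IH: "map_pmf (\<lambda>q. bump k q x) (pmf_of_multiset (wmset w {1..k})) = draw_sums k x" using Suc by auto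
  have "map_pmf (\<lambda>q. bump (Suc k) q x) (pmf_of_multiset (wmset w {1..Suc k}))
     = bind_pmf (bernoulli_pmf (real (x k) / real (x (Suc k))))
        (\<lambda>b. map_pmf (\<lambda>q. bump (Suc k) q x) (pmf_of_multiset (if b then wmset w {1..k} else replicate_mset (w (Suc k)) (Suc k))))"
    using pmf_of_multiset_add[OF ne, of "replicate_mset (w (Suc k)) (Suc k)"]
    unfolding M[symmetric] sz sz' by (simp add: map_bind_pmf)
  also have "\<dots> = draw_sums (Suc k) x"
  proof -
    have t: "map_pmf (\<lambda>q. bump (Suc k) q x) (pmf_of_multiset (wmset w {1..k})) = map_pmf (\<lambda>z. z(Suc k := Suc (x (Suc k)))) (draw_sums k x)"
      unfolding IH[symmetric] pmf.map_comp o_def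
    proof (rule map_pmf_cong[OF refl])
      fix q assume "q \<in> set_pmf (pmf_of_multiset (wmset w {1..k}))"
      hence "q \<in> {1..k}" using ne set_wmset[of "{1..k}" w] by auto
      thus "bump (Suc k) q x = (bump k q x)(Suc k := Suc (x (Suc k)))" by (auto simp: bump_def fun_eq_iff)
    qed
    have "bump (Suc k) (Suc k) x = x(Suc k := Suc (x (Suc k)))" by (auto simp: bump_def fun_eq_iff)
    hence f: "map_pmf (\<lambda>q. bump (Suc k) q x) (pmf_of_multiset (replicate_mset (w (Suc k)) (Suc k))) = return_pmf (x(Suc k := Suc (x (Suc k))))"
      using Suc.prems by (simp add: pmf_of_multiset_replicate)
    show ?thesis using Suc.hyps t f by (simp add: if_distrib[of pmf_of_multiset] if_distrib[of "map_pmf _"] cong: if_cong)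
  qed
  finally show ?case .
qed

lemma psum_bump:
  assumes "1 \<le> q"
  shows "psum r (w(q := Suc (w q))) = bump r q (psum r w)"
proof
  fix i
  have "(\<Sum>j\<in>{1..i}. (w(q := Suc (w q))) j) = (if q \<le> i then Suc (\<Sum>j\<in>{1..i}. w j) else (\<Sum>j\<in>{1..i}. w j))"
  proof (cases "q \<le> i")
    case True
    have "(\<Sum>j\<in>{1..i}. (w(q := Suc (w q))) j) = Suc (w q) + (\<Sum>j\<in>{1..i} - {q}. (w(q := Suc (w q))) j)"
      using True assms by (subst sum.remove[of _ q]) auto
    also have "(\<Sum>j\<in>{1..i} - {q}. (w(q := Suc (w q))) j) = (\<Sum>j\<in>{1..i} - {q}. w j)" by (intro sum.cong) auto
    also have "Suc (w q) + \<dots> = Suc (\<Sum>j\<in>{1..i}. w j)" using True assms by (subst sum.remove[of "{1..i}" q]) auto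
    finally show ?thesis using True by simp
  next
    case False
    have "(\<Sum>j\<in>{1..i}. (w(q := Suc (w q))) j) = (\<Sum>j\<in>{1..i}. w j)" using False by (intro sum.cong) auto
    thus ?thesis using False by simp
  qed
  thus "psum r (w(q := Suc (w q))) i = bump r q (psum r w) i"
    using assms by (auto simp: psum_def bump_def)
qed

definition pos_total :: "nat \<Rightarrow> nat \<Rightarrow> (nat \<Rightarrow> nat) \<Rightarrow> bool" where
  "pos_total N T w \<longleftrightarrow> (\<forall>k\<in>{1..N}. w k > 0) \<and> (\<Sum>k\<in>{1..N}. w k) = T"

lemma map_psum_attach1:
  assumes g: "pos_total N T w" and r: "1 \<le> r" "r \<le> N"
  shows "map_pmf (psum r) (attach1 {1..N} w) =
    bind_pmf (bernoulli_pmf (real (psum r w r) / real T)) (\<lambda>b. if b then draw_sums r (psum r w) else return_pmf (psum r w))"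
proof -
  define x where "x = psum r w"
  have sz: "size (wmset w {1..r}) = x r" using r by (simp add: size_wmset x_def psum_def)
  have szT: "size (wmset w {1..N}) = T" using g by (simp add: size_wmset pos_total_def)
  have xr: "x r > 0"
  proof -
    have "w 1 \<le> (\<Sum>j\<in>{1..r}. w j)" using r by (intro member_le_sum) auto
    moreover have "w 1 > 0" using g r by (simp add: pos_total_def)
    ultimately show ?thesis using r by (simp add: x_def psum_def)
  qed
  hence ne: "wmset w {1..r} \<noteq> {#}" using sz by auto
  have U: "{1..N} = {1..r} \<union> {Suc r..N}" using r by auto
  have M: "wmset w {1..N} = wmset w {1..r} + wmset w {Suc r..N}"
    unfolding U by (rule wmset_union) auto
  hence neN: "wmset w {1..N} \<noteq> {#}" using ne by simp
  have I: "map_pmf (\<lambda>q. bump r q x) (pmf_of_multiset (wmset w {1..r})) = draw_sums r x"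
    using r g by (intro map_bump_wmset) (auto simp: pos_total_def x_def psum_def)
  have "map_pmf (psum r) (attach1 {1..N} w) = map_pmf (\<lambda>q. bump r q x) (pmf_of_multiset (wmset w {1..N}))"
    unfolding attach1_def wmset_def[symmetric] pmf.map_comp o_def x_def
  proof (rule map_pmf_cong[OF refl])
    fix q assume "q \<in> set_pmf (pmf_of_multiset (wmset w {1..N}))"
    hence "q \<in> {1..N}" using neN set_wmset[of "{1..N}" w] by auto
    thus "psum r (w(q := Suc (w q))) = bump r q (psum r w)" by (intro psum_bump) auto
  qed
  also have "\<dots> = bind_pmf (bernoulli_pmf (real (x r) / real T))
      (\<lambda>b. map_pmf (\<lambda>q. bump r q x) (pmf_of_multiset (if b then wmset w {1..r} else wmset w {Suc r..N})))"
    using pmf_of_multiset_add[OF ne, of "wmset w {Suc r..N}"] unfolding M[symmetric] sz szT by (simp add: map_bind_pmf)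
  also have "\<dots> = bind_pmf (bernoulli_pmf (real (x r) / real T)) (\<lambda>b. if b then draw_sums r x else return_pmf x)"
  proof (intro bind_pmf_cong refl)
    fix b assume b: "b \<in> set_pmf (bernoulli_pmf (real (x r) / real T))"
    show "map_pmf (\<lambda>q. bump r q x) (pmf_of_multiset (if b then wmset w {1..r} else wmset w {Suc r..N}))
       = (if b then draw_sums r x else return_pmf x)"
    proof (cases b)
      case False
      \<comment> \<open>If all weight lay on the first \<open>r\<close> vertices, as in the round
        that creates vertex \<open>r + 1\<close> in Model N, this branch would have probability
        0.\<close>
      have ne': "wmset w {Suc r..N} \<noteq> {#}"
      proof
        assume "wmset w {Suc r..N} = {#}"
        hence "x r = T" using M sz szT by simp
        hence "real (x r) / real T = 1" using xr by simp
        thus False using b False by (simp add: set_pmf_iff)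
      qed
      have "map_pmf (\<lambda>q. bump r q x) (pmf_of_multiset (wmset w {Suc r..N})) = map_pmf (\<lambda>q. x) (pmf_of_multiset (wmset w {Suc r..N}))"
      proof (rule map_pmf_cong[OF refl])
        fix q assume "q \<in> set_pmf (pmf_of_multiset (wmset w {Suc r..N}))"
        hence "q \<in> {Suc r..N}" using ne' set_wmset[of "{Suc r..N}" w] by auto
        thus "bump r q x = x" by (auto simp: bump_def fun_eq_iff)
      qed
      thus ?thesis using False by simp
    qed (use I in simp)
  qed
  finally show ?thesis unfolding x_def .
qed

lemma pos_total_attach1:
  assumes g: "pos_total N T w" and N: "N \<ge> 1" and v: "v \<in> set_pmf (attach1 {1..N} w)"
  shows "pos_total N (Suc T) v"
proof -
  have "w 1 \<le> (\<Sum>j\<in>{1..N}. w j)" using N by (intro member_le_sum) auto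
  moreover have "w 1 > 0" using g N by (simp add: pos_total_def)
  ultimately have "size (wmset w {1..N}) > 0" by (simp add: size_wmset)
  hence ne: "wmset w {1..N} \<noteq> {#}" by auto
  obtain q where q: "v = w(q := Suc (w q))" "q \<in> set_pmf (pmf_of_multiset (wmset w {1..N}))"
    using v unfolding attach1_def wmset_def by auto
  hence qN: "q \<in> {1..N}" using ne set_wmset[of "{1..N}" w] by auto
  have "psum N v = bump N q (psum N w)" unfolding q(1) using qN by (intro psum_bump) auto
  hence "psum N v N = Suc (psum N w N)" using qN by (simp add: bump_def)
  moreover have "\<forall>k\<in>{1..N}. v k > 0" using g unfolding q(1) pos_total_def by simp
  ultimately show ?thesis using g N by (simp add: pos_total_def psum_def)
qed

text \<open>A block of draws within one round: no vertex arrives, so the totals are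
  consecutive.\<close>

primrec drawn :: "nat \<Rightarrow> nat \<Rightarrow> nat pmf \<Rightarrow> nat pmf" where
  "drawn T 0 P = P"
| "drawn T (Suc j) P = drawn (Suc T) j (bind_pmf P (draw T))"

text \<open>Given \<open>S\<^sub>r\<close>, the lower sums follow \<open>polya_sums\<close>, and by
  \<open>polya_sums_draw_sums\<close> edges preserve this. Only the mixing law \<open>p\<close> of
  \<open>S\<^sub>r\<close> evolves, so the graph reduces to a one-dimensional urn.\<close>

lemma map_psum_attach:
  assumes md: "\<And>k. 1 \<le> k \<Longrightarrow> k < r \<Longrightarrow> m k + d k \<le> m (Suc k)"
    and r: "1 \<le> r" "r \<le> N"
    and g: "\<And>w. w \<in> set_pmf \<mu> \<Longrightarrow> pos_total N T w"
    and law: "map_pmf (psum r) \<mu> = bind_pmf p (polya_sums m d r)"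
    and lo: "\<And>y. y \<in> set_pmf p \<Longrightarrow> r > 1 \<Longrightarrow> m (r - 1) + d (r - 1) \<le> y"
  shows "map_pmf (psum r) (bind_pmf \<mu> (attach j {1..N})) = bind_pmf (drawn T j p) (polya_sums m d r)
     \<and> (\<forall>w\<in>set_pmf (bind_pmf \<mu> (attach j {1..N})). pos_total N (T + j) w)"
  using g law lo
proof (induction j arbitrary: \<mu> p T)
  case 0
  have "attach 0 {1..N} = return_pmf" by (rule ext) simp
  thus ?case using 0 by (simp add: bind_return_pmf')
next
  case (Suc j)
  define \<mu>' where "\<mu>' = bind_pmf \<mu> (attach1 {1..N})"
  define p' where "p' = bind_pmf p (draw T)"
  have e: "bind_pmf \<mu> (attach (Suc j) {1..N}) = bind_pmf \<mu>' (attach j {1..N})"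
  proof -
    have "attach (Suc j) {1..N} = (\<lambda>w. bind_pmf (attach1 {1..N} w) (attach j {1..N}))" by (rule ext) simp
    thus ?thesis by (simp add: \<mu>'_def bind_assoc_pmf)
  qed
  define Kern where "Kern x = bind_pmf (bernoulli_pmf (real (x r) / real T)) (\<lambda>b. if b then draw_sums r x else return_pmf x)"
    for x :: "nat \<Rightarrow> nat"
  have "map_pmf (psum r) \<mu>' = bind_pmf \<mu> (\<lambda>w. map_pmf (psum r) (attach1 {1..N} w))"
    by (simp add: \<mu>'_def map_bind_pmf)
  also have "\<dots> = bind_pmf \<mu> (\<lambda>w. Kern (psum r w))"
    unfolding Kern_def using Suc.prems(1) r by (intro bind_pmf_cong refl map_psum_attach1) auto
  also have "\<dots> = bind_pmf (map_pmf (psum r) \<mu>) Kern" by (simp add: bind_map_pmf)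
  also have "\<dots> = bind_pmf p (\<lambda>y. bind_pmf (polya_sums m d r y) Kern)" unfolding Suc.prems(2) bind_assoc_pmf ..
  also have "\<dots> = bind_pmf p (\<lambda>y. bind_pmf (draw T y) (polya_sums m d r))"
  proof (intro bind_pmf_cong refl)
    fix y assume y: "y \<in> set_pmf p"
    have "bind_pmf (polya_sums m d r y) Kern = bind_pmf (polya_sums m d r y)
        (\<lambda>x. bind_pmf (bernoulli_pmf (real y / real T)) (\<lambda>b. if b then draw_sums r x else return_pmf x))"
      unfolding Kern_def using polya_sums_top[OF r(1)] by (intro bind_pmf_cong refl) auto
    also have "\<dots> = bind_pmf (bernoulli_pmf (real y / real T))
        (\<lambda>b. bind_pmf (polya_sums m d r y) (\<lambda>x. if b then draw_sums r x else return_pmf x))"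
      by (rule bind_commute_pmf)
    also have "\<dots> = bind_pmf (bernoulli_pmf (real y / real T)) (\<lambda>b. polya_sums m d r (if b then Suc y else y))"
    proof (intro bind_pmf_cong refl)
      fix b
      have "bind_pmf (polya_sums m d r y) (draw_sums r) = polya_sums m d r (Suc y)"
        using md r Suc.prems(3)[OF y] by (intro polya_sums_draw_sums[where r=r]) auto
      thus "bind_pmf (polya_sums m d r y) (\<lambda>x. if b then draw_sums r x else return_pmf x) = polya_sums m d r (if b then Suc y else y)"
        by (cases b) (simp_all add: bind_return_pmf')
    qed
    also have "\<dots> = bind_pmf (draw T y) (polya_sums m d r)" by (simp add: draw_def bind_map_pmf)
    finally show "bind_pmf (polya_sums m d r y) Kern = bind_pmf (draw T y) (polya_sums m d r)" .
  qed
  finally have law': "map_pmf (psum r) \<mu>' = bind_pmf p' (polya_sums m d r)" by (simp add: p'_def bind_assoc_pmf)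
  have g': "pos_total N (Suc T) w" if "w \<in> set_pmf \<mu>'" for w
    using that Suc.prems(1) r pos_total_attach1[of N T] unfolding \<mu>'_def by auto
  have lo': "m (r - 1) + d (r - 1) \<le> y" if y: "y \<in> set_pmf p'" and r1: "r > 1" for y
  proof -
    obtain z where z: "z \<in> set_pmf p" "y \<in> set_pmf (draw T z)"
      using y unfolding p'_def set_bind_pmf by blast
    have "z \<le> y" using z(2) set_pmf_draw[of T z] by auto
    thus ?thesis using Suc.prems(3)[OF z(1) r1] by linarith
  qed
  show ?case using Suc.IH[OF g' law' lo'] unfolding e by (simp add: p'_def)
qed

lemma draw_full: "T > 0 \<Longrightarrow> draw T T = return_pmf (Suc T)"
  by (rule pmf_eqI) (simp add: pmf_draw indicator_def)

lemma drawn_full: "T > 0 \<Longrightarrow> drawn T j (return_pmf T) = return_pmf (T + j)"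
  by (induction j arbitrary: T) (simp_all add: bind_return_pmf draw_full)

lemma drawn_walk: "(\<And>i. i < j \<Longrightarrow> U (t + i) = T + i) \<Longrightarrow> drawn T j (walk U a t) = walk U a (t + j)"
proof (induction j arbitrary: T t)
  case (Suc j)
  have "bind_pmf (walk U a t) (draw T) = walk U a (Suc t)" using Suc.prems[of 0] by simp
  moreover have "drawn (Suc T) j (walk U a (Suc t)) = walk U a (Suc t + j)"
  proof (rule Suc.IH)
    fix i assume "i < j"
    thus "U (Suc t + i) = Suc T + i" using Suc.prems[of "Suc i"] by simp
  qed
  ultimately show ?case by simp
qed simp

text \<open>The weight of the first \<open>k\<close> vertices at the moment when vertex
  \<open>k + 1\<close> begins to compete with them, which for a seed vertex is time 0.
  \<open>base_weight\<close> is the weight of vertex \<open>k + 1\<close> at that moment.\<close>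

definition base_total :: "model \<Rightarrow> nat \<Rightarrow> nat \<Rightarrow> (nat \<Rightarrow> nat) \<Rightarrow> nat \<Rightarrow> nat" where
  "base_total M l s d k = (if k < s then m_seq d k else a_seq M l s d k)"

definition base_weight :: "nat \<Rightarrow> (nat \<Rightarrow> nat) \<Rightarrow> nat \<Rightarrow> nat" where
  "base_weight s d k = (if k < s then d (k + 1) else 1)"

lemma m_seq_Suc: "m_seq d (Suc k) = m_seq d k + d (Suc k)"
  by (simp add: m_seq_def)

lemma base_total_Suc: "base_total M l s d k + base_weight s d k \<le> base_total M l s d (Suc k)"
proof -
  consider "Suc k < s" | "Suc k = s" | "k \<ge> s" by linarith
  thus ?thesis
    by cases (auto simp: base_total_def base_weight_def m_seq_Suc[symmetric] a_seq_def Suc_diff_le)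
qed

lemma base_total_ge:
  assumes d: "\<And>i. i \<in> {1..s} \<Longrightarrow> d i > 0"
  shows "k \<le> base_total M l s d k"
proof -
  have m: "k \<le> s \<Longrightarrow> k \<le> m_seq d k" for k
  proof (induction k)
    case (Suc k)
    have "d (Suc k) > 0" using Suc.prems by (intro d) auto
    thus ?case using Suc by (simp add: m_seq_Suc)
  qed simp
  show ?thesis
  proof (cases "k < s")
    case False
    have "s + (k - s) \<le> m_seq d s + (l + 1) * (k - s)" using m[of s] by (intro add_mono) auto
    thus ?thesis using False by (simp add: base_total_def a_seq_def)
  qed (use m[of k] in \<open>auto simp: base_total_def\<close>)
qed

lemma psum_upd: "r < q \<Longrightarrow> psum r (w(q := v)) = psum r w"
  by (auto simp: psum_def fun_eq_iff intro!: sum.cong)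

lemma pos_total_upd:
  assumes "pos_total N T w"
  shows "pos_total (Suc N) (Suc T) (w(Suc N := 1))"
proof -
  have "(\<Sum>k\<in>{1..N}. (w(Suc N := 1)) k) = (\<Sum>k\<in>{1..N}. w k)" by (intro sum.cong) auto
  thus ?thesis using assms unfolding pos_total_def by (auto simp: le_Suc_eq)
qed

text \<open>At the seed every Polya kernel makes zero draws.\<close>

lemma polya_sums_initial:
  assumes "1 \<le> k" "k \<le> s"
  shows "polya_sums (base_total M l s d) (base_weight s d) k (m_seq d k) = return_pmf (\<lambda>i. if i \<in> {1..k} then m_seq d i else 0)"
  using assms
proof (induction k rule: nat_induct_at_least)
  case base
  show ?case by (auto simp: fun_eq_iff)
next
  case (Suc k)
  have "base_total M l s d k = m_seq d k" "base_weight s d k = d (Suc k)"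
    using Suc.prems by (auto simp: base_total_def base_weight_def)
  thus ?case using Suc by (auto simp: m_seq_Suc bind_return_pmf fun_eq_iff)
qed

text \<open>The total weight is deterministic, so the new vertex adds a Polya level with zero draws;
  \<open>base_total\<close> refers to exactly this moment in either model.\<close>

lemma new_vertex:
  assumes N: "s \<le> N" "1 \<le> N" and g: "\<And>w. w \<in> set_pmf \<mu> \<Longrightarrow> pos_total N (base_total M l s d N) w"
    and law: "map_pmf (psum N) \<mu> = polya_sums (base_total M l s d) (base_weight s d) N (base_total M l s d N)"
  shows "map_pmf (psum (Suc N)) (map_pmf (\<lambda>w. w(Suc N := 1)) \<mu>)
    = polya_sums (base_total M l s d) (base_weight s d) (Suc N) (Suc (base_total M l s d N))"
proof -
  have "map_pmf (psum (Suc N)) (map_pmf (\<lambda>w. w(Suc N := 1)) \<mu>)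
    = map_pmf (\<lambda>w. (psum N w)(Suc N := Suc (base_total M l s d N))) \<mu>"
    unfolding pmf.map_comp o_def
  proof (rule map_pmf_cong[OF refl], rule ext)
    fix w i assume "w \<in> set_pmf \<mu>"
    hence gw: "(\<Sum>k\<in>{1..N}. w k) = base_total M l s d N" using g by (auto simp: pos_total_def)
    have e: "(\<Sum>j\<in>{1..i}. (w(Suc N := 1)) j) = (\<Sum>j\<in>{1..i}. w j)" if "i \<le> N" for i
      using that by (intro sum.cong) auto
    show "psum (Suc N) (w(Suc N := 1)) i = ((psum N w)(Suc N := Suc (base_total M l s d N))) i"
    proof (cases "i = Suc N")
      case True
      have "(\<Sum>j\<in>{1..Suc N}. (w(Suc N := 1)) j) = Suc (\<Sum>j\<in>{1..N}. (w(Suc N := 1)) j)" by simp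
      thus ?thesis using True e[of N] gw by (simp add: psum_def del: sum.cl_ivl_Suc)
    qed (use e in \<open>auto simp: psum_def\<close>)
  qed
  also have "\<dots> = map_pmf (\<lambda>x. x(Suc N := Suc (base_total M l s d N))) (map_pmf (psum N) \<mu>)"
    by (simp add: pmf.map_comp o_def)
  also have "\<dots> = polya_sums (base_total M l s d) (base_weight s d) (Suc N) (Suc (base_total M l s d N))"
    unfolding law using N by (simp add: base_weight_def bind_return_pmf)
  finally show ?thesis .
qed

lemma bind_step_L: "bind_pmf \<mu> (step Model_L l s (Suc n))
    = bind_pmf (map_pmf (\<lambda>w. w(Suc (s + n) := 1)) \<mu>) (attach l {1..Suc (s + n)})"
proof -
  have "step Model_L l s (Suc n) = (\<lambda>w. attach l {1..Suc (s + n)} (w(Suc (s + n) := 1)))" by (rule ext) simp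
  thus ?thesis by (simp add: bind_map_pmf)
qed

lemma bind_step_N: "bind_pmf \<mu> (step Model_N l s (Suc n))
    = map_pmf (\<lambda>w. w(Suc (s + n) := 1)) (bind_pmf \<mu> (attach l {1..s + n}))"
proof -
  have "step Model_N l s (Suc n) = (\<lambda>w. map_pmf (\<lambda>w. w(Suc (s + n) := 1)) (attach l {1..s + n} w))" by (rule ext) simp
  thus ?thesis by (simp add: map_bind_pmf)
qed

context
  fixes M :: model and l s :: nat and d :: "nat \<Rightarrow> nat"
  assumes l: "l \<ge> 1" and s: "s \<ge> 1" and d: "\<And>i. i \<in> {1..s} \<Longrightarrow> d i > 0"
begin

private abbreviation "mm \<equiv> base_total M l s d"
private abbreviation "dd \<equiv> base_weight s d"

lemma base_prev_le:
  assumes "s + n > 1"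
  shows "mm (s + n - 1) + dd (s + n - 1) \<le> m_seq d s + (l + 1) * n"
proof (cases n)
  case 0
  have "m_seq d s = m_seq d (s - 1) + d s" using s m_seq_Suc[of d "s - 1"] by simp
  thus ?thesis using 0 s by (simp add: base_total_def base_weight_def)
qed (auto simp: base_total_def base_weight_def a_seq_def)

text \<open>With all existing vertices included, the top sum is the deterministic total and there is
  no immigration. This is the state from which \<open>weights_law_L\<close> and
  \<open>weights_law_N\<close> start.\<close>

lemma weights_full:
  "map_pmf (psum (s + n)) (weights M l s d n) = polya_sums mm dd (s + n) (m_seq d s + (l + 1) * n)
   \<and> (\<forall>w\<in>set_pmf (weights M l s d n). pos_total (s + n) (m_seq d s + (l + 1) * n) w)"
proof (induction n)
  case 0
  define w0 where "w0 = (\<lambda>k. if k \<in> {1..s} then d k else 0)"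
  have e: "(\<Sum>j\<in>{1..i}. w0 j) = m_seq d i" if "i \<le> s" for i
    unfolding m_seq_def w0_def using that by (intro sum.cong) auto
  have "psum s w0 = (\<lambda>i. if i \<in> {1..s} then m_seq d i else 0)" using e by (auto simp: psum_def fun_eq_iff)
  moreover have "pos_total s (m_seq d s) w0" using e[of s] d by (auto simp: pos_total_def w0_def)
  moreover have "weights M l s d 0 = return_pmf w0" by (simp add: w0_def)
  ultimately show ?case using polya_sums_initial[OF s order_refl, of M l d] by (simp del: weights.simps polya_sums.simps)
next
  case (Suc n)
  define N where "N = s + n"
  define T where "T = m_seq d s + (l + 1) * n"
  define \<mu> where "\<mu> = weights M l s d n"
  define U where "U = (\<lambda>w::nat \<Rightarrow> nat. w(Suc N := 1))"
  have N: "s \<le> N" "1 \<le> N" using s by (auto simp: N_def)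
  have law: "map_pmf (psum N) \<mu> = polya_sums mm dd N T" and g: "\<And>w. w \<in> set_pmf \<mu> \<Longrightarrow> pos_total N T w"
    using Suc by (auto simp: N_def T_def \<mu>_def)
  have T0: "T > 0" using base_total_ge[where k=s and d=d and s=s and M=Model_L and l=0, OF d] s
    by (simp add: T_def base_total_def a_seq_def)
  have "map_pmf (psum (Suc N)) (weights M l s d (Suc n)) = polya_sums mm dd (Suc N) (T + l + 1)
   \<and> (\<forall>w\<in>set_pmf (weights M l s d (Suc n)). pos_total (Suc N) (T + l + 1) w)"
  proof (cases M)
    case Model_L
    have mN: "mm N = T" using N by (simp add: base_total_def a_seq_def Model_L T_def N_def)
    have W: "weights M l s d (Suc n) = bind_pmf (map_pmf U \<mu>) (attach l {1..Suc N})"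
      unfolding weights.simps U_def N_def \<mu>_def using bind_step_L Model_L by simp
    have 1: "map_pmf (psum (Suc N)) (map_pmf U \<mu>) = polya_sums mm dd (Suc N) (Suc T)"
      unfolding U_def using new_vertex[OF N, of \<mu> M l d] law g unfolding mN by simp
    have 2: "pos_total (Suc N) (Suc T) w" if "w \<in> set_pmf (map_pmf U \<mu>)" for w
      using that g unfolding U_def set_map_pmf by (blast intro: pos_total_upd)
    have "map_pmf (psum (Suc N)) (bind_pmf (map_pmf U \<mu>) (attach l {1..Suc N}))
        = bind_pmf (drawn (Suc T) l (return_pmf (Suc T))) (polya_sums mm dd (Suc N))
      \<and> (\<forall>w\<in>set_pmf (bind_pmf (map_pmf U \<mu>) (attach l {1..Suc N})). pos_total (Suc N) (Suc T + l) w)"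
    proof (rule map_psum_attach)
      show "map_pmf (psum (Suc N)) (map_pmf U \<mu>) = bind_pmf (return_pmf (Suc T)) (polya_sums mm dd (Suc N))"
        using 1 by (simp add: bind_return_pmf del: polya_sums.simps)
      show "mm (Suc N - 1) + dd (Suc N - 1) \<le> y" if "y \<in> set_pmf (return_pmf (Suc T))" for y
        using that mN N by (simp add: base_weight_def)
    qed (use 2 base_total_Suc in auto)
    thus ?thesis unfolding W drawn_full[OF zero_less_Suc] by (simp add: bind_return_pmf del: polya_sums.simps)
  next
    case Model_N
    have mN: "mm N = T + l" using N by (simp add: base_total_def a_seq_def Model_N T_def N_def)
    have W: "weights M l s d (Suc n) = map_pmf U (bind_pmf \<mu> (attach l {1..N}))"
      unfolding weights.simps U_def N_def \<mu>_def using bind_step_N Model_N by simp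
    define \<nu> where "\<nu> = bind_pmf \<mu> (attach l {1..N})"
    have "map_pmf (psum N) \<nu> = bind_pmf (drawn T l (return_pmf T)) (polya_sums mm dd N)
      \<and> (\<forall>w\<in>set_pmf \<nu>. pos_total N (T + l) w)"
      unfolding \<nu>_def
    proof (rule map_psum_attach)
      show "map_pmf (psum N) \<mu> = bind_pmf (return_pmf T) (polya_sums mm dd N)"
        using law by (simp add: bind_return_pmf)
      show "mm (N - 1) + dd (N - 1) \<le> y" if "y \<in> set_pmf (return_pmf T)" "N > 1" for y
        using that base_prev_le[of n] by (simp add: N_def T_def)
    qed (use g N base_total_Suc in auto)
    hence 1: "map_pmf (psum N) \<nu> = polya_sums mm dd N (mm N)" "\<And>w. w \<in> set_pmf \<nu> \<Longrightarrow> pos_total N (mm N) w"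
      unfolding mN drawn_full[OF T0] by (auto simp: bind_return_pmf)
    have "map_pmf (psum (Suc N)) (map_pmf U \<nu>) = polya_sums mm dd (Suc N) (Suc (mm N))"
      unfolding U_def by (rule new_vertex[OF N 1(2,1)])
    moreover have "\<forall>w\<in>set_pmf (map_pmf U \<nu>). pos_total (Suc N) (Suc (mm N)) w"
      using 1(2) unfolding U_def set_map_pmf by (blast intro: pos_total_upd)
    ultimately show ?thesis unfolding W \<nu>_def[symmetric] mN by (simp del: polya_sums.simps)
  qed
  thus ?case by (simp add: N_def T_def algebra_simps del: polya_sums.simps weights.simps)
qed

lemma drawn_urn: "drawn (a + 1 + (l + 1) * k) l (walk (urn_total l a) a (l * k)) = walk (urn_total l a) a (l * Suc k)"
proof -
  have "drawn (a + 1 + (l + 1) * k) l (walk (urn_total l a) a (l * k)) = walk (urn_total l a) a (l * k + l)"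
  proof (rule drawn_walk)
    fix i assume "i < l"
    hence "(l * k + i) div l = k" by simp
    thus "urn_total l a (l * k + i) = a + 1 + (l + 1) * k + i" by (simp add: urn_total_def)
  qed
  thus ?thesis by (simp add: add.commute)
qed

lemma walk_urn_ge: "y \<in> set_pmf (walk (urn_total l (mm r)) (mm r) t) \<Longrightarrow> r > 1 \<Longrightarrow> mm (r - 1) + dd (r - 1) \<le> y"
  using set_pmf_walk[of "urn_total l (mm r)" "mm r" t] base_total_Suc[of M l s d "r - 1"] by fastforce

text \<open>At time \<open>r - s\<close> the first \<open>r\<close> weights add up to
  \<open>a_r\<close>. Each later round brings an immigrant of weight 1 and then \<open>l\<close>
  draws, as in \<open>urn_total\<close>.\<close>

lemma weights_law_L:
  assumes r: "r \<ge> s" and M: "M = Model_L"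
  shows "map_pmf (psum r) (weights M l s d (r - s + k)) = bind_pmf (walk (urn_total l (mm r)) (mm r) (l * k)) (polya_sums mm dd r)
    \<and> (\<forall>w\<in>set_pmf (weights M l s d (r - s + k)). pos_total (r + k) (mm r + (l + 1) * k) w)"
proof (induction k)
  case 0
  have "mm r = m_seq d s + (l + 1) * (r - s)" using r by (simp add: base_total_def a_seq_def M)
  thus ?case using weights_full[of "r - s"] r by (simp add: bind_return_pmf)
next
  case (Suc k)
  define N where "N = r + k"
  define \<mu> where "\<mu> = weights M l s d (r - s + k)"
  define U where "U = (\<lambda>w::nat \<Rightarrow> nat. w(Suc N := 1))"
  define T where "T = mm r + (l + 1) * k"
  have g: "\<And>w. w \<in> set_pmf \<mu> \<Longrightarrow> pos_total N T w" using Suc by (auto simp: \<mu>_def N_def T_def)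
  have n: "s + (r - s + k) = N" using r by (simp add: N_def)
  have W: "weights M l s d (r - s + Suc k) = bind_pmf (map_pmf U \<mu>) (attach l {1..Suc N})"
    using bind_step_L[of \<mu> l s "r - s + k"] unfolding n by (simp add: U_def \<mu>_def M)
  have "map_pmf (psum r) (bind_pmf (map_pmf U \<mu>) (attach l {1..Suc N}))
        = bind_pmf (drawn (Suc T) l (walk (urn_total l (mm r)) (mm r) (l * k))) (polya_sums mm dd r)
      \<and> (\<forall>w\<in>set_pmf (bind_pmf (map_pmf U \<mu>) (attach l {1..Suc N})). pos_total (Suc N) (Suc T + l) w)"
  proof (rule map_psum_attach)
    have "map_pmf (psum r) (map_pmf U \<mu>) = map_pmf (psum r) \<mu>"
      by (simp add: pmf.map_comp o_def U_def psum_upd N_def)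
    thus "map_pmf (psum r) (map_pmf U \<mu>) = bind_pmf (walk (urn_total l (mm r)) (mm r) (l * k)) (polya_sums mm dd r)"
      using Suc by (simp add: \<mu>_def)
    show "pos_total (Suc N) (Suc T) w" if "w \<in> set_pmf (map_pmf U \<mu>)" for w
      using that g unfolding U_def set_map_pmf by (blast intro: pos_total_upd)
  qed (use r s base_total_Suc walk_urn_ge in \<open>auto simp: N_def\<close>)
  moreover have "Suc T = mm r + 1 + (l + 1) * k" by (simp add: T_def)
  ultimately show ?case unfolding W
    using drawn_urn[of "mm r" k] by (simp add: N_def T_def algebra_simps)
qed

text \<open>The clock starts one round later: in the round that creates vertex \<open>r + 1\<close>,
  all \<open>l\<close> edges still go to the first \<open>r\<close> vertices and raise their sum
  deterministically to \<open>a_r\<close>.\<close>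

lemma weights_law_N:
  assumes r: "r \<ge> s" and M: "M = Model_N"
  shows "map_pmf (psum r) (weights M l s d (r - s + Suc k)) = bind_pmf (walk (urn_total l (mm r)) (mm r) (l * k)) (polya_sums mm dd r)
    \<and> (\<forall>w\<in>set_pmf (weights M l s d (r - s + Suc k)). pos_total (r + Suc k) (mm r + 1 + (l + 1) * k) w)"
proof (induction k)
  case 0
  define T where "T = m_seq d s + (l + 1) * (r - s)"
  define \<mu> where "\<mu> = weights M l s d (r - s)"
  define U where "U = (\<lambda>w::nat \<Rightarrow> nat. w(Suc r := 1))"
  have mr: "mm r = T + l" using r by (simp add: base_total_def a_seq_def M T_def)
  have T0: "T > 0" using base_total_ge[where k=s and d=d and s=s and M=Model_L and l=0, OF d] s
    by (simp add: T_def base_total_def a_seq_def)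
  have law: "map_pmf (psum r) \<mu> = polya_sums mm dd r T" and g: "\<And>w. w \<in> set_pmf \<mu> \<Longrightarrow> pos_total r T w"
    using weights_full[of "r - s"] r by (auto simp: T_def \<mu>_def)
  have n: "s + (r - s) = r" using r by simp
  have W: "weights M l s d (r - s + Suc 0) = map_pmf U (bind_pmf \<mu> (attach l {1..r}))"
    using bind_step_N[of \<mu> l s "r - s"] unfolding n by (simp add: U_def \<mu>_def M)
  have "map_pmf (psum r) (bind_pmf \<mu> (attach l {1..r})) = bind_pmf (drawn T l (return_pmf T)) (polya_sums mm dd r)
      \<and> (\<forall>w\<in>set_pmf (bind_pmf \<mu> (attach l {1..r})). pos_total r (T + l) w)"
  proof (rule map_psum_attach)
    show "map_pmf (psum r) \<mu> = bind_pmf (return_pmf T) (polya_sums mm dd r)" using law by (simp add: bind_return_pmf)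
    show "mm (r - 1) + dd (r - 1) \<le> y" if "y \<in> set_pmf (return_pmf T)" "r > 1" for y
      using that base_prev_le[of "r - s"] r by (simp add: T_def)
  qed (use g r s base_total_Suc in auto)
  hence 1: "map_pmf (psum r) (bind_pmf \<mu> (attach l {1..r})) = polya_sums mm dd r (mm r)"
    "\<And>w. w \<in> set_pmf (bind_pmf \<mu> (attach l {1..r})) \<Longrightarrow> pos_total r (mm r) w"
    unfolding drawn_full[OF T0] mr by (auto simp: bind_return_pmf)
  have "map_pmf (psum r) (map_pmf U (bind_pmf \<mu> (attach l {1..r}))) = polya_sums mm dd r (mm r)"
    unfolding 1(1)[symmetric] by (simp only: pmf.map_comp o_def U_def psum_upd lessI)
  moreover have "\<forall>w\<in>set_pmf (map_pmf U (bind_pmf \<mu> (attach l {1..r}))). pos_total (Suc r) (Suc (mm r)) w"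
    using 1(2) unfolding U_def set_map_pmf by (blast intro: pos_total_upd)
  ultimately show ?case unfolding W by (simp add: bind_return_pmf)
next
  case (Suc k)
  define N where "N = r + Suc k"
  define \<mu> where "\<mu> = weights M l s d (r - s + Suc k)"
  define U where "U = (\<lambda>w::nat \<Rightarrow> nat. w(Suc N := 1))"
  define T where "T = mm r + 1 + (l + 1) * k"
  have g: "\<And>w. w \<in> set_pmf \<mu> \<Longrightarrow> pos_total N T w" and law: "map_pmf (psum r) \<mu> = bind_pmf (walk (urn_total l (mm r)) (mm r) (l * k)) (polya_sums mm dd r)"
    using Suc unfolding \<mu>_def N_def T_def by blast+
  have n: "s + (r - s + Suc k) = N" using r by (simp add: N_def)
  have W: "weights M l s d (r - s + Suc (Suc k)) = map_pmf U (bind_pmf \<mu> (attach l {1..N}))"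
    using bind_step_N[of \<mu> l s "r - s + Suc k"] unfolding n
    unfolding U_def \<mu>_def M add_Suc_right weights.simps .
  have *: "map_pmf (psum r) (bind_pmf \<mu> (attach l {1..N}))
        = bind_pmf (drawn T l (walk (urn_total l (mm r)) (mm r) (l * k))) (polya_sums mm dd r)
      \<and> (\<forall>w\<in>set_pmf (bind_pmf \<mu> (attach l {1..N})). pos_total N (T + l) w)"
    by (rule map_psum_attach[OF _ _ _ g law]) (use r s base_total_Suc walk_urn_ge in \<open>auto simp: N_def\<close>)
  have "map_pmf (psum r) (map_pmf U (bind_pmf \<mu> (attach l {1..N}))) = map_pmf (psum r) (bind_pmf \<mu> (attach l {1..N}))"
  proof -
    have "psum r (U w) = psum r w" for w unfolding U_def by (rule psum_upd) (simp add: N_def)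
    thus ?thesis by (simp only: pmf.map_comp o_def)
  qed
  moreover have "\<forall>w\<in>set_pmf (map_pmf U (bind_pmf \<mu> (attach l {1..N}))). pos_total (Suc N) (Suc (T + l)) w"
    using * unfolding U_def set_map_pmf by (blast intro: pos_total_upd)
  moreover have "drawn T l (walk (urn_total l (mm r)) (mm r) (l * k)) = walk (urn_total l (mm r)) (mm r) (l * Suc k)"
    unfolding T_def by (rule drawn_urn)
  moreover have "Suc (T + l) = mm r + 1 + (l + 1) * Suc k" "Suc N = r + Suc (Suc k)" by (simp_all add: T_def N_def)
  ultimately show ?case unfolding W using * by simp
qed

lemma weights_law:
  assumes r: "r \<ge> s"
  shows "\<exists>c. \<forall>k. map_pmf (psum r) (weights M l s d (Suc k + c))
     = bind_pmf (walk (urn_total l (mm r)) (mm r) (l * Suc k)) (polya_sums mm dd r)"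
proof (cases M)
  case Model_L
  have "map_pmf (psum r) (weights M l s d (Suc k + (r - s)))
     = bind_pmf (walk (urn_total l (mm r)) (mm r) (l * Suc k)) (polya_sums mm dd r)" for k
    using weights_law_L[OF r Model_L, of "Suc k"] by (simp only: add.commute[of "Suc k"])
  thus ?thesis by blast
next
  case Model_N
  have "map_pmf (psum r) (weights M l s d (Suc k + (r - s + 1)))
     = bind_pmf (walk (urn_total l (mm r)) (mm r) (l * Suc k)) (polya_sums mm dd r)" for k
  proof -
    have "Suc k + (r - s + 1) = r - s + Suc (Suc k)" by simp
    thus ?thesis using weights_law_N[OF r Model_N, of "Suc k"] by (simp only:)
  qed
  thus ?thesis by blast
qed

end

section \<open>The rate of convergence\<close>

text \<open>The totals satisfy \<open>T \<le> (t + \<kappa>) / \<beta>\<close>, so each factor is at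
  most \<open>((t + \<kappa>) / (t + 1 + \<kappa>)) powr \<beta>\<close> and the product
  telescopes.\<close>

lemma urn_inverse_decay:
  fixes l a c :: nat
  assumes l: "l \<ge> 1"
  shows "\<exists>C>0. \<forall>k. (\<Prod>t<l * Suc k. 1 - 1 / real (urn_total l a t)) \<le> C / real (Suc k + c) powr (real l / (real l + 1))"
proof -
  define \<beta> where "\<beta> = real l / (real l + 1)"
  \<comment> \<open>Makes \<open>a + 1 + t + t / l\<close> equal to
    \<open>(t + \<kappa>) / \<beta>\<close>.\<close>
  define \<kappa> where "\<kappa> = (real a + 1) * \<beta>"
  have \<beta>: "\<beta> > 0" using l by (simp add: \<beta>_def)
  have \<kappa>: "\<kappa> > 0" using \<beta> by (simp add: \<kappa>_def)
  have le: "(\<Prod>q<t. 1 - 1 / real (urn_total l a q)) \<le> (\<kappa> / (real t + \<kappa>)) powr \<beta>" for t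
  proof (induction t)
    case (Suc t)
    define T where "T = real (urn_total l a t)"
    define h where "h = 1 / (real t + \<kappa>)"
    have h: "h > 0" using \<kappa> by (simp add: h_def add_nonneg_pos)
    have T: "T \<ge> 1" by (simp add: T_def urn_total_def)
    have "real (t div l) \<le> real t / real l" by (rule of_nat_div_le_of_nat)
    hence "T \<le> real a + 1 + real t + real t / real l" by (simp add: T_def urn_total_def)
    also have "\<dots> = (real t + \<kappa>) / \<beta>"
    proof -
      have "1 / \<beta> = 1 + 1 / real l" using l by (simp add: \<beta>_def field_simps)
      moreover have "(real t + \<kappa>) / \<beta> = real t * (1 / \<beta>) + (real a + 1)"
        using \<beta> by (simp add: \<kappa>_def add_divide_distrib)
      ultimately show ?thesis by (simp add: distrib_left)
    qed
    finally have "\<beta> * T \<le> real t + \<kappa>" using \<beta> by (simp add: field_simps)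
    hence "\<beta> * h \<le> 1 / T" using T \<kappa> unfolding h_def by (simp add: field_simps add_nonneg_pos)
    hence "1 - 1 / T \<le> 1 - \<beta> * h" by simp
    also have "\<dots> \<le> exp (- (\<beta> * h))" using exp_ge_add_one_self[of "- (\<beta> * h)"] by simp
    also have "\<dots> \<le> (1 + h) powr (- \<beta>)"
    proof -
      have "ln (1 + h) \<le> h" using h by (intro ln_add_one_self_le_self) auto
      hence "\<beta> * ln (1 + h) \<le> \<beta> * h" using \<beta> by (intro mult_left_mono) auto
      thus ?thesis using h by (simp add: powr_def)
    qed
    also have "\<dots> = ((real t + \<kappa>) / (real (Suc t) + \<kappa>)) powr \<beta>"
    proof -
      have "1 + h = (real (Suc t) + \<kappa>) / (real t + \<kappa>)" using \<kappa> by (simp add: h_def field_simps add_nonneg_pos)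
      hence "inverse (1 + h) = (real t + \<kappa>) / (real (Suc t) + \<kappa>)" by simp
      moreover have "inverse (1 + h) powr \<beta> = inverse ((1 + h) powr \<beta>)" by (rule inverse_powr)
      ultimately show ?thesis by (simp only: powr_minus)
    qed
    finally have step: "1 - 1 / T \<le> ((real t + \<kappa>) / (real (Suc t) + \<kappa>)) powr \<beta>" .
    have "(\<Prod>q<Suc t. 1 - 1 / real (urn_total l a q)) \<le> (\<kappa> / (real t + \<kappa>)) powr \<beta> * ((real t + \<kappa>) / (real (Suc t) + \<kappa>)) powr \<beta>"
      unfolding prod.lessThan_Suc using Suc step T unfolding T_def by (intro mult_mono) auto
    also have "\<dots> = (\<kappa> / (real t + \<kappa>) * ((real t + \<kappa>) / (real (Suc t) + \<kappa>))) powr \<beta>"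
      using \<kappa> by (subst powr_mult) auto
    also have "\<kappa> / (real t + \<kappa>) * ((real t + \<kappa>) / (real (Suc t) + \<kappa>)) = \<kappa> / (real (Suc t) + \<kappa>)"
      using \<kappa> by (simp add: add_nonneg_pos less_imp_neq[symmetric])
    finally show ?case .
  qed (use \<kappa> in simp)
  have "(\<Prod>t<l * Suc k. 1 - 1 / real (urn_total l a t)) \<le> (\<kappa> * (1 + real c)) powr \<beta> / real (Suc k + c) powr \<beta>" for k
  proof -
    have "1 * Suc k \<le> l * Suc k" using l by (rule mult_le_mono1)
    hence "real (1 * Suc k) \<le> real (l * Suc k)" by (rule of_nat_mono)
    hence "real (Suc k) \<le> real (l * Suc k) + \<kappa>" using \<kappa> unfolding nat_mult_1 by linarith
    hence "real (Suc k) * (1 + real c) \<le> (real (l * Suc k) + \<kappa>) * (1 + real c)" by (rule mult_right_mono) simp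
    moreover have "real (Suc k + c) \<le> real (Suc k) * (1 + real c)" by (simp add: algebra_simps)
    ultimately have "real (Suc k + c) \<le> (real (l * Suc k) + \<kappa>) * (1 + real c)" by linarith
    hence "\<kappa> * (1 + real c) / ((real (l * Suc k) + \<kappa>) * (1 + real c)) \<le> \<kappa> * (1 + real c) / real (Suc k + c)"
      using \<kappa> by (intro frac_le) auto
    hence "\<kappa> / (real (l * Suc k) + \<kappa>) \<le> \<kappa> * (1 + real c) / real (Suc k + c)" by simp
    hence "(\<kappa> / (real (l * Suc k) + \<kappa>)) powr \<beta> \<le> (\<kappa> * (1 + real c) / real (Suc k + c)) powr \<beta>"
      using \<kappa> \<beta> by (intro powr_mono2) auto
    also have "\<dots> = (\<kappa> * (1 + real c)) powr \<beta> / real (Suc k + c) powr \<beta>"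
      by (rule powr_divide)
    finally show ?thesis using le[of "l * Suc k"] by linarith
  qed
  thus ?thesis using \<kappa> unfolding \<beta>_def by (intro exI[of _ "(\<kappa> * (1 + real c)) powr (real l / (real l + 1))"]) auto
qed

text \<open>Reads only the coordinates in \<open>{1..r}\<close>, so that preimages are cylinders;
  the case \<open>i = 1\<close> is separate to avoid \<open>z 0\<close>.\<close>

definition increments :: "nat \<Rightarrow> (nat \<Rightarrow> real) \<Rightarrow> nat \<Rightarrow> real" where
  "increments r z = (\<lambda>i. if i \<in> {1..r} then z i - (if i = 1 then 0 else z (i - 1)) else 0)"

definition cumsum :: "nat \<Rightarrow> (nat \<Rightarrow> real) \<Rightarrow> nat \<Rightarrow> real" where
  "cumsum r y = (\<lambda>i. if i \<in> {1..r} then \<Sum>j\<in>{1..i}. y j else 0)"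

lemma increments_cumsum: "y \<in> Rvec r \<Longrightarrow> increments r (cumsum r y) = y"
proof
  fix i assume y: "y \<in> Rvec r"
  show "increments r (cumsum r y) i = y i"
  proof (cases "i \<in> {1..r}")
    case True
    then obtain j where "i = Suc j" by (cases i) auto
    thus ?thesis using True by (cases "j = 0") (auto simp: increments_def cumsum_def)
  qed (use y in \<open>auto simp: Rvec_def increments_def\<close>)
qed

lemma increments_in_Rvec: "increments r z \<in> Rvec r"
  by (auto simp: increments_def Rvec_def)

lemma cumsum_increments:
  assumes "i \<in> {1..r}"
  shows "cumsum r (increments r z) i = z i"
proof -
  have "i \<le> r \<Longrightarrow> i \<ge> 1 \<Longrightarrow> (\<Sum>j\<in>{1..i}. increments r z j) = z i" for i
  proof (induction i)
    case (Suc i)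
    thus ?case by (cases "i = 0") (auto simp: increments_def)
  qed simp
  thus ?thesis using assms by (simp add: cumsum_def)
qed

lemma measurable_cumsum: "cumsum r \<in> measurable borel borel"
proof (rule measurable_coordinatewise_then_product)
  fix i
  have "continuous_on UNIV (\<lambda>y. cumsum r y i)"
    by (cases "i \<in> {1..r}") (auto simp: cumsum_def intro!: continuous_intros)
  thus "(\<lambda>y. cumsum r y i) \<in> borel_measurable borel" by (rule borel_measurable_continuous_onI)
qed

lemma measurable_increments: "increments r \<in> measurable borel borel"
proof (rule measurable_coordinatewise_then_product)
  fix i
  have "continuous_on UNIV (\<lambda>y. increments r y i)"
    by (cases "i \<in> {1..r}"; cases "i = 1") (auto simp: increments_def intro!: continuous_intros)
  thus "(\<lambda>y. increments r y i) \<in> borel_measurable borel" by (rule borel_measurable_continuous_onI)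
qed

lemma Rvec_borel: "Rvec r \<in> sets borel"
proof -
  have "closed (\<Inter>i\<in>- {1..r}. {x::nat \<Rightarrow> real. x i = 0})"
    by (intro closed_INT ballI closed_Collect_eq continuous_intros)
  moreover have "(\<Inter>i\<in>- {1..r}. {x::nat \<Rightarrow> real. x i = 0}) = Rvec r" by (auto simp: Rvec_def)
  ultimately show ?thesis by simp
qed

lemma cvx_increments_vimage:
  assumes K: "convex_in r K"
  shows "cvx {z. increments r z \<in> K}"
  unfolding cvx_def
proof (intro ballI allI impI, unfold mem_Collect_eq)
  fix x y u assume "increments r x \<in> K" "increments r y \<in> K" "0 \<le> u" "u \<le> (1::real)"
  hence "(\<lambda>i. u * increments r x i + (1 - u) * increments r y i) \<in> K"
    using K unfolding convex_in_def by blast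
  moreover have "(\<lambda>i. u * increments r x i + (1 - u) * increments r y i) = increments r (\<lambda>i. u * x i + (1 - u) * y i)"
    by (auto simp: increments_def fun_eq_iff algebra_simps)
  ultimately show "increments r (\<lambda>i. u * x i + (1 - u) * y i) \<in> K" by simp
qed

lemma depends_on_increments_vimage: "depends_on {1..r} {z. increments r z \<in> K}"
  unfolding depends_on_def
proof (intro allI impI, unfold mem_Collect_eq)
  fix x y assume eq: "\<forall>i\<in>{1..r}. x i = y i" and x: "increments r x \<in> K"
  have "increments r x = increments r y"
  proof
    fix i
    show "increments r x i = increments r y i"
    proof (cases "i \<in> {1..r} \<and> i \<noteq> 1")
      case True
      hence "i - 1 \<in> {1..r}" by auto
      thus ?thesis using True eq by (simp add: increments_def)
    qed (use eq in \<open>auto simp: increments_def\<close>)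
  qed
  thus "increments r y \<in> K" using x by simp
qed

lemma finite_density_prop:
  assumes "finite_density h" "\<And>x. x \<le> 0 \<Longrightarrow> h x = 0"
  shows "prob_space (prop_density h)" "sets (prop_density h) = sets borel"
    "emeasure (prop_density h) {x} = 0" "AE x in prop_density h. x > 0"
  using finite_density.prob_space_prop_density[OF assms(1)] finite_density.sets_prop_density[OF assms(1)]
    finite_density.emeasure_prop_density_singleton[OF assms(1)] finite_density.AE_prop_density_pos[OF assms] by auto

lemma beta_distr_props:
  assumes "m \<ge> 1" "d \<ge> 1"
  shows "prob_space (beta_distr (real m) (real d))" "sets (beta_distr (real m) (real d)) = sets borel"
    "emeasure (beta_distr (real m) (real d)) {x} = 0" "AE x in beta_distr (real m) (real d). x > 0"
proof -
  have e: "beta_distr (real m) (real d) = prop_density (beta_dens m d)" by (simp add: beta_distr_def beta_dens_def)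
  have z: "x \<le> 0 \<Longrightarrow> beta_dens m d x = 0" for x by (simp add: beta_dens_def)
  show "prob_space (beta_distr (real m) (real d))" "sets (beta_distr (real m) (real d)) = sets borel"
    "emeasure (beta_distr (real m) (real d)) {x} = 0" "AE x in beta_distr (real m) (real d). x > 0"
    unfolding e using finite_density_prop[OF finite_density_beta[OF assms] z] by auto
qed

lemma gga_distr_props:
  assumes "a \<ge> 1" "l \<ge> 1"
  shows "prob_space (gga_distr (real a) (real (Suc l)))" "sets (gga_distr (real a) (real (Suc l))) = sets borel"
    "emeasure (gga_distr (real a) (real (Suc l))) {x} = 0" "AE x in gga_distr (real a) (real (Suc l)). x > 0"
proof -
  have z: "x \<le> 0 \<Longrightarrow> gga_dens a (Suc l) x = 0" for x by (simp add: gga_dens_def)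
  show "prob_space (gga_distr (real a) (real (Suc l)))" "sets (gga_distr (real a) (real (Suc l))) = sets borel"
    "emeasure (gga_distr (real a) (real (Suc l))) {x} = 0" "AE x in gga_distr (real a) (real (Suc l)). x > 0"
    unfolding gga_distr_eq using finite_density_prop[OF finite_density_gga[OF assms] z] by auto
qed

text \<open>The last coordinate is treated like the others, with the urn in place of the Polya kernels; the
  inverse moment of the urn turns the error \<open>C / (y - 1)\<close> of the chain into the rate.\<close>

lemma (in polya_chain) urn_chain_rate:
  fixes l c :: nat
  assumes l: "l \<ge> 1" and B_r: "B r = gga_distr (real (m r)) (real (Suc l))"
  defines "\<beta> \<equiv> real l / (real l + 1)"
  shows "\<exists>C>0. \<forall>k K. K \<in> sets borel \<longrightarrow> cvx K \<longrightarrow> depends_on {1..r} K \<longrightarrow>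
    \<bar>measure_pmf.prob (bind_pmf (walk (urn_total l (m r)) (m r) (l * Suc k)) (polya_sums m d r))
        {x. (\<lambda>i. 1 / ((real l + 1) * real (Suc k + c) powr \<beta>) * real (x i)) \<in> K}
      - measure P {\<xi> \<in> space P. Zv \<xi> \<in> K}\<bar> \<le> C / real (Suc k + c) powr \<beta>"
proof -
  have a: "m r \<ge> 1" using m[of r] r by simp
  obtain C where C: "C \<ge> 0" "r = 1 \<Longrightarrow> C = 0"
    and ch: "\<And>K \<epsilon> y. K \<in> sets borel \<Longrightarrow> cvx K \<Longrightarrow> \<epsilon> > 0 \<Longrightarrow> m r \<le> y \<Longrightarrow>
    \<bar>measure_pmf.prob (polya_sums m d r y) {x. (\<lambda>i. \<epsilon> * real (x i)) \<in> K}
      - measure P {\<xi> \<in> space P. beta_sums r (\<epsilon> * real y) \<xi> \<in> K}\<bar> \<le> C / (real y - 1)"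
    using chain_discrepancy[of r] r by auto
  obtain G where G: "G > 0" "\<And>k t. \<bar>measure_pmf.prob (walk (urn_total l (m r)) (m r) (l * Suc k))
        {x. real x / ((real l + 1) * real (Suc k + c) powr (real l / (real l + 1))) \<le> t}
      - measure (gga_distr (real (m r)) (real (Suc l))) {..t}\<bar> \<le> G / real (Suc k + c) powr (real l / (real l + 1))"
    using urn_gga_kolmogorov[OF a l, of c] by blast
  obtain D where D: "D > 0" "\<And>k. (\<Prod>t<l * Suc k. 1 - 1 / real (urn_total l (m r) t)) \<le> D / real (Suc k + c) powr (real l / (real l + 1))"
    using urn_inverse_decay[OF l, of "m r" c] by blast
  have "\<bar>measure_pmf.prob (bind_pmf (walk (urn_total l (m r)) (m r) (l * Suc k)) (polya_sums m d r))
        {x. (\<lambda>i. 1 / ((real l + 1) * real (Suc k + c) powr \<beta>) * real (x i)) \<in> K}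
      - measure P {\<xi> \<in> space P. Zv \<xi> \<in> K}\<bar> \<le> (C * D + 2 * G) / real (Suc k + c) powr \<beta>"
    if K: "K \<in> sets borel" "cvx K" "depends_on {1..r} K" for k K
  proof -
    define p where "p = walk (urn_total l (m r)) (m r) (l * Suc k)"
    define \<epsilon> where "\<epsilon> = 1 / ((real l + 1) * real (Suc k + c) powr \<beta>)"
    have \<epsilon>: "\<epsilon> > 0" by (simp add: \<epsilon>_def)
    have rr: "r \<in> {1..r}" using r by simp
    \<comment> \<open>The two sequences differ beyond \<open>r\<close>, where \<open>Zvar\<close>
      continues with the value of the last factor and \<open>beta_sums\<close> with 0.\<close>
    have "Zv \<xi> \<in> K \<longleftrightarrow> beta_sums r (\<xi> r * 1) \<xi> \<in> K" for \<xi>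
      by (rule depends_onD[OF K(3)]) (auto simp: Zv_def Zvar_def beta_sums_def)
    hence Z: "{\<xi> \<in> space P. Zv \<xi> \<in> K} = {\<xi> \<in> space P. beta_sums r (\<xi> r * 1) \<xi> \<in> K}" by simp
    have "\<bar>measure_pmf.prob (bind_pmf p (polya_sums m d r)) {x. (\<lambda>i. \<epsilon> * real (x i)) \<in> K}
      - measure P {\<xi> \<in> space P. beta_sums r (\<xi> r * 1) \<xi> \<in> K}\<bar>
      \<le> C * measure_pmf.expectation p (\<lambda>t. 1 / (real t - 1)) + 2 * (G / real (Suc k + c) powr \<beta>)"
    proof (rule chain_step[OF rr _ K(1,2)])
      show "finite (set_pmf p)" unfolding p_def by (rule finite_set_pmf_walk)
      fix t assume "t \<in> set_pmf p"
      hence "m r \<le> t" using set_pmf_walk unfolding p_def by fastforce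
      thus "\<bar>measure_pmf.prob (polya_sums m d r t) {x. (\<lambda>i. \<epsilon> * real (x i)) \<in> K}
          - measure P {\<xi> \<in> space P. beta_sums r (\<epsilon> * real t) \<xi> \<in> K}\<bar> \<le> C / (real t - 1)"
        using ch K \<epsilon> by blast
    next
      fix u
      show "\<bar>measure_pmf.prob p {t. \<epsilon> * real t / 1 \<le> u} - measure (B r) {..u}\<bar> \<le> G / real (Suc k + c) powr \<beta>"
        using G(2)[of k u] unfolding p_def B_r \<epsilon>_def \<beta>_def by simp
    qed simp
    also have "C * measure_pmf.expectation p (\<lambda>t. 1 / (real t - 1)) \<le> C * (D / real (Suc k + c) powr \<beta>)"
    proof (cases "r = 1")
      case False
      hence a2: "m r \<ge> 2" using m[of r] r by auto
      have "measure_pmf.expectation p (\<lambda>t. 1 / (real t - 1)) = (\<Prod>t<l * Suc k. 1 - 1 / real (urn_total l (m r) t)) / (real (m r) - 1)"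
        unfolding p_def using a2 by (intro expectation_walk_inverse) (auto intro: less_imp_le urn_total_gt)
      also have "\<dots> \<le> (\<Prod>t<l * Suc k. 1 - 1 / real (urn_total l (m r) t)) / 1"
      proof (rule divide_left_mono)
        show "0 \<le> (\<Prod>t<l * Suc k. 1 - 1 / real (urn_total l (m r) t))"
          by (intro prod_nonneg) (auto simp: urn_total_def)
      qed (use a2 in auto)
      also have "\<dots> \<le> D / real (Suc k + c) powr \<beta>" using D(2)[of k] by (simp add: \<beta>_def)
      finally show ?thesis using C(1) by (rule mult_left_mono)
    qed (use C in auto)
    finally show ?thesis unfolding Z p_def[symmetric] \<epsilon>_def[symmetric] by (simp add: add_divide_distrib)
  qed
  moreover have "C * D + 2 * G > 0" using C D G by (intro add_nonneg_pos) auto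
  ultimately show ?thesis by blast
qed

theorem theorem1p1:
  fixes M :: model and l s r :: nat and d :: "nat \<Rightarrow> nat"
  assumes "l \<ge> 1" and "s \<ge> 1" and "\<And>i. i \<in> {1..s} \<Longrightarrow> d i > 0" and "r \<ge> s"
  shows "\<exists>C>0. \<forall>n\<ge>1. \<forall>K. convex_in r K \<longrightarrow>
     \<bar>measure_pmf.prob (weights M l s d n) {w. Dvec l r n w \<in> K}
        - measure (Y_law M l s d r) K\<bar> \<le> C / real n powr (real l / (real l + 1))"
proof -
  define mm where "mm = base_total M l s d"
  define dd where "dd = base_weight s d"
  define \<beta> where "\<beta> = real l / (real l + 1)"
  \<comment> \<open>The uniform law outside \<open>{1..r}\<close> is a filler, because
    \<open>chain_factors\<close> makes its assumptions at every index.\<close>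
  define B where "B i = (if i \<in> {1..r} then factor_distr M l s d r i else beta_distr 1 1)" for i
  have r1: "r \<ge> 1" using assms by simp
  have mm_ge: "k \<le> mm k" for k unfolding mm_def by (rule base_total_ge[OF assms(3)])
  have dd_ge: "1 \<le> dd k" if "1 \<le> k" for k
    using assms(3)[of "k + 1"] that by (auto simp: dd_def base_weight_def)
  have B_beta: "B k = beta_distr (real (mm k)) (real (dd k))" if "1 \<le> k" "k < r" for k
    using that by (simp add: B_def factor_distr_def mm_def dd_def base_total_def base_weight_def)
  have B_r: "B r = gga_distr (real (mm r)) (real (Suc l))"
    using assms(4) r1 by (simp add: B_def factor_distr_def mm_def base_total_def add.commute)
  have B_out: "B k = beta_distr (real 1) (real 1)" if "\<not> (1 \<le> k \<and> k \<le> r)" for k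
    using that by (auto simp: B_def)
  have Bp: "prob_space (B k) \<and> sets (B k) = sets borel \<and> (\<forall>x. emeasure (B k) {x} = 0) \<and> (AE x in B k. x > 0)" for k
  proof -
    consider "1 \<le> k" "k < r" | "k = r" | "\<not> (1 \<le> k \<and> k \<le> r)" by linarith
    thus ?thesis
    proof cases
      case 1
      have "mm k \<ge> 1" using mm_ge[of k] 1 by simp
      thus ?thesis using 1 dd_ge beta_distr_props[of "mm k" "dd k"] unfolding B_beta[OF 1] by blast
    next
      case 2
      have "mm r \<ge> 1" using mm_ge[of r] r1 by simp
      thus ?thesis using gga_distr_props[of "mm r" l] assms(1) unfolding 2 B_r by blast
    next
      case 3
      show ?thesis using beta_distr_props[of 1 1] unfolding B_out[OF 3] by auto
    qed
  qed
  have cf: "chain_factors B r"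
  proof (rule chain_factors.intro)
    show "prob_space (B k)" "sets (B k) = sets borel" "emeasure (B k) {x} = 0" "AE x in B k. x > 0" for k x
      using Bp[of k] by blast+
  qed (rule r1)
  have pc: "polya_chain B r mm dd"
  proof (rule polya_chain.intro[OF cf], rule polya_chain_axioms.intro)
    show "mm k + dd k \<le> mm (Suc k)" for k unfolding mm_def dd_def by (rule base_total_Suc)
    show "k \<le> mm k" for k by (rule mm_ge)
    show "1 \<le> k \<Longrightarrow> 1 \<le> dd k" for k by (rule dd_ge)
    show "1 \<le> k \<Longrightarrow> k < r \<Longrightarrow> B k = beta_distr (real (mm k)) (real (dd k))" for k by (rule B_beta)
  qed
  interpret polya_chain B r mm dd by (rule pc)
  have "\<exists>c. \<forall>k. map_pmf (psum r) (weights M l s d (Suc k + c))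
     = bind_pmf (walk (urn_total l (mm r)) (mm r) (l * Suc k)) (polya_sums mm dd r)"
    unfolding mm_def dd_def by (rule weights_law[OF assms(1,2) _ assms(4)]) (rule assms(3))
  then obtain c where c: "\<And>k. map_pmf (psum r) (weights M l s d (Suc k + c))
     = bind_pmf (walk (urn_total l (mm r)) (mm r) (l * Suc k)) (polya_sums mm dd r)"
    by blast
  obtain C where C: "C > 0" "\<And>k K. K \<in> sets borel \<Longrightarrow> cvx K \<Longrightarrow> depends_on {1..r} K \<Longrightarrow>
    \<bar>measure_pmf.prob (bind_pmf (walk (urn_total l (mm r)) (mm r) (l * Suc k)) (polya_sums mm dd r))
        {x. (\<lambda>i. 1 / ((real l + 1) * real (Suc k + c) powr \<beta>) * real (x i)) \<in> K}
      - measure P {\<xi> \<in> space P. Zv \<xi> \<in> K}\<bar> \<le> C / real (Suc k + c) powr \<beta>"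
    using urn_chain_rate[OF assms(1) B_r, of c] unfolding \<beta>_def by blast
  have P_eq: "PiM {1..r} (factor_distr M l s d r) = P"
    unfolding P_def by (rule PiM_cong) (auto simp: B_def)
  have Yvar_eq: "Yvar r \<xi> = increments r (Zv \<xi>)" for \<xi>
    by (auto simp: Yvar_def increments_def Zv_def Zvar_def fun_eq_iff)
  have borel_UNIV: "sets (PiM UNIV (\<lambda>_::nat. borel :: real measure)) = sets borel" by (rule sets_PiM_equal_borel)
  have mY: "Yvar r \<in> measurable P (PiM UNIV (\<lambda>_. borel))"
  proof -
    have "increments r \<circ> Zv \<in> measurable P borel" by (rule measurable_comp[OF measurable_Zv measurable_increments])
    moreover have "increments r \<circ> Zv = Yvar r" by (auto simp: Yvar_eq)
    ultimately show ?thesis using measurable_cong_sets[OF refl borel_UNIV, of P] by simp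
  qed
  define \<mu> where "\<mu> = distr P (PiM UNIV (\<lambda>_. borel)) (Yvar r)"
  interpret \<mu>: prob_space \<mu> unfolding \<mu>_def by (rule pP.prob_space_distr[OF mY])
  have Y: "Y_law M l s d r = completion \<mu>" unfolding Y_law_def \<mu>_def P_eq ..
  have sets_\<mu>: "sets \<mu> = sets borel" by (simp add: \<mu>_def borel_UNIV)
  interpret c\<mu>: prob_space "completion \<mu>" by (rule \<mu>.prob_space_completion)
  have main: "\<bar>measure_pmf.prob (weights M l s d (Suc k + c)) {w. Dvec l r (Suc k + c) w \<in> K}
        - measure (Y_law M l s d r) K\<bar> \<le> C / real (Suc k + c) powr \<beta>" if K: "convex_in r K" for k K
  proof -
    \<comment> \<open>The set \<open>K\<close> in terms of sums, as a cylinder in the full sequence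
      space, so that its interior is not forced to be empty.\<close>
    define Kz where "Kz = {z. increments r z \<in> K}"
    define n where "n = Suc k + c"
    define \<epsilon> where "\<epsilon> = 1 / ((real l + 1) * real n powr \<beta>)"
    define q where "q = bind_pmf (walk (urn_total l (mm r)) (mm r) (l * Suc k)) (polya_sums mm dd r)"
    define S where "S A = measure_pmf.prob q {x. (\<lambda>i. \<epsilon> * real (x i)) \<in> A}" for A
    define Q where "Q A = measure P {\<xi> \<in> space P. Zv \<xi> \<in> A}" for A
    have Kz: "cvx Kz" "depends_on {1..r} Kz"
      unfolding Kz_def using cvx_increments_vimage[OF K] depends_on_increments_vimage by auto
    have int: "interior Kz \<in> sets borel" "cvx (interior Kz)" "depends_on {1..r} (interior Kz)"
      using Kz by (auto intro: cvx_interior depends_on_interior)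
    have cl: "closure Kz \<in> sets borel" "cvx (closure Kz)" "depends_on {1..r} (closure Kz)"
      using Kz by (auto intro: cvx_closure depends_on_closure)
    have SQ: "\<bar>S A - Q A\<bar> \<le> C / real n powr \<beta>" if "A \<in> sets borel" "cvx A" "depends_on {1..r} A" for A
      using C(2)[OF that, of k] unfolding S_def Q_def q_def \<epsilon>_def n_def .
    have D_eq: "measure_pmf.prob (weights M l s d n) {w. Dvec l r n w \<in> K} = S Kz"
    proof -
      have "Dvec l r n w = increments r (\<lambda>i. \<epsilon> * real (psum r w i))" for w
      proof
        fix i
        show "Dvec l r n w i = increments r (\<lambda>i. \<epsilon> * real (psum r w i)) i"
        proof (cases "i \<in> {1..r}")
          case True
          then obtain j where j: "i = Suc j" by (cases i) auto
          show ?thesis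
          proof (cases "j = 0")
            case True
            thus ?thesis using \<open>i \<in> {1..r}\<close> j
              by (simp add: Dvec_def increments_def psum_def \<epsilon>_def \<beta>_def)
          next
            case False
            hence "psum r w i = psum r w j + w i" using \<open>i \<in> {1..r}\<close> j by (simp add: psum_def)
            thus ?thesis using \<open>i \<in> {1..r}\<close> j False
              by (simp add: Dvec_def increments_def \<epsilon>_def \<beta>_def distrib_left add_divide_distrib)
          qed
        qed (auto simp: Dvec_def increments_def)
      qed
      hence "{w. Dvec l r n w \<in> K} = psum r -` {x. (\<lambda>i. \<epsilon> * real (x i)) \<in> Kz}" by (auto simp: Kz_def)
      thus ?thesis unfolding S_def q_def c[symmetric] n_def by simp
    qed
    have S_mono: "S A \<le> S A'" if "A \<subseteq> A'" for A A'
      unfolding S_def using that by (intro measure_pmf.finite_measure_mono) auto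
    have preP: "{\<xi> \<in> space P. Zv \<xi> \<in> A} \<in> sets P" if "A \<in> sets borel" for A
    proof -
      have "{\<xi> \<in> space P. Zv \<xi> \<in> A} = Zv -` A \<inter> space P" by auto
      thus ?thesis using measurable_sets[OF measurable_Zv that] by simp
    qed
    \<comment> \<open>Serves twice: it makes \<open>K\<close> measurable for the completion, and it
      gives the interior and the closure, between which the law of the graph is squeezed, the same
      limit value.\<close>
    have Q_eq: "Q (closure Kz) = Q (interior Kz)"
      unfolding Q_def
    proof (rule measure_eq_AE)
      show "AE \<xi> in P. (\<xi> \<in> {\<xi> \<in> space P. Zv \<xi> \<in> closure Kz}) = (\<xi> \<in> {\<xi> \<in> space P. Zv \<xi> \<in> interior Kz})"
        using frontier_null[OF order_refl _ Kz]
      proof (rule eventually_mono)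
        fix \<xi> assume "Zv \<xi> \<notin> frontier Kz"
        thus "(\<xi> \<in> {\<xi> \<in> space P. Zv \<xi> \<in> closure Kz}) = (\<xi> \<in> {\<xi> \<in> space P. Zv \<xi> \<in> interior Kz})"
          using interior_subset closure_subset by (auto simp: frontier_def)
      qed simp
    qed (use preP int cl in auto)
    \<comment> \<open>The Borel sets \<open>lift (interior Kz)\<close> and \<open>lift (closure Kz)\<close> enclose \<open>K\<close>, which itself is only
      measurable with respect to the completion.\<close>
    define lift where "lift A = Rvec r \<inter> cumsum r -` A" for A
    have lift: "lift A \<in> sets \<mu>" if "A \<in> sets borel" for A
      using measurable_sets[OF measurable_cumsum that] Rvec_borel unfolding sets_\<mu> lift_def by simp
    have measure_lift: "measure \<mu> (lift A) = Q A" if A: "A \<in> sets borel" "depends_on {1..r} A" for A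
    proof -
      have "Yvar r \<xi> \<in> lift A \<longleftrightarrow> Zv \<xi> \<in> A" for \<xi>
      proof -
        have "cumsum r (increments r (Zv \<xi>)) \<in> A \<longleftrightarrow> Zv \<xi> \<in> A"
          by (rule depends_onD[OF A(2)]) (rule cumsum_increments)
        thus ?thesis unfolding Yvar_eq lift_def using increments_in_Rvec by auto
      qed
      hence "Yvar r -` lift A \<inter> space P = {\<xi> \<in> space P. Zv \<xi> \<in> A}" by auto
      moreover have "measure \<mu> (lift A) = measure P (Yvar r -` lift A \<inter> space P)"
        unfolding \<mu>_def using lift[OF A(1)] unfolding \<mu>_def sets_distr by (rule measure_distr[OF mY])
      ultimately show ?thesis by (simp add: Q_def)
    qed
    have lK: "lift Kz = K"
      using K increments_cumsum unfolding lift_def Kz_def convex_in_def by force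
    have sub: "lift (interior Kz) \<subseteq> K" "K \<subseteq> lift (closure Kz)"
      unfolding lK[symmetric] lift_def using interior_subset closure_subset by blast+
    have "measure \<mu> (lift (closure Kz) - lift (interior Kz)) = 0"
      using lift int cl sub measure_lift Q_eq by (subst \<mu>.finite_measure_Diff) auto
    hence null: "lift (closure Kz) - lift (interior Kz) \<in> null_sets \<mu>"
      using lift int cl by (intro null_setsI) (auto simp: \<mu>.emeasure_eq_measure)
    have K_sets: "K \<in> sets (completion \<mu>)"
    proof -
      have "K - lift (interior Kz) \<subseteq> lift (closure Kz) - lift (interior Kz)" using sub by auto
      hence "lift (interior Kz) \<union> (K - lift (interior Kz)) \<in> sets (completion \<mu>)"
        using null lift[OF int(1)] by (intro sets_completionI[OF refl]) auto
      moreover have "lift (interior Kz) \<union> (K - lift (interior Kz)) = K" using sub by auto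
      ultimately show ?thesis by simp
    qed
    have "measure (completion \<mu>) (lift (interior Kz)) \<le> measure (completion \<mu>) K"
      using K_sets sub by (intro c\<mu>.finite_measure_mono) auto
    moreover have "measure (completion \<mu>) K \<le> measure (completion \<mu>) (lift (closure Kz))"
      using lift[OF cl(1)] sub by (intro c\<mu>.finite_measure_mono) auto
    ultimately have YK: "measure (Y_law M l s d r) K = Q (interior Kz)"
      unfolding Y using lift int cl measure_lift Q_eq by (simp add: measure_completion)
    have "S (interior Kz) \<le> S Kz" "S Kz \<le> S (closure Kz)"
      using S_mono interior_subset closure_subset by blast+
    thus ?thesis using SQ[OF int] SQ[OF cl] unfolding Q_eq n_def[symmetric] D_eq YK by linarith
  qed
  \<comment> \<open>\<open>main\<close> does not cover \<open>n \<le> c\<close>; there the second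
    summand makes the bound at least 1.\<close>
  define C' where "C' = C + real (Suc c) powr \<beta>"
  have \<beta>: "\<beta> \<ge> 0" by (simp add: \<beta>_def)
  have C': "C' > 0" "C \<le> C'" using C(1) by (auto simp: C'_def intro: add_pos_nonneg)
  show ?thesis
  proof (intro exI[of _ C'] conjI C' allI impI, fold \<beta>_def)
    fix n :: nat and K assume n: "n \<ge> 1" and K: "convex_in r K"
    show "\<bar>measure_pmf.prob (weights M l s d n) {w. Dvec l r n w \<in> K} - measure (Y_law M l s d r) K\<bar> \<le> C' / real n powr \<beta>"
    proof (cases "n > c")
      case True
      then obtain k where k: "n = Suc k + c" by (metis add.commute add_Suc_right less_natE)
      have "C / real n powr \<beta> \<le> C' / real n powr \<beta>" using C' by (intro divide_right_mono) auto
      thus ?thesis using main[OF K, of k] unfolding k by linarith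
    next
      case False
      have "real n powr \<beta> \<le> real (Suc c) powr \<beta>" using False \<beta> by (intro powr_mono2) auto
      hence "real n powr \<beta> \<le> C'" using C(1) by (simp add: C'_def)
      hence "1 \<le> C' / real n powr \<beta>" using n by (simp add: field_simps)
      moreover have "measure (Y_law M l s d r) K \<le> 1" "0 \<le> measure (Y_law M l s d r) K"
        unfolding Y using c\<mu>.prob_le_1 by auto
      moreover have "measure_pmf.prob (weights M l s d n) {w. Dvec l r n w \<in> K} \<le> 1"
        "0 \<le> measure_pmf.prob (weights M l s d n) {w. Dvec l r n w \<in> K}" by auto
      ultimately show ?thesis by linarith
    qed
  qed
qed

end
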